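(* Let $n\ge m$ be positive integers. Then the restriction $\boldsymbol\pi^{(m)}_{n,n+1}$ of $\boldsymbol\pi_{n,n+1}$ to $\boldsymbol\zeta(n+1)^{(m)}$ and the restriction $\mathbf{i}^{(m)}_{n+1,n}$ of $\mathbf{i}_{n+1,n}$ to $\boldsymbol\zeta(n)^{(m)}$ are inverse of each other.
   Context: $\boldsymbol\zeta(n)$ is the center of $\mathbf{U}(gl(n))$, $gl(n)=gl(n,\mathbb C)$ with standard basis $e_{i,j}$; $\boldsymbol\zeta(n)^{(m)}$ is the $m$-th filtration element of $\boldsymbol\zeta(n)$ for the filtration induced by the standard filtration of $\mathbf{U}(gl(n))$. For a matrix with noncommuting entries, $\mathbf{cdet}(A)=\sum_\sigma(-1)^{|\sigma|}a_{\sigma(1),1}\cdots a_{\sigma(k),k}$. For $1\le k\le n$, $$\mathbf{H}_k(n)=\sum_{1\le i_1<\cdots<i_k\le n}\mathbf{cdet}\big[e_{i_a,i_b}+\delta_{ab}(k-a)\big]_{a,b=1,\dots,k}.$$ By a theorem of Capelli, $\mathbf{H}_1(n),\dots,\mathbf{H}_n(n)$ are algebraically independent generators of $\boldsymbol\zeta(n)$. The Capelli monomorphism $\mathbf{i}_{n+1,n}:\boldsymbol\zeta(n)\to\boldsymbol\zeta(n+1)$ is the algebra map with $\mathbf{i}_{n+1,n}(\mathbf{H}_k(n))=\mathbf{H}_k(n+1)$, $k=1,\dots,n$. The projection $\boldsymbol\pi_{n,n+1}:\boldsymbol\zeta(n+1)\to\boldsymbol\zeta(n)$ is the algebra map with $\boldsymbol\pi_{n,n+1}(\mathbf{H}_k(n+1))=\mathbf{H}_k(n)$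 for $k=1,\dots,n$ and $\boldsymbol\pi_{n,n+1}(\mathbf{H}_{n+1}(n+1))=0$. *)

theory Defs
  imports
    "HOL-Library.Poly_Mapping"
    "HOL-Combinatorics.Permutations"
    "HOL-Algebra.QuotRing"
    Complex_Main
begin

section \<open>The tensor algebra of gl(n)\<close>

text \<open>
  Words form the free monoid, written additively so that \<open>'a word \<Rightarrow>\<^sub>0 complex\<close>,
  with the convolution product of \<^theory>\<open>HOL-Library.Poly_Mapping\<close>, is the free associative
  unital complex algebra on \<^typ>\<open>'a\<close>.
\<close>

datatype 'a word = Word (letters: "'a list")

instantiation word :: (type) monoid_add
begin

definition zero_word :: "'a word" where
  "0 = Word []"

definition plus_word :: "'a word \<Rightarrow> 'a word \<Rightarrow> 'a word" where
  "v + w = Word (letters v @ letters w)"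

instance
  by standard (simp_all add: zero_word_def plus_word_def)

end

type_synonym gl_tensor = "(nat \<times> nat) word \<Rightarrow>\<^sub>0 complex"

definition gen :: "nat \<Rightarrow> nat \<Rightarrow> gl_tensor" where
  "gen i j = Poly_Mapping.single (Word [(i, j)]) 1"

text \<open>
  The tensor algebra of gl(n) is the free algebra on the basis e(i,j), 1 \<open>\<le>\<close> i, j \<open>\<le>\<close> n.
\<close>

definition tensor_alg :: "nat \<Rightarrow> gl_tensor ring" where
  "tensor_alg n =
     \<lparr>carrier = {p. \<forall>w \<in> Poly_Mapping.keys p. set (letters w) \<subseteq> {1..n} \<times> {1..n}},
      mult = (*), one = 1, zero = 0, add = (+)\<rparr>"

lemma letters_0 [simp]: "letters 0 = []"
  by (simp add: zero_word_def)

lemma letters_plus [simp]: "letters (v + w) = letters v @ letters w"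
  by (simp add: plus_word_def)

lemma tensor_alg_ring: "ring (tensor_alg n)"
proof -
  have mult: "p * q \<in> carrier (tensor_alg n)"
    if "p \<in> carrier (tensor_alg n)" "q \<in> carrier (tensor_alg n)" for p q
  proof -
    have "set (letters w) \<subseteq> {1..n} \<times> {1..n}" if w: "w \<in> Poly_Mapping.keys (p * q)" for w
    proof -
      obtain u v where "w = u + v" "u \<in> Poly_Mapping.keys p" "v \<in> Poly_Mapping.keys q"
        using w keys_mult[of p q] by blast
      then show ?thesis
        using \<open>p \<in> _\<close> \<open>q \<in> _\<close> by (simp add: tensor_alg_def)
    qed
    then show ?thesis by (simp add: tensor_alg_def)
  qed
  have add: "p + q \<in> carrier (tensor_alg n)"
    if "p \<in> carrier (tensor_alg n)" "q \<in> carrier (tensor_alg n)" for p q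
  proof -
    have "set (letters w) \<subseteq> {1..n} \<times> {1..n}" if w: "w \<in> Poly_Mapping.keys (p + q)" for w
    proof -
      have "w \<in> Poly_Mapping.keys p \<or> w \<in> Poly_Mapping.keys q"
        using w Poly_Mapping.keys_add[of p q] by blast
      then show ?thesis
        using \<open>p \<in> _\<close> \<open>q \<in> _\<close> by (auto simp add: tensor_alg_def)
    qed
    then show ?thesis by (simp add: tensor_alg_def)
  qed
  have neg: "- p \<in> carrier (tensor_alg n)" if "p \<in> carrier (tensor_alg n)" for p
    using that by (simp add: tensor_alg_def)
  have abelian: "abelian_group (tensor_alg n)"
  proof (rule abelian_groupI)
    fix p assume p: "p \<in> carrier (tensor_alg n)"
    show "\<exists>q\<in>carrier (tensor_alg n). q \<oplus>\<^bsub>tensor_alg n\<^esub> p = \<zero>\<^bsub>tensor_alg n\<^esub>"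
      by (rule bexI[OF _ neg[OF p]]) (simp add: tensor_alg_def)
  next
    fix p q assume "p \<in> carrier (tensor_alg n)" "q \<in> carrier (tensor_alg n)"
    then show "p \<oplus>\<^bsub>tensor_alg n\<^esub> q \<in> carrier (tensor_alg n)"
      using add[of p q] by (simp add: tensor_alg_def)
  qed (simp_all add: tensor_alg_def add.assoc add.commute)
  have monoid: "Group.monoid (tensor_alg n)"
  proof (rule monoidI)
    fix p q assume "p \<in> carrier (tensor_alg n)" "q \<in> carrier (tensor_alg n)"
    then show "p \<otimes>\<^bsub>tensor_alg n\<^esub> q \<in> carrier (tensor_alg n)"
      using mult[of p q] by (simp add: tensor_alg_def)
  qed (simp_all add: tensor_alg_def mult.assoc)
  show ?thesis
    by (rule ringI[OF abelian monoid])
       (simp_all add: tensor_alg_def distrib_left distrib_right)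
qed

section \<open>The universal enveloping algebra of gl(n)\<close>

text \<open>
  In gl(n) one has [e(i,j), e(k,l)] = \<open>\<delta>\<^sub>j\<^sub>k\<close> e(i,l) - \<open>\<delta>\<^sub>l\<^sub>i\<close> e(k,j).  By bilinearity, the
  relations xy - yx - [x,y] for basis elements x, y generate the same two-sided ideal as the
  relations for all x, y in gl(n).
\<close>

definition gl_bracket :: "nat \<Rightarrow> nat \<Rightarrow> nat \<Rightarrow> nat \<Rightarrow> gl_tensor" where
  "gl_bracket i j k l = (if j = k then gen i l else 0) - (if l = i then gen k j else 0)"

definition gl_relations :: "nat \<Rightarrow> gl_tensor set" where
  "gl_relations n =
     {gen i j * gen k l - gen k l * gen i j - gl_bracket i j k l | i j k l.
        i \<in> {1..n} \<and> j \<in> {1..n} \<and> k \<in> {1..n} \<and> l \<in> {1..n}}"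

definition gl_ideal :: "nat \<Rightarrow> gl_tensor set" where
  "gl_ideal n = genideal (tensor_alg n) (gl_relations n)"

definition U :: "nat \<Rightarrow> gl_tensor set ring" where
  "U n = tensor_alg n Quot gl_ideal n"

definition U_class :: "nat \<Rightarrow> gl_tensor \<Rightarrow> gl_tensor set" where
  "U_class n p = gl_ideal n +>\<^bsub>tensor_alg n\<^esub> p"

definition E :: "nat \<Rightarrow> nat \<Rightarrow> nat \<Rightarrow> gl_tensor set" where
  "E n i j = U_class n (gen i j)"

definition U_smult :: "nat \<Rightarrow> complex \<Rightarrow> gl_tensor set \<Rightarrow> gl_tensor set" where
  "U_smult n c x = U_class n (Poly_Mapping.single 0 c) \<otimes>\<^bsub>U n\<^esub> x"

definition U_filt :: "nat \<Rightarrow> nat \<Rightarrow> gl_tensor set set" where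
  "U_filt n m = U_class n `
     {p \<in> carrier (tensor_alg n). \<forall>w \<in> Poly_Mapping.keys p. length (letters w) \<le> m}"

section \<open>The center and its filtration\<close>

definition center :: "('a, 'b) ring_scheme \<Rightarrow> 'a set" where
  "center R = {z \<in> carrier R. \<forall>x \<in> carrier R. z \<otimes>\<^bsub>R\<^esub> x = x \<otimes>\<^bsub>R\<^esub> z}"

definition zeta :: "nat \<Rightarrow> gl_tensor set ring" where
  "zeta n = (U n)\<lparr>carrier := center (U n)\<rparr>"

definition zeta_filt :: "nat \<Rightarrow> nat \<Rightarrow> gl_tensor set set" where
  "zeta_filt n m = carrier (zeta n) \<inter> U_filt n m"

section \<open>Column determinants and Capelli elements\<close>

definition cdet :: "('a, 'b) ring_scheme \<Rightarrow> nat \<Rightarrow> (nat \<Rightarrow> nat \<Rightarrow> 'a) \<Rightarrow> 'a" where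
  "cdet R k A =
     (\<Oplus>\<^bsub>R\<^esub>\<sigma> \<in> {\<sigma>. \<sigma> permutes {1..k}}.
        [(sign \<sigma> :: int)] \<cdot>\<^bsub>R\<^esub> foldr (\<otimes>\<^bsub>R\<^esub>) (map (\<lambda>j. A (\<sigma> j) j) [1..<Suc k]) \<one>\<^bsub>R\<^esub>)"

text \<open>
  The increasing sequences \<open>i\<^sub>1 < \<dots> < i\<^sub>k\<close> are lists, so \<open>i\<^sub>a\<close> is \<open>v ! (a - 1)\<close>.
\<close>

definition Capelli_H :: "nat \<Rightarrow> nat \<Rightarrow> gl_tensor set" where
  "Capelli_H n k =
     (\<Oplus>\<^bsub>U n\<^esub>v \<in> {v. length v = k \<and> sorted_wrt (<) v \<and> set v \<subseteq> {1..n}}.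
        cdet (U n) k (\<lambda>a b. E n (v ! (a - 1)) (v ! (b - 1))
          \<oplus>\<^bsub>U n\<^esub> (if a = b then [(k - a)] \<cdot>\<^bsub>U n\<^esub> \<one>\<^bsub>U n\<^esub> else \<zero>\<^bsub>U n\<^esub>)))"

section \<open>The Capelli monomorphism and the projection\<close>

definition zeta_alg_hom ::
    "nat \<Rightarrow> nat \<Rightarrow> (gl_tensor set \<Rightarrow> gl_tensor set) \<Rightarrow> bool" where
  "zeta_alg_hom n n' f \<longleftrightarrow>
     f \<in> ring_hom (zeta n) (zeta n') \<and>
     (\<forall>c. \<forall>z \<in> carrier (zeta n). f (U_smult n c z) = U_smult n' c (f z))"

text \<open>
  As the Capelli elements freely generate the center (Capelli), each of the following two
  predicates determines its map on the center; values outside the center are irrelevant.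
\<close>

definition is_Capelli_mono :: "nat \<Rightarrow> (gl_tensor set \<Rightarrow> gl_tensor set) \<Rightarrow> bool" where
  "is_Capelli_mono n \<iota> \<longleftrightarrow>
     zeta_alg_hom n (n + 1) \<iota> \<and>
     (\<forall>k \<in> {1..n}. \<iota> (Capelli_H n k) = Capelli_H (n + 1) k)"

definition is_Capelli_proj :: "nat \<Rightarrow> (gl_tensor set \<Rightarrow> gl_tensor set) \<Rightarrow> bool" where
  "is_Capelli_proj n \<pi> \<longleftrightarrow>
     zeta_alg_hom (n + 1) n \<pi> \<and>
     (\<forall>k \<in> {1..n}. \<pi> (Capelli_H (n + 1) k) = Capelli_H n k) \<and>
     \<pi> (Capelli_H (n + 1) (n + 1)) = \<zero>\<^bsub>zeta n\<^esub>"

end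

theory Submission
  imports Defs "HOL-Analysis.Analysis" "Jordan_Normal_Form.Determinant"
begin

text \<open>
  The filtration element \<open>\<zeta>(n)\<^sup>(\<^sup>m\<^sup>)\<close> is spanned by the monomials in the Capelli elements
  of weight at most \<open>m\<close>, where \<open>H\<^sub>k\<close> has weight \<open>k\<close>. For \<open>m \<le> n\<close> such monomials only
  involve \<open>H\<^sub>1, \<dots>, H\<^sub>m\<close>, on which the two maps are inverse to each other.

  The spanning property is proved by induction on \<open>m\<close>. Letting \<open>gl(n)\<close> act on polynomial functions
  of a matrix \<open>Y\<close>, the basis element \<open>e(i,j)\<close> as multiplication by \<open>Y\<^sub>i\<^sub>j\<close> plus the derivation that
  preserves the degree, shows that the top symbol of an element of the enveloping algebra is well defined.
  The symbol of a central element is invariant under conjugation of matrices, hence determined by its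
  values on companion matrices, to which a generic matrix is conjugate through its Krylov matrix.
  On companion matrices the symbols of \<open>H\<^sub>1, \<dots>, H\<^sub>n\<close> are, up to sign, the free entries. So every
  symbol of a central element is a weighted homogeneous polynomial in those of the Capelli elements,
  and subtracting that polynomial in the \<open>H\<^sub>k\<close> lowers the degree.
\<close>

section \<open>Filtered tensors and the ideal of relations\<close>

text \<open>The obstacle is that a quotient by a generated ideal comes without a basis: a tensor in
  the ideal could have a nonzero component in its top degree, and then symbols of classes would make
  no sense. A representation in which every letter raises the degree by exactly one in its leading
  term excludes this. Multiplication by the coordinates alone cannot be used, since multiplications
  commute; the derivation is the correction that produces the brackets, and it does not disturb
  leading terms. In the other direction, a tensor with vanishing symbol can be lowered, because
  letters may be reordered at the cost of shorter words and because distinct monomials are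
  independent as functions. Polynomials are handled as functions: invariance is a differential
  equation that is integrated along curves of matrices, and identities spread from generic matrices
  by restriction to lines. Centrality of \<open>H_k\<close> rests on the shifts
  \<open>k - a\<close>. Their drop by one from each column to the next is exactly what makes
  noncommutative minors alternate in their columns modulo the ideal.\<close>

definition word_mon :: "(nat \<times> nat) list \<Rightarrow> gl_tensor" where
  "word_mon w = Poly_Mapping.single (Word w) 1"

abbreviation scal :: "complex \<Rightarrow> gl_tensor" where
  "scal c \<equiv> Poly_Mapping.single 0 c"

definition index_pairs :: "nat \<Rightarrow> (nat \<times> nat) set" where
  "index_pairs n = {1..n} \<times> {1..n}"

definition tensor_filt :: "nat \<Rightarrow> nat \<Rightarrow> gl_tensor set" where
  "tensor_filt n m = {p. \<forall>w \<in> Poly_Mapping.keys p. set (letters w) \<subseteq> index_pairs n \<and> length (letters w) \<le> m}"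

lemma finite_index_pairs [simp]: "finite (index_pairs n)"
  by (simp add: index_pairs_def)

lemma mem_index_pairs [simp]: "(i, j) \<in> index_pairs n \<longleftrightarrow> i \<in> {1..n} \<and> j \<in> {1..n}"
  by (simp add: index_pairs_def)

lemma carrier_tensor_alg:
  "carrier (tensor_alg n) = {p. \<forall>w \<in> Poly_Mapping.keys p. set (letters w) \<subseteq> index_pairs n}"
  by (simp add: tensor_alg_def index_pairs_def)

lemma tensor_alg_simps [simp]:
  "p \<otimes>\<^bsub>tensor_alg n\<^esub> q = p * q" "p \<oplus>\<^bsub>tensor_alg n\<^esub> q = p + q"
  "\<one>\<^bsub>tensor_alg n\<^esub> = 1" "\<zero>\<^bsub>tensor_alg n\<^esub> = 0"
  by (simp_all add: tensor_alg_def)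

lemma poly_mapping_keys_induct:
  fixes p :: "'a \<Rightarrow>\<^sub>0 'b::comm_monoid_add"
  assumes "P 0" and "\<And>k c. k \<in> A \<Longrightarrow> P (Poly_Mapping.single k c)"
    and "\<And>p q. P p \<Longrightarrow> P q \<Longrightarrow> P (p + q)"
    and "Poly_Mapping.keys p \<subseteq> A"
  shows "P p"
proof -
  have "P (\<Sum>k\<in>K. Poly_Mapping.single k (poly_mapping.lookup p k))" if "finite K" "K \<subseteq> A" for K
    using that by (induction K rule: finite_induct) (auto intro: assms)
  moreover have "p = (\<Sum>k\<in>Poly_Mapping.keys p. Poly_Mapping.single k (poly_mapping.lookup p k))"
    by (rule poly_mapping_eqI)
       (simp add: lookup_sum lookup_single when_def not_in_keys_iff_lookup_eq_zero)
  ultimately show ?thesis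
    using assms(4) by (metis finite_keys)
qed

lemma carrier_tensor_alg_UN: "p \<in> carrier (tensor_alg n) \<longleftrightarrow> (\<exists>m. p \<in> tensor_filt n m)"
proof
  assume p: "p \<in> carrier (tensor_alg n)"
  have "p \<in> tensor_filt n (Max ((length \<circ> letters) ` Poly_Mapping.keys p))"
    using p by (auto simp: tensor_filt_def carrier_tensor_alg intro!: Max_ge)
  then show "\<exists>m. p \<in> tensor_filt n m" ..
qed (auto simp: tensor_filt_def carrier_tensor_alg)

lemma tensor_filt_mono: "p \<in> tensor_filt n a \<Longrightarrow> a \<le> b \<Longrightarrow> p \<in> tensor_filt n b"
  by (force simp: tensor_filt_def)

lemma tensor_filt_0 [simp]: "0 \<in> tensor_filt n m"
  by (simp add: tensor_filt_def)

lemma tensor_filt_add: "p \<in> tensor_filt n m \<Longrightarrow> q \<in> tensor_filt n m \<Longrightarrow> p + q \<in> tensor_filt n m"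
  using Poly_Mapping.keys_add[of p q] by (fastforce simp: tensor_filt_def)

lemma tensor_filt_uminus: "p \<in> tensor_filt n m \<Longrightarrow> - p \<in> tensor_filt n m"
  by (simp add: tensor_filt_def)

lemma tensor_filt_diff: "p \<in> tensor_filt n m \<Longrightarrow> q \<in> tensor_filt n m \<Longrightarrow> p - q \<in> tensor_filt n m"
  using tensor_filt_add[of p n m "- q"] by (simp add: tensor_filt_uminus)

lemma tensor_filt_mult: "p \<in> tensor_filt n a \<Longrightarrow> q \<in> tensor_filt n b \<Longrightarrow> p * q \<in> tensor_filt n (a + b)"
proof -
  assume p: "p \<in> tensor_filt n a" and q: "q \<in> tensor_filt n b"
  have "set (letters w) \<subseteq> index_pairs n \<and> length (letters w) \<le> a + b" if "w \<in> Poly_Mapping.keys (p * q)" for w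
  proof -
    obtain u v where "w = u + v" "u \<in> Poly_Mapping.keys p" "v \<in> Poly_Mapping.keys q"
      using \<open>w \<in> _\<close> keys_mult[of p q] by blast
    then show ?thesis
      using p q by (fastforce simp: tensor_filt_def)
  qed
  then show ?thesis by (simp add: tensor_filt_def)
qed

lemma tensor_filt_sum: "(\<And>i. i \<in> A \<Longrightarrow> f i \<in> tensor_filt n m) \<Longrightarrow> sum f A \<in> tensor_filt n m"
  by (induction A rule: infinite_finite_induct) (auto intro: tensor_filt_add)

lemma tensor_filt_single: "set w \<subseteq> index_pairs n \<Longrightarrow> length w \<le> m \<Longrightarrow> Poly_Mapping.single (Word w) c \<in> tensor_filt n m"
  by (simp add: tensor_filt_def)

lemma tensor_filt_word_mon: "set w \<subseteq> index_pairs n \<Longrightarrow> word_mon w \<in> tensor_filt n (length w)"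
  by (simp add: tensor_filt_single word_mon_def)

lemma tensor_filt_scal [simp]: "scal c \<in> tensor_filt n m"
  by (simp add: tensor_filt_def)

lemma tensor_filt_induct [consumes 1, case_names zero single add]:
  assumes "p \<in> tensor_filt n m" "P 0"
    and "\<And>w c. set w \<subseteq> index_pairs n \<Longrightarrow> length w \<le> m \<Longrightarrow> P (Poly_Mapping.single (Word w) c)"
    and "\<And>p q. P p \<Longrightarrow> P q \<Longrightarrow> P (p + q)"
  shows "P p"
proof (rule poly_mapping_keys_induct[of P "{w. set (letters w) \<subseteq> index_pairs n \<and> length (letters w) \<le> m}"])
  fix k :: "(nat \<times> nat) word" and c assume "k \<in> {w. set (letters w) \<subseteq> index_pairs n \<and> length (letters w) \<le> m}"
  then show "P (Poly_Mapping.single k c)" using assms(3)[of "letters k" c] by simp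
qed (use assms in \<open>auto simp: tensor_filt_def\<close>)

lemma tensor_filt_induct_mem [consumes 1, case_names zero single add]:
  assumes "p \<in> tensor_filt n m" "P 0"
    and "\<And>w c. set w \<subseteq> index_pairs n \<Longrightarrow> length w \<le> m \<Longrightarrow> P (Poly_Mapping.single (Word w) c)"
    and "\<And>p q. p \<in> tensor_filt n m \<Longrightarrow> q \<in> tensor_filt n m \<Longrightarrow> P p \<Longrightarrow> P q \<Longrightarrow> P (p + q)"
  shows "P p"
proof -
  have "p \<in> tensor_filt n m \<and> P p"
    using assms(1) by (induction rule: tensor_filt_induct) (auto intro: assms(2-) tensor_filt_add tensor_filt_single)
  then show ?thesis ..
qed

lemma gen_word_mon: "gen i j = word_mon [(i, j)]"
  by (simp add: gen_def word_mon_def)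

lemma word_mon_append: "word_mon (v @ w) = word_mon v * word_mon w"
  by (simp add: word_mon_def mult_single plus_word_def)

lemma word_mon_Cons: "word_mon (x # w) = gen (fst x) (snd x) * word_mon w"
  using word_mon_append[of "[x]" w] by (simp add: gen_word_mon)

lemma word_mon_Nil [simp]: "word_mon [] = 1"
  unfolding word_mon_def single_one[symmetric] by (simp add: zero_word_def)

lemma single_Word: "Poly_Mapping.single (Word w) c = scal c * word_mon w"
  by (simp add: word_mon_def mult_single)

lemma scal_commute: "scal c * p = p * scal c"
proof (rule poly_mapping_keys_induct[of "\<lambda>p. scal c * p = p * scal c" UNIV])
  show "scal c * (p + q) = (p + q) * scal c"
    if "scal c * p = p * scal c" "scal c * q = q * scal c" for p q
    using that by (simp add: algebra_simps)
qed (auto simp: mult_single mult.commute)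

lemma scal_of_nat: "scal (of_nat k) = of_nat k"
  by (induction k) (simp_all add: single_add single_one)

lemma scal_inverse_mult: "c \<noteq> 0 \<Longrightarrow> scal (inverse c) * (scal c * p) = p"
  by (simp add: mult.assoc[symmetric] mult_single)

lemma tensor_filt_gen: "(i, j) \<in> index_pairs n \<Longrightarrow> gen i j \<in> tensor_filt n 1"
  using tensor_filt_word_mon[of "[(i,j)]" n] by (simp add: gen_word_mon)

lemma tensor_filt_bracket:
  "(i, j) \<in> index_pairs n \<Longrightarrow> (k, l) \<in> index_pairs n \<Longrightarrow> gl_bracket i j k l \<in> tensor_filt n 1"
  by (auto simp: gl_bracket_def simp del: One_nat_def intro!: tensor_filt_uminus tensor_filt_diff tensor_filt_gen)

lemma carrier_closed:
  "p \<in> carrier (tensor_alg n) \<Longrightarrow> q \<in> carrier (tensor_alg n) \<Longrightarrow> p + q \<in> carrier (tensor_alg n)"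
  "p \<in> carrier (tensor_alg n) \<Longrightarrow> q \<in> carrier (tensor_alg n) \<Longrightarrow> p - q \<in> carrier (tensor_alg n)"
  "p \<in> carrier (tensor_alg n) \<Longrightarrow> q \<in> carrier (tensor_alg n) \<Longrightarrow> p * q \<in> carrier (tensor_alg n)"
  "p \<in> carrier (tensor_alg n) \<Longrightarrow> - p \<in> carrier (tensor_alg n)"
proof -
  interpret ring "tensor_alg n" by (rule tensor_alg_ring)
  show *: "p \<in> carrier (tensor_alg n) \<Longrightarrow> q \<in> carrier (tensor_alg n) \<Longrightarrow> p + q \<in> carrier (tensor_alg n)" for p q
    using a_closed[of p q] by simp
  show "p \<in> carrier (tensor_alg n) \<Longrightarrow> q \<in> carrier (tensor_alg n) \<Longrightarrow> p * q \<in> carrier (tensor_alg n)"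
    using m_closed[of p q] by simp
  show **: "p \<in> carrier (tensor_alg n) \<Longrightarrow> - p \<in> carrier (tensor_alg n)" for p
    by (simp add: carrier_tensor_alg)
  show "p \<in> carrier (tensor_alg n) \<Longrightarrow> q \<in> carrier (tensor_alg n) \<Longrightarrow> p - q \<in> carrier (tensor_alg n)"
    using *[of p "-q"] **[of q] by simp
qed

lemma tensor_filt_carrier: "p \<in> tensor_filt n m \<Longrightarrow> p \<in> carrier (tensor_alg n)"
  by (auto simp: carrier_tensor_alg_UN)

lemma gl_relations_carrier: "gl_relations n \<subseteq> carrier (tensor_alg n)"
proof
  fix x assume "x \<in> gl_relations n"
  then show "x \<in> carrier (tensor_alg n)"
    by (fastforce simp: gl_relations_def intro!: carrier_closed intro: tensor_filt_carrier[OF tensor_filt_gen] tensor_filt_carrier[OF tensor_filt_bracket])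
qed

lemma gl_ideal: "ideal (gl_ideal n) (tensor_alg n)"
  unfolding gl_ideal_def by (rule ring.genideal_ideal[OF tensor_alg_ring gl_relations_carrier])

lemma gl_ideal_0 [simp]: "0 \<in> gl_ideal n"
  using additive_subgroup.zero_closed[OF ideal.axioms(1)[OF gl_ideal]] by simp

lemma gl_ideal_add: "p \<in> gl_ideal n \<Longrightarrow> q \<in> gl_ideal n \<Longrightarrow> p + q \<in> gl_ideal n"
  using additive_subgroup.a_closed[OF ideal.axioms(1)[OF gl_ideal]] by fastforce

lemma gl_ideal_lmult: "p \<in> gl_ideal n \<Longrightarrow> x \<in> carrier (tensor_alg n) \<Longrightarrow> x * p \<in> gl_ideal n"
  using ideal.I_l_closed[OF gl_ideal] by fastforce

lemma gl_ideal_rmult: "p \<in> gl_ideal n \<Longrightarrow> x \<in> carrier (tensor_alg n) \<Longrightarrow> p * x \<in> gl_ideal n"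
  using ideal.I_r_closed[OF gl_ideal] by fastforce

lemma gl_ideal_scal: "p \<in> gl_ideal n \<Longrightarrow> scal c * p \<in> gl_ideal n"
  by (rule gl_ideal_lmult) (auto intro: tensor_filt_carrier[OF tensor_filt_scal])

lemma gl_ideal_uminus: "p \<in> gl_ideal n \<Longrightarrow> - p \<in> gl_ideal n"
  using gl_ideal_scal[of p n "-1"] by (simp add: single_uminus single_one)

lemma gl_ideal_diff: "p \<in> gl_ideal n \<Longrightarrow> q \<in> gl_ideal n \<Longrightarrow> p - q \<in> gl_ideal n"
  using gl_ideal_add[of p n "- q"] by (simp add: gl_ideal_uminus)

lemma gl_ideal_sum: "(\<And>i. i \<in> A \<Longrightarrow> f i \<in> gl_ideal n) \<Longrightarrow> sum f A \<in> gl_ideal n"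
  by (induction A rule: infinite_finite_induct) (auto intro: gl_ideal_add)

lemma gl_ideal_of_int: "p \<in> gl_ideal n \<Longrightarrow> of_int c * p \<in> gl_ideal n"
proof (induction c rule: int_induct[where k = 0])
  case (step1 i)
  then show ?case by (simp add: algebra_simps gl_ideal_add)
next
  case (step2 i)
  then show ?case by (simp add: algebra_simps gl_ideal_diff)
qed auto

text \<open>The ideal is a complex subspace, so \<open>scal (inverse (of_nat k))\<close> divides by
  \<open>k\<close>. Identities below are often obtained only for \<open>2\<close> or
  \<open>fact k\<close> times the wanted element.\<close>

lemma gl_ideal_cancel_nat:
  assumes "of_nat k * p \<in> gl_ideal n" "k \<noteq> 0"
  shows "p \<in> gl_ideal n"
  using gl_ideal_scal[OF assms(1), of "inverse (of_nat k)"] assms(2)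
    scal_inverse_mult[of "of_nat k" p] by (simp add: scal_of_nat)

lemma gl_ideal_relation:
  assumes "(i, j) \<in> index_pairs n" "(k, l) \<in> index_pairs n"
  shows "gen i j * gen k l - gen k l * gen i j - gl_bracket i j k l \<in> gl_ideal n"
proof -
  have "gen i j * gen k l - gen k l * gen i j - gl_bracket i j k l \<in> gl_relations n"
    using assms by (auto simp: gl_relations_def)
  then show ?thesis
    using ring.genideal_self[OF tensor_alg_ring gl_relations_carrier] by (auto simp: gl_ideal_def)
qed

section \<open>Classes in the enveloping algebra\<close>

lemma U_class_hom: "U_class n \<in> Ring.ring_hom (tensor_alg n) (U n)"
proof -
  have "U_class n = (\<lambda>p. gl_ideal n +>\<^bsub>tensor_alg n\<^esub> p)"
    by (simp add: U_class_def fun_eq_iff)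
  then show ?thesis
    using ideal.rcos_ring_hom[OF gl_ideal] by (simp add: U_def)
qed

lemma ring_U: "ring (U n)"
  unfolding U_def by (rule ideal.quotient_is_ring[OF gl_ideal])

lemma carrier_U: "carrier (U n) = U_class n ` carrier (tensor_alg n)"
  by (auto simp: U_def FactRing_def A_RCOSETS_def' U_class_def)

lemma U_class_simps:
  assumes "p \<in> carrier (tensor_alg n)" "q \<in> carrier (tensor_alg n)"
  shows "U_class n (p + q) = U_class n p \<oplus>\<^bsub>U n\<^esub> U_class n q"
    and "U_class n (p * q) = U_class n p \<otimes>\<^bsub>U n\<^esub> U_class n q"
  using ring_hom_add[OF U_class_hom assms] ring_hom_mult[OF U_class_hom assms] by simp_all

lemma U_class_1: "U_class n 1 = \<one>\<^bsub>U n\<^esub>"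
  using ring_hom_one[OF U_class_hom, of n] by simp

lemma U_class_0: "U_class n 0 = \<zero>\<^bsub>U n\<^esub>"
  using ring_hom_zero[OF U_class_hom tensor_alg_ring ring_U, of n] by simp

lemma U_class_eq_iff:
  assumes p: "p \<in> carrier (tensor_alg n)" and q: "q \<in> carrier (tensor_alg n)"
  shows "U_class n p = U_class n q \<longleftrightarrow> p - q \<in> gl_ideal n"
proof -
  interpret ring "tensor_alg n" by (rule tensor_alg_ring)
  interpret I: ideal "gl_ideal n" "tensor_alg n" by (rule gl_ideal)
  have "p \<ominus>\<^bsub>tensor_alg n\<^esub> q = p - q"
  proof -
    have "\<ominus>\<^bsub>tensor_alg n\<^esub> q = - q"
      by (rule minus_equality) (use q carrier_closed in auto)
    then show ?thesis by (simp add: a_minus_def)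
  qed
  then show ?thesis
    using quotient_eq_iff_same_a_r_cos[OF gl_ideal p q] by (simp add: U_class_def)
qed

text \<open>Commutators obey the Leibniz rule along a word, so commuting with the letters suffices.
  Centrality becomes a question of membership in \<open>gl_ideal\<close> for
  representatives.\<close>

lemma center_iff_commutator:
  assumes p: "p \<in> carrier (tensor_alg n)"
  shows "U_class n p \<in> carrier (zeta n) \<longleftrightarrow>
    (\<forall>a b. (a, b) \<in> index_pairs n \<longrightarrow> gen a b * p - p * gen a b \<in> gl_ideal n)" (is "?L \<longleftrightarrow> ?R")
proof
  assume L: ?L
  show ?R
  proof (intro allI impI)
    fix a b assume "(a, b) \<in> index_pairs n"
    then have g: "gen a b \<in> carrier (tensor_alg n)"
      by (rule tensor_filt_carrier[OF tensor_filt_gen])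
    then have "U_class n p \<otimes>\<^bsub>U n\<^esub> U_class n (gen a b) = U_class n (gen a b) \<otimes>\<^bsub>U n\<^esub> U_class n p"
      using L by (auto simp: zeta_def center_def carrier_U)
    then have "U_class n (gen a b * p) = U_class n (p * gen a b)"
      using U_class_simps[OF p g] U_class_simps[OF g p] by simp
    then show "gen a b * p - p * gen a b \<in> gl_ideal n"
      using g p by (simp add: U_class_eq_iff carrier_closed)
  qed
next
  assume R: ?R
  have word: "word_mon w * p - p * word_mon w \<in> gl_ideal n" if "set w \<subseteq> index_pairs n" for w
    using that
  proof (induction w)
    case (Cons x w)
    obtain a b where x: "x = (a, b)" by (cases x)
    have ab: "(a, b) \<in> index_pairs n" using Cons.prems x by simp
    have "word_mon (x # w) * p - p * word_mon (x # w)
       = gen a b * (word_mon w * p - p * word_mon w) + (gen a b * p - p * gen a b) * word_mon w"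
      by (simp add: x word_mon_Cons algebra_simps)
    also have "\<dots> \<in> gl_ideal n"
      using R Cons ab
      by (intro gl_ideal_add gl_ideal_lmult gl_ideal_rmult tensor_filt_carrier[OF tensor_filt_gen] tensor_filt_carrier[OF tensor_filt_word_mon]) auto
    finally show ?case .
  qed simp
  have "x * p - p * x \<in> gl_ideal n" if "x \<in> tensor_filt n m" for x m
    using that
  proof (induction rule: tensor_filt_induct)
    case (single w c)
    have "Poly_Mapping.single (Word w) c * p - p * Poly_Mapping.single (Word w) c
      = scal c * (word_mon w * p - p * word_mon w)"
      by (simp add: single_Word algebra_simps scal_commute)
    then show ?case using word[OF single(1)] by (simp add: gl_ideal_scal)
  next
    case (add x y)
    then show ?case using gl_ideal_add[OF add] by (simp add: algebra_simps)
  qed simp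
  then have comm: "U_class n p \<otimes>\<^bsub>U n\<^esub> U_class n x = U_class n x \<otimes>\<^bsub>U n\<^esub> U_class n p"
    if x: "x \<in> carrier (tensor_alg n)" for x
  proof -
    have "U_class n (x * p) = U_class n (p * x)"
      using x p \<open>\<And>x m. x \<in> tensor_filt n m \<Longrightarrow> x * p - p * x \<in> gl_ideal n\<close>
      by (auto simp: U_class_eq_iff carrier_closed carrier_tensor_alg_UN[of x])
    then show ?thesis using U_class_simps[OF p x] U_class_simps[OF x p] by simp
  qed
  then show ?L using p by (auto simp: zeta_def center_def carrier_U)
qed

lemma U_filt_eq: "U_filt n m = U_class n ` tensor_filt n m"
proof -
  have "{p \<in> carrier (tensor_alg n). \<forall>w \<in> Poly_Mapping.keys p. length (letters w) \<le> m} = tensor_filt n m"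
    by (auto simp: carrier_tensor_alg tensor_filt_def)
  then show ?thesis by (simp add: U_filt_def)
qed

declare One_nat_def [simp del] upt_Suc [simp del]

section \<open>Centrality of the Capelli elements\<close>

text \<open>
  Row and column indices \<open>I\<close>, \<open>J\<close> are arbitrary sequences and the shift is added where their
  values agree. This makes minors with repeated indices meaningful, and the sum over all \<open>J\<close> of the
  diagonal minors, a trace, is visibly invariant.
\<close>

definition Capelli_entry :: "nat \<Rightarrow> nat \<Rightarrow> nat \<Rightarrow> gl_tensor" where
  "Capelli_entry u i j = gen i j + (if i = j then of_nat u else 0)"

definition Capelli_prod :: "(nat \<Rightarrow> nat) \<Rightarrow> (nat \<Rightarrow> nat) \<Rightarrow> (nat \<Rightarrow> nat) \<Rightarrow> nat list \<Rightarrow> gl_tensor" where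
  "Capelli_prod sh I J l = prod_list (map (\<lambda>s. Capelli_entry (sh s) (I s) (J s)) l)"

text \<open>The section \<open>(-) k\<close> gives position \<open>s\<close> the shift
  \<open>k - s\<close>, so the shifts descend from \<open>k - 1\<close> to \<open>0\<close>. As in
  \<open>cdet\<close>, the factors stand in column order and only the rows are permuted.\<close>

definition Capelli_minor :: "nat \<Rightarrow> (nat \<Rightarrow> nat) \<Rightarrow> (nat \<Rightarrow> nat) \<Rightarrow> gl_tensor" where
  "Capelli_minor k I J = (\<Sum>\<sigma> | \<sigma> permutes {1..k}. of_int (sign \<sigma>) * Capelli_prod ((-) k) (I \<circ> \<sigma>) J [1..<Suc k])"

lemma image_comp_permutes:
  "J ` S \<subseteq> A \<Longrightarrow> \<rho> permutes S \<Longrightarrow> (J \<circ> \<rho>) ` S \<subseteq> A"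
  by (metis image_comp permutes_image)

lemma Capelli_entry_tensor_filt: "(i, j) \<in> index_pairs n \<Longrightarrow> Capelli_entry u i j \<in> tensor_filt n 1"
  using tensor_filt_gen[of i j n] tensor_filt_scal[of "of_nat u" n 1]
  by (auto simp: Capelli_entry_def scal_of_nat intro!: tensor_filt_add)

lemma Capelli_prod_tensor_filt:
  assumes "I ` set l \<subseteq> {1..n}" "J ` set l \<subseteq> {1..n}"
  shows "Capelli_prod sh I J l \<in> tensor_filt n (length l)"
  using assms
proof (induction l)
  case Nil
  then show ?case using tensor_filt_scal[of 1 n 0] by (simp add: Capelli_prod_def)
next
  case (Cons a l)
  have "Capelli_entry (sh a) (I a) (J a) * Capelli_prod sh I J l \<in> tensor_filt n (1 + length l)"
    using Cons by (intro tensor_filt_mult Capelli_entry_tensor_filt) auto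
  then show ?case by (simp add: Capelli_prod_def One_nat_def)
qed

lemma Capelli_prod_cong:
  "(\<And>s. s \<in> set l \<Longrightarrow> I s = I' s \<and> J s = J' s) \<Longrightarrow> Capelli_prod sh I J l = Capelli_prod sh I' J' l"
  unfolding Capelli_prod_def by (intro arg_cong[where f = prod_list] map_cong) auto

lemma Capelli_minor_cong:
  assumes "\<And>s. s \<in> {1..k} \<Longrightarrow> I s = I' s \<and> J s = J' s"
  shows "Capelli_minor k I J = Capelli_minor k I' J'"
proof -
  have "Capelli_prod ((-) k) (I \<circ> \<sigma>) J [1..<Suc k] = Capelli_prod ((-) k) (I' \<circ> \<sigma>) J' [1..<Suc k]"
    if "\<sigma> permutes {1..k}" for \<sigma>
  proof (rule Capelli_prod_cong)
    fix s assume "s \<in> set [1..<Suc k]"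
    then have "s \<in> {1..k}" "\<sigma> s \<in> {1..k}" using permutes_in_image[OF that] by auto
    then show "(I \<circ> \<sigma>) s = (I' \<circ> \<sigma>) s \<and> J s = J' s" using assms by simp
  qed
  then show ?thesis unfolding Capelli_minor_def by (intro sum.cong) auto
qed

lemma tensor_filt_of_int: "p \<in> tensor_filt n m \<Longrightarrow> of_int c * p \<in> tensor_filt n m"
proof -
  assume p: "p \<in> tensor_filt n m"
  have nat: "of_nat k * p \<in> tensor_filt n m" for k
    using tensor_filt_mult[OF tensor_filt_scal[of "of_nat k" n 0] p] by (simp add: scal_of_nat)
  show ?thesis
    by (cases c rule: int_cases2) (use nat in \<open>auto intro: tensor_filt_uminus\<close>)
qed

lemma Capelli_minor_tensor_filt:
  assumes "I ` {1..k} \<subseteq> {1..n}" "J ` {1..k} \<subseteq> {1..n}"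
  shows "Capelli_minor k I J \<in> tensor_filt n k"
proof -
  have "Capelli_prod ((-) k) (I \<circ> \<sigma>) J [1..<Suc k] \<in> tensor_filt n k" if "\<sigma> permutes {1..k}" for \<sigma>
  proof -
    have "set [1..<Suc k] = {1..k}" by auto
    then have "(I \<circ> \<sigma>) ` set [1..<Suc k] \<subseteq> {1..n}" "J ` set [1..<Suc k] \<subseteq> {1..n}"
      using assms image_comp_permutes[OF assms(1) that] by simp_all
    from Capelli_prod_tensor_filt[OF this] show ?thesis by simp
  qed
  then show ?thesis
    unfolding Capelli_minor_def by (intro tensor_filt_sum tensor_filt_of_int) auto
qed

section \<open>Alternation of the minors in rows and columns\<close>

lemma of_nat_gen: "of_nat u * gen i j = gen i j * of_nat u"
  by (rule mult_of_nat_commute)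

lemma of_nat_gen_left: "of_nat u * (gen i j * x) = gen i j * (of_nat u * x)"
  by (simp add: of_nat_gen mult.assoc[symmetric])

text \<open>The source of all column relations. The quadratic terms form two commutators of letters.
  The linear terms come from the shifts, and since these differ by one between the left and the
  right column, what survives is exactly minus the two brackets.\<close>

lemma Capelli_entry_two_columns:
  assumes "{i, j, b, c} \<subseteq> {1..n}"
  shows "Capelli_entry (Suc u) i b * Capelli_entry u j c - Capelli_entry (Suc u) j b * Capelli_entry u i c
       + Capelli_entry (Suc u) i c * Capelli_entry u j b - Capelli_entry (Suc u) j c * Capelli_entry u i b \<in> gl_ideal n"
    (is "?L \<in> _")
proof -
  have "?L = (gen i b * gen j c - gen j c * gen i b - gl_bracket i b j c)
           - (gen j b * gen i c - gen i c * gen j b - gl_bracket j b i c)"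
    by (cases "i = b"; cases "j = c"; cases "j = b"; cases "i = c")
       (simp_all add: Capelli_entry_def gl_bracket_def algebra_simps of_nat_gen of_nat_gen_left)
  also have "\<dots> \<in> gl_ideal n"
    using assms by (intro gl_ideal_diff gl_ideal_relation) auto
  finally show ?thesis .
qed

lemma Capelli_prod_append: "Capelli_prod sh I J (l @ l') = Capelli_prod sh I J l * Capelli_prod sh I J l'"
  by (simp add: Capelli_prod_def)

text \<open>\<open>\<tau>\<close> affects only the neighbouring factors at \<open>s\<close> and
  \<open>Suc s\<close>, whose shifts differ by one, so the two-column relation applies between the
  untouched outer factors \<open>L\<close> and \<open>R\<close>.\<close>

lemma Capelli_prod_two_columns:
  assumes s: "1 \<le> s" "s < k" and I: "I ` {1..k} \<subseteq> {1..n}" and J: "J ` {1..k} \<subseteq> {1..n}"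
  defines "\<tau> \<equiv> Transposition.transpose s (Suc s)" and "P \<equiv> \<lambda>I J. Capelli_prod ((-) k) I J [1..<Suc k]"
  shows "P I J - P (I \<circ> \<tau>) J + P I (J \<circ> \<tau>) - P (I \<circ> \<tau>) (J \<circ> \<tau>) \<in> gl_ideal n"
proof -
  define L where "L = Capelli_prod ((-) k) I J [1..<s]"
  define R where "R = Capelli_prod ((-) k) I J [Suc (Suc s)..<Suc k]"
  have upt: "[1..<Suc k] = [1..<s] @ [s, Suc s] @ [Suc (Suc s)..<Suc k]"
  proof -
    have "[1..<Suc k] = [1..<s] @ [s..<Suc k]" using s upt_add_eq_append[of 1 s "Suc k - s"] by simp
    then show ?thesis using s by (simp add: upt_conv_Cons)
  qed
  have ks: "k - s = Suc (k - Suc s)" using s by simp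
  have P: "P A B = L * (Capelli_entry (Suc (k - Suc s)) (A s) (B s) * Capelli_entry (k - Suc s) (A (Suc s)) (B (Suc s))) * R"
    if "A = I \<or> A = I \<circ> \<tau>" "B = J \<or> B = J \<circ> \<tau>" for A B
  proof -
    have "Capelli_prod ((-) k) A B [1..<s] = L" "Capelli_prod ((-) k) A B [Suc (Suc s)..<Suc k] = R"
      unfolding L_def R_def using that by (auto intro!: Capelli_prod_cong simp: \<tau>_def Transposition.transpose_def)
    then show ?thesis
      unfolding P_def upt Capelli_prod_append by (simp add: Capelli_prod_def ks mult.assoc)
  qed
  have "P I J - P (I \<circ> \<tau>) J + P I (J \<circ> \<tau>) - P (I \<circ> \<tau>) (J \<circ> \<tau>) = 
     L * (Capelli_entry (Suc (k - Suc s)) (I s) (J s) * Capelli_entry (k - Suc s) (I (Suc s)) (J (Suc s))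
        - Capelli_entry (Suc (k - Suc s)) (I (Suc s)) (J s) * Capelli_entry (k - Suc s) (I s) (J (Suc s))
       + Capelli_entry (Suc (k - Suc s)) (I s) (J (Suc s)) * Capelli_entry (k - Suc s) (I (Suc s)) (J s)
       - Capelli_entry (Suc (k - Suc s)) (I (Suc s)) (J (Suc s)) * Capelli_entry (k - Suc s) (I s) (J s)) * R"
    by (simp add: P \<tau>_def algebra_simps)
  also have "\<dots> \<in> gl_ideal n"
  proof (rule gl_ideal_rmult[OF gl_ideal_lmult[OF Capelli_entry_two_columns]])
    show "{I s, I (Suc s), J s, J (Suc s)} \<subseteq> {1..n}"
      using I J s by (auto simp: image_subset_iff)
    show "L \<in> carrier (tensor_alg n)" "R \<in> carrier (tensor_alg n)"
      unfolding L_def R_def using I J s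
      by (intro tensor_filt_carrier[OF Capelli_prod_tensor_filt]; force simp: image_subset_iff)+
  qed
  finally show ?thesis .
qed

lemma transpose_permutes: "a \<in> S \<Longrightarrow> b \<in> S \<Longrightarrow> Transposition.transpose a b permutes S"
  by (rule permutes_swap_id)

lemma permutation_of_permutes: "\<sigma> permutes {1..k::nat} \<Longrightarrow> permutation \<sigma>"
  by (auto simp: permutation_permutes)

lemma sign_compose_transpose:
  assumes "\<sigma> permutes {1..k::nat}" "a \<in> {1..k}" "b \<in> {1..k}" "a \<noteq> b"
  shows "sign (\<sigma> \<circ> Transposition.transpose a b) = - sign \<sigma>"
    and "sign (Transposition.transpose a b \<circ> \<sigma>) = - sign \<sigma>"
  using assms by (simp_all add: sign_compose permutation_of_permutes[OF assms(1)]
      permutation_swap_id sign_swap_id)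

text \<open>For rows this is an exact identity, a reindexing of the sum over permutations. For
  columns the noncommuting factors intervene and only a congruence modulo \<open>gl_ideal\<close> is
  obtained.\<close>

lemma Capelli_minor_row_transpose:
  assumes "a \<in> {1..k}" "b \<in> {1..k}" "a \<noteq> b"
  shows "Capelli_minor k (I \<circ> Transposition.transpose a b) J = - Capelli_minor k I J"
proof -
  let ?\<tau> = "Transposition.transpose a b"
  have "Capelli_minor k I J = (\<Sum>\<sigma> | \<sigma> permutes {1..k}. of_int (sign (?\<tau> \<circ> \<sigma>)) *
      Capelli_prod ((-) k) (I \<circ> (?\<tau> \<circ> \<sigma>)) J [1..<Suc k])"
    unfolding Capelli_minor_def by (rule setum_permutations_compose_left[OF transpose_permutes[OF assms(1,2)]])
  also have "\<dots> = - Capelli_minor k (I \<circ> ?\<tau>) J"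
    unfolding Capelli_minor_def sum_negf[symmetric]
    by (intro sum.cong) (simp_all add: sign_compose_transpose(2)[OF _ assms] comp_assoc)
  finally show ?thesis by simp
qed

text \<open>Pairing \<open>\<sigma>\<close> with \<open>\<sigma> \<circ> \<tau>\<close>
  antisymmetrizes every summand in the two rows concerned, which is the shape required by
  \<open>Capelli_prod_two_columns\<close>. This proves twice the claim, and the factor is then
  cancelled.\<close>

lemma Capelli_minor_column_adjacent:
  assumes s: "1 \<le> s" "s < k" and I: "I ` {1..k} \<subseteq> {1..n}" and J: "J ` {1..k} \<subseteq> {1..n}"
  shows "Capelli_minor k I (J \<circ> Transposition.transpose s (Suc s)) + Capelli_minor k I J \<in> gl_ideal n"
proof -
  let ?\<tau> = "Transposition.transpose s (Suc s)"
  let ?P = "\<lambda>I J. Capelli_prod ((-) k) I J [1..<Suc k]"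
  have s': "s \<in> {1..k}" "Suc s \<in> {1..k}" using s by auto
  have neg: "Capelli_minor k I B = - (\<Sum>\<sigma> | \<sigma> permutes {1..k}. of_int (sign \<sigma>) * ?P (I \<circ> \<sigma> \<circ> ?\<tau>) B)" for B
  proof -
    have "Capelli_minor k I B = (\<Sum>\<sigma> | \<sigma> permutes {1..k}. of_int (sign (\<sigma> \<circ> ?\<tau>)) * ?P (I \<circ> (\<sigma> \<circ> ?\<tau>)) B)"
      unfolding Capelli_minor_def by (rule sum_permutations_compose_right[OF transpose_permutes[OF s']])
    then show ?thesis
      unfolding sum_negf[symmetric]
      by (simp add: sign_compose_transpose(1)[OF _ s'] comp_assoc)
  qed
  have two: "of_nat 2 * Capelli_minor k I B = (\<Sum>\<sigma> | \<sigma> permutes {1..k}. of_int (sign \<sigma>) *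
        (?P (I \<circ> \<sigma>) B - ?P (I \<circ> \<sigma> \<circ> ?\<tau>) B))" for B
  proof -
    have "of_nat 2 * Capelli_minor k I B = Capelli_minor k I B + Capelli_minor k I B"
      using mult_2[of "Capelli_minor k I B"] by simp
    also have "\<dots> = Capelli_minor k I B - (\<Sum>\<sigma> | \<sigma> permutes {1..k}. of_int (sign \<sigma>) * ?P (I \<circ> \<sigma> \<circ> ?\<tau>) B)"
      using neg[of B] by simp
    finally show ?thesis
      by (simp add: Capelli_minor_def right_diff_distrib sum_subtractf)
  qed
  have "of_nat 2 * (Capelli_minor k I (J \<circ> ?\<tau>) + Capelli_minor k I J) = (\<Sum>\<sigma> | \<sigma> permutes {1..k}. of_int (sign \<sigma>) *
     (?P (I \<circ> \<sigma>) J - ?P (I \<circ> \<sigma> \<circ> ?\<tau>) J + ?P (I \<circ> \<sigma>) (J \<circ> ?\<tau>) - ?P (I \<circ> \<sigma> \<circ> ?\<tau>) (J \<circ> ?\<tau>)))"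
    unfolding distrib_left[of "of_nat 2"] two
    by (simp add: algebra_simps sum.distrib sum_subtractf)
  also have "\<dots> \<in> gl_ideal n"
  proof (intro gl_ideal_sum gl_ideal_of_int Capelli_prod_two_columns s J)
    fix \<sigma> assume "\<sigma> \<in> {\<sigma>. \<sigma> permutes {1..k}}"
    then show "(I \<circ> \<sigma>) ` {1..k} \<subseteq> {1..n}"
      using image_comp_permutes[OF I] by simp
  qed
  finally show ?thesis by (rule gl_ideal_cancel_nat) simp
qed

text \<open>Three successive sign changes amount to one.\<close>

lemma gl_ideal_alternate:
  assumes "w + x \<in> gl_ideal n" "x + y \<in> gl_ideal n" "y + z \<in> gl_ideal n"
  shows "w + z \<in> gl_ideal n"
  using gl_ideal_add[OF gl_ideal_diff[OF assms(1,2)] assms(3)] by simp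

lemma add_diff_diff_cancel: "(x + y) - (y - z) = x + (z :: 'a :: ab_group_add)"
  by simp

lemma Capelli_minor_column_transpose:
  assumes "1 \<le> a" "a < b" "b \<le> k" and I: "I ` {1..k} \<subseteq> {1..n}" and "J ` {1..k} \<subseteq> {1..n}"
  shows "Capelli_minor k I (J \<circ> Transposition.transpose a b) + Capelli_minor k I J \<in> gl_ideal n"
  using assms(2,3,5)
proof (induction b arbitrary: J)
  case (Suc b)
  show ?case
  proof (cases "a = b")
    case True
    have "Capelli_minor k I (J \<circ> Transposition.transpose b (Suc b)) + Capelli_minor k I J \<in> gl_ideal n"
      using Suc.prems assms(1) True by (intro Capelli_minor_column_adjacent I) auto
    then show ?thesis by (simp only: True)
  next
    case False
    then have b: "a < b" "1 \<le> b" "b < k" using Suc.prems assms(1) by auto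
    let ?\<tau> = "Transposition.transpose b (Suc b)" and ?t = "Transposition.transpose a b"
    \<comment> \<open>A distant transposition is a shorter one conjugated by an adjacent one: three
      transpositions, each changing the sign.\<close>
    have eq: "Transposition.transpose a (Suc b) = ?\<tau> \<circ> ?t \<circ> ?\<tau>"
      using b by (auto simp: fun_eq_iff Transposition.transpose_def)
    have J1: "(J \<circ> ?\<tau>) ` {1..k} \<subseteq> {1..n}"
      using b Suc.prems by (intro image_comp_permutes transpose_permutes) auto
    have J2: "(J \<circ> ?\<tau> \<circ> ?t) ` {1..k} \<subseteq> {1..n}"
      using b assms(1) by (intro image_comp_permutes[OF J1] transpose_permutes) auto
    from Capelli_minor_column_adjacent[OF b(2,3) I J2] Suc.IH[OF b(1) less_imp_le[OF b(3)] J1]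
      Capelli_minor_column_adjacent[OF b(2,3) I Suc.prems(3)]
    show ?thesis unfolding eq o_assoc by (rule gl_ideal_alternate)
  qed
qed simp

lemma Capelli_minor_column_permute:
  assumes \<rho>: "\<rho> permutes {1..k}" and I: "I ` {1..k} \<subseteq> {1..n}" and J: "J ` {1..k} \<subseteq> {1..n}"
  shows "Capelli_minor k I (J \<circ> \<rho>) - of_int (sign \<rho>) * Capelli_minor k I J \<in> gl_ideal n"
proof -
  have "finite {1..k}" by simp
  from this \<rho> show ?thesis
  proof (induction rule: permutes_rev_induct)
    case id
    then show ?case by simp
  next
    case (swap a b \<rho>)
    let ?t = "Transposition.transpose a b"
    have J': "(J \<circ> \<rho>) ` {1..k} \<subseteq> {1..n}"
      using image_comp_permutes[OF J] swap by blast
    have "Capelli_minor k I (J \<circ> \<rho> \<circ> ?t) + Capelli_minor k I (J \<circ> \<rho>) \<in> gl_ideal n"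
    proof (cases "a < b")
      case True
      then show ?thesis using swap J' I by (intro Capelli_minor_column_transpose) auto
    next
      case False
      then show ?thesis using swap J' I Capelli_minor_column_transpose[of b a k I n "J \<circ> \<rho>"]
        by (simp add: transpose_commute)
    qed
    from gl_ideal_diff[OF this swap.IH]
    have "Capelli_minor k I (J \<circ> \<rho> \<circ> ?t) + of_int (sign \<rho>) * Capelli_minor k I J \<in> gl_ideal n"
      by (rule back_subst[of "\<lambda>x. x \<in> gl_ideal n"]) (rule add_diff_diff_cancel)
    then show ?case
      unfolding sign_compose_transpose(1)[OF swap.hyps(4,1,2,3)] o_assoc
      by (simp only: of_int_minus mult_minus_left diff_minus_eq_add)
  qed
qed

text \<open>\<open>J\<close> is the row sequence and \<open>J'\<close> is arbitrary. Swapping two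
  equal rows changes nothing but also reverses the sign; the ideal serves to divide the resulting
  identity by 2.\<close>

lemma Capelli_minor_repeated:
  assumes "\<not> inj_on J {1..k}"
  shows "Capelli_minor k J J' \<in> gl_ideal n"
proof -
  obtain a b where ab: "a \<in> {1..k}" "b \<in> {1..k}" "a \<noteq> b" "J a = J b"
    using assms by (auto simp: inj_on_def)
  have "J \<circ> Transposition.transpose a b = J"
    using ab by (auto simp: fun_eq_iff Transposition.transpose_def)
  then have "Capelli_minor k J J' = - Capelli_minor k J J'"
    using Capelli_minor_row_transpose[OF ab(1-3), of J J'] by simp
  then have "Capelli_minor k J J' + Capelli_minor k J J' = 0"
    by (metis add.right_inverse)
  then have "of_nat 2 * Capelli_minor k J J' = 0"
    using mult_2[of "Capelli_minor k J J'"] by simp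
  then show ?thesis using gl_ideal_cancel_nat[of 2 "Capelli_minor k J J'" n] by simp
qed

lemma Capelli_minor_row_permute:
  assumes "\<rho> permutes {1..k}"
  shows "Capelli_minor k (I \<circ> \<rho>) J = of_int (sign \<rho>) * Capelli_minor k I J"
proof -
  have sgn: "sign \<rho> * sign (\<rho> \<circ> \<sigma>) = sign \<sigma>" if "\<sigma> permutes {1..k}" for \<sigma>
    using permutation_of_permutes[OF that] permutation_of_permutes[OF assms]
    by (simp add: sign_compose mult.assoc[symmetric])
  have "of_int (sign \<rho>) * Capelli_minor k I J = of_int (sign \<rho>) * (\<Sum>\<sigma> | \<sigma> permutes {1..k}. of_int (sign (\<rho> \<circ> \<sigma>)) *
      Capelli_prod ((-) k) (I \<circ> (\<rho> \<circ> \<sigma>)) J [1..<Suc k])"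
    unfolding Capelli_minor_def by (subst setum_permutations_compose_left[OF assms]) simp
  also have "\<dots> = Capelli_minor k (I \<circ> \<rho>) J"
    unfolding Capelli_minor_def sum_distrib_left
    by (intro sum.cong)
       (simp_all add: mult.assoc[symmetric] of_int_mult[symmetric] sgn comp_assoc of_int_mult)
  finally show ?thesis by simp
qed

text \<open>The exact sign from the rows cancels the congruent sign from the columns, so the order
  of the indices of a diagonal minor does not matter modulo the ideal.\<close>

lemma Capelli_minor_permute:
  assumes \<rho>: "\<rho> permutes {1..k}" and J: "J ` {1..k} \<subseteq> {1..n}"
  shows "Capelli_minor k (J \<circ> \<rho>) (J \<circ> \<rho>) - Capelli_minor k J J \<in> gl_ideal n"
proof -
  have "of_int (sign \<rho>) * (Capelli_minor k J (J \<circ> \<rho>) - of_int (sign \<rho>) * Capelli_minor k J J) \<in> gl_ideal n"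
    by (intro gl_ideal_of_int Capelli_minor_column_permute assms)
  moreover have "of_int (sign \<rho>) * (of_int (sign \<rho>) * x) = x" for x :: gl_tensor
    by (simp add: sign_def)
  ultimately show ?thesis
    by (simp add: Capelli_minor_row_permute[OF \<rho>] right_diff_distrib)
qed

definition increasing_lists :: "nat \<Rightarrow> nat \<Rightarrow> nat list set" where
  "increasing_lists n k = {v. length v = k \<and> sorted_wrt (<) v \<and> set v \<subseteq> {1..n}}"

text \<open>The chosen representative of \<open>Capelli_H n k\<close> in the tensor algebra;
  \<open>Capelli_H_eq\<close> makes the identification.\<close>

definition Capelli_tensor :: "nat \<Rightarrow> nat \<Rightarrow> gl_tensor" where
  "Capelli_tensor n k = (\<Sum>v\<in>increasing_lists n k. Capelli_minor k (\<lambda>a. v ! (a - 1)) (\<lambda>a. v ! (a - 1)))"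

section \<open>Commutators of minors with the generators\<close>

lemma Capelli_entry_commutator:
  assumes "(p, q) \<in> index_pairs n" "(i, j) \<in> index_pairs n"
  shows "gen p q * Capelli_entry u i j - Capelli_entry u i j * gen p q
     - ((if i = q then Capelli_entry u p j else 0) - (if j = p then Capelli_entry u i q else 0)) \<in> gl_ideal n"
proof -
  \<comment> \<open>The shift commutes with \<open>gen p q\<close>. On the right-hand side it
    appears in both replaced entries exactly when \<open>i = q\<close> and \<open>j = p\<close>, and
    these two contributions cancel, so the formula is the same for every \<open>u\<close>.\<close>
  have "gen p q * Capelli_entry u i j - Capelli_entry u i j * gen p q
     - ((if i = q then Capelli_entry u p j else 0) - (if j = p then Capelli_entry u i q else 0))
     = gen p q * gen i j - gen i j * gen p q - gl_bracket p q i j"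
    by (auto simp: Capelli_entry_def gl_bracket_def algebra_simps of_nat_gen of_nat_gen_left)
  then show ?thesis using gl_ideal_relation[OF assms] by simp
qed

text \<open>Leibniz rule, factor by factor. Positions are distinct so that changing \<open>I\<close>
  or \<open>J\<close> at one position alters a single factor.\<close>

lemma Capelli_prod_commutator:
  assumes pq: "(p, q) \<in> index_pairs n" and "distinct l" "I ` set l \<subseteq> {1..n}" "J ` set l \<subseteq> {1..n}"
  shows "gen p q * Capelli_prod sh I J l - Capelli_prod sh I J l * gen p q
     - (\<Sum>s\<in>set l. (if I s = q then Capelli_prod sh (I(s := p)) J l else 0)
          - (if J s = p then Capelli_prod sh I (J(s := q)) l else 0)) \<in> gl_ideal n"
  using assms(2-)
proof (induction l)
  case (Cons a l)
  define D where "D l s = (if I s = q then Capelli_prod sh (I(s := p)) J l else 0)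
          - (if J s = p then Capelli_prod sh I (J(s := q)) l else 0)" for l s
  define X where "X = Capelli_entry (sh a) (I a) (J a)"
  define d where "d = (if I a = q then Capelli_entry (sh a) p (J a) else 0) - (if J a = p then Capelli_entry (sh a) (I a) q else 0)"
  define R where "R = Capelli_prod sh I J l"
  have Da: "D (a # l) a = d * R"
  proof -
    have "Capelli_prod sh (I(a := p)) J l = R" "Capelli_prod sh I (J(a := q)) l = R"
      unfolding R_def using Cons.prems(1) by (auto intro!: Capelli_prod_cong)
    then show ?thesis by (simp add: D_def d_def Capelli_prod_def algebra_simps)
  qed
  have Ds: "D (a # l) s = X * D l s" if "s \<in> set l" for s
    using that Cons.prems(1) by (auto simp: D_def X_def Capelli_prod_def algebra_simps)
  have sum: "(\<Sum>s\<in>set (a # l). D (a # l) s) = d * R + X * (\<Sum>s\<in>set l. D l s)"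
    using Cons.prems(1) by (simp add: Da Ds sum_distrib_left)
  have eq: "gen p q * Capelli_prod sh I J (a # l) - Capelli_prod sh I J (a # l) * gen p q - (\<Sum>s\<in>set (a # l). D (a # l) s)
     = (gen p q * X - X * gen p q - d) * R + X * (gen p q * R - R * gen p q - (\<Sum>s\<in>set l. D l s))"
    unfolding sum by (simp add: Capelli_prod_def X_def R_def algebra_simps)
  have aJ: "(I a, J a) \<in> index_pairs n" using Cons.prems by auto
  have "gen p q * X - X * gen p q - d \<in> gl_ideal n"
    unfolding X_def d_def by (rule Capelli_entry_commutator[OF pq aJ])
  moreover have "gen p q * R - R * gen p q - (\<Sum>s\<in>set l. D l s) \<in> gl_ideal n"
    unfolding R_def D_def by (rule Cons.IH) (use Cons.prems in auto)
  moreover have "R \<in> carrier (tensor_alg n)" "X \<in> carrier (tensor_alg n)"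
    unfolding R_def X_def using Cons.prems aJ
    by (auto intro: tensor_filt_carrier[OF Capelli_prod_tensor_filt] tensor_filt_carrier[OF Capelli_entry_tensor_filt])
  ultimately show ?case
    unfolding D_def[symmetric] eq by (intro gl_ideal_add gl_ideal_rmult gl_ideal_lmult)
qed (simp add: Capelli_prod_def)

lemma Capelli_minor_commutator:
  assumes pq: "(p, q) \<in> index_pairs n" and I: "I ` {1..k} \<subseteq> {1..n}" and J: "J ` {1..k} \<subseteq> {1..n}"
  shows "gen p q * Capelli_minor k I J - Capelli_minor k I J * gen p q
     - (\<Sum>s\<in>{1..k}. (if I s = q then Capelli_minor k (I(s := p)) J else 0)
          - (if J s = p then Capelli_minor k I (J(s := q)) else 0)) \<in> gl_ideal n"
proof -
  let ?l = "[1..<Suc k]"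
  let ?P = "\<lambda>I J. Capelli_prod ((-) k) I J ?l"
  define S where "S \<sigma> = (\<Sum>s\<in>{1..k}. (if (I \<circ> \<sigma>) s = q then ?P ((I \<circ> \<sigma>)(s := p)) J else 0)
          - (if J s = p then ?P (I \<circ> \<sigma>) (J(s := q)) else 0))" for \<sigma>
  have set_l: "set ?l = {1..k}" by auto
  have "gen p q * ?P (I \<circ> \<sigma>) J - ?P (I \<circ> \<sigma>) J * gen p q - S \<sigma> \<in> gl_ideal n"
    if "\<sigma> permutes {1..k}" for \<sigma>
    unfolding S_def set_l[symmetric]
  proof (rule Capelli_prod_commutator[OF pq])
    show "(I \<circ> \<sigma>) ` set [1..<Suc k] \<subseteq> {1..n}"
      using image_comp_permutes[OF I that] unfolding set_l .
    show "J ` set [1..<Suc k] \<subseteq> {1..n}"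
      using J unfolding set_l .
  qed simp
  then have "(\<Sum>\<sigma> | \<sigma> permutes {1..k}. of_int (sign \<sigma>) *
      (gen p q * ?P (I \<circ> \<sigma>) J - ?P (I \<circ> \<sigma>) J * gen p q - S \<sigma>)) \<in> gl_ideal n"
    by (intro gl_ideal_sum gl_ideal_of_int) auto
  moreover have "gen p q * (of_int c * x) = of_int c * (gen p q * x)" for c x
    by (metis mult.assoc mult_of_int_commute)
  then have "(\<Sum>\<sigma> | \<sigma> permutes {1..k}. of_int (sign \<sigma>) *
      (gen p q * ?P (I \<circ> \<sigma>) J - ?P (I \<circ> \<sigma>) J * gen p q - S \<sigma>))
     = gen p q * Capelli_minor k I J - Capelli_minor k I J * gen p q - (\<Sum>\<sigma> | \<sigma> permutes {1..k}. of_int (sign \<sigma>) * S \<sigma>)"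
    unfolding Capelli_minor_def
    by (simp add: right_diff_distrib sum_subtractf sum_distrib_left sum_distrib_right mult.assoc)
  moreover have "(\<Sum>\<sigma> | \<sigma> permutes {1..k}. of_int (sign \<sigma>) * S \<sigma>)
     = (\<Sum>s\<in>{1..k}. (if I s = q then Capelli_minor k (I(s := p)) J else 0)
          - (if J s = p then Capelli_minor k I (J(s := q)) else 0))"
  proof -
    have S: "S \<sigma> = (\<Sum>s\<in>{1..k}. (if I s = q then ?P (I(s := p) \<circ> \<sigma>) J else 0)
          - (if J s = p then ?P (I \<circ> \<sigma>) (J(s := q)) else 0))" if \<sigma>: "\<sigma> permutes {1..k}" for \<sigma>
    proof -
      \<comment> \<open>A change of the permuted row sequence at \<open>s\<close> is a change of
        \<open>I\<close> at \<open>\<sigma> s\<close>. As \<open>\<sigma>\<close> permutes the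
        positions, the sum over them can be reindexed so that the replaced position no longer
        depends on \<open>\<sigma>\<close>.\<close>
      have upd: "(I \<circ> \<sigma>)(s := p) = I(\<sigma> s := p) \<circ> \<sigma>" for s
        using permutes_inj[OF \<sigma>] by (auto simp: fun_eq_iff inj_eq)
      have "(\<Sum>s\<in>{1..k}. if (I \<circ> \<sigma>) s = q then ?P ((I \<circ> \<sigma>)(s := p)) J else 0)
         = (\<Sum>s\<in>{1..k}. if I (\<sigma> s) = q then ?P (I(\<sigma> s := p) \<circ> \<sigma>) J else 0)"
        by (simp only: upd o_apply)
      also have "\<dots> = (\<Sum>s\<in>{1..k}. if I s = q then ?P (I(s := p) \<circ> \<sigma>) J else 0)"
        by (rule sum.reindex_bij_betw[OF permutes_imp_bij[OF \<sigma>],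
              of "\<lambda>s. if I s = q then ?P (I(s := p) \<circ> \<sigma>) J else 0"])
      finally show ?thesis unfolding S_def by (simp add: sum_subtractf)
    qed
    have "(\<Sum>\<sigma> | \<sigma> permutes {1..k}. of_int (sign \<sigma>) * S \<sigma>)
      = (\<Sum>\<sigma> | \<sigma> permutes {1..k}. \<Sum>s\<in>{1..k}. (if I s = q then of_int (sign \<sigma>) * ?P (I(s := p) \<circ> \<sigma>) J else 0)
          - (if J s = p then of_int (sign \<sigma>) * ?P (I \<circ> \<sigma>) (J(s := q)) else 0))"
      by (intro sum.cong) (auto simp: S sum_distrib_left right_diff_distrib if_distrib intro!: sum.cong)
    also have "\<dots> = (\<Sum>s\<in>{1..k}. \<Sum>\<sigma> | \<sigma> permutes {1..k}. (if I s = q then of_int (sign \<sigma>) * ?P (I(s := p) \<circ> \<sigma>) J else 0)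
          - (if J s = p then of_int (sign \<sigma>) * ?P (I \<circ> \<sigma>) (J(s := q)) else 0))"
      by (rule sum.swap)
    also have "\<dots> = (\<Sum>s\<in>{1..k}. (if I s = q then Capelli_minor k (I(s := p)) J else 0)
          - (if J s = p then Capelli_minor k I (J(s := q)) else 0))"
      by (intro sum.cong) (auto simp: Capelli_minor_def sum_subtractf sum_negf)
    finally show ?thesis .
  qed
  ultimately show ?thesis by simp
qed

definition Capelli_total :: "nat \<Rightarrow> nat \<Rightarrow> gl_tensor" where
  "Capelli_total n k = (\<Sum>J\<in>{1..k} \<rightarrow>\<^sub>E {1..n}. Capelli_minor k J J)"

text \<open>
  The commutator with \<open>gen p q\<close> replaces a row index \<open>q\<close> by \<open>p\<close>, minus a column index \<open>p\<close> by \<open>q\<close>.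
  On the diagonal sum over all index sequences these contributions cancel after reindexing.
\<close>

lemma Capelli_total_commutator:
  assumes pq: "(p, q) \<in> index_pairs n"
  shows "gen p q * Capelli_total n k - Capelli_total n k * gen p q \<in> gl_ideal n"
proof -
  let ?A = "{1..k} \<rightarrow>\<^sub>E {1..n}"
  have fin: "finite ?A" by (simp add: finite_PiE)
  define D where "D J = (\<Sum>s\<in>{1..k}. (if J s = q then Capelli_minor k (J(s := p)) J else 0)
          - (if J s = p then Capelli_minor k J (J(s := q)) else 0))" for J
  have "(\<Sum>J\<in>?A. gen p q * Capelli_minor k J J - Capelli_minor k J J * gen p q - D J) \<in> gl_ideal n"
    unfolding D_def by (intro gl_ideal_sum Capelli_minor_commutator pq) auto
  moreover have "(\<Sum>J\<in>?A. D J) = 0"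
  proof -
    have "(\<Sum>J\<in>?A. if J s = q then Capelli_minor k (J(s := p)) J else 0)
        = (\<Sum>J\<in>?A. if J s = p then Capelli_minor k J (J(s := q)) else 0)" if s: "s \<in> {1..k}" for s
    proof -
      have "(\<Sum>J | J \<in> ?A \<and> J s = q. Capelli_minor k (J(s := p)) J)
          = (\<Sum>J | J \<in> ?A \<and> J s = p. Capelli_minor k J (J(s := q)))"
      proof (rule sum.reindex_bij_witness[of _ "\<lambda>J. J(s := q)" "\<lambda>J. J(s := p)"])
        fix J assume "J \<in> {J. J \<in> ?A \<and> J s = q}"
        then show "J(s := p) \<in> {J. J \<in> ?A \<and> J s = p}" "(J(s := p))(s := q) = J"
          "Capelli_minor k (J(s := p)) ((J(s := p))(s := q)) = Capelli_minor k (J(s := p)) J"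
          using s pq by (auto simp: PiE_iff extensional_def fun_upd_idem_iff split: if_splits)
      next
        fix J assume "J \<in> {J. J \<in> ?A \<and> J s = p}"
        then show "J(s := q) \<in> {J. J \<in> ?A \<and> J s = q}" "(J(s := q))(s := p) = J"
          using s pq by (auto simp: PiE_iff extensional_def fun_upd_idem_iff split: if_splits)
      qed
      then show ?thesis by (simp only: sum.inter_filter[OF fin])
    qed
    then show ?thesis
      unfolding D_def by (subst sum.swap) (simp add: sum_subtractf)
  qed
  ultimately show ?thesis
    by (simp add: Capelli_total_def sum_subtractf sum_distrib_left sum_distrib_right)
qed

section \<open>From all index sequences to increasing lists\<close>

lemma finite_increasing_lists: "finite (increasing_lists n k)"
proof (rule finite_subset)
  show "increasing_lists n k \<subseteq> {v. set v \<subseteq> {1..n} \<and> length v = k}" by (auto simp: increasing_lists_def)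
qed (simp add: finite_lists_length_eq)

lemma increasing_lists_nth:
  assumes "v \<in> increasing_lists n k"
  shows "bij_betw (\<lambda>a. v ! (a - 1)) {1..k} (set v)"
proof -
  have v: "length v = k" "distinct v"
    using assms by (auto simp: increasing_lists_def strict_sorted_iff)
  have "bij_betw (\<lambda>a. a - 1) {1..k} {..<k}"
    by (rule bij_betw_byWitness[of _ "\<lambda>a. a + 1"]) auto
  moreover have "bij_betw (nth v) {..<k} (set v)"
    using v by (intro bij_betw_nth) auto
  ultimately show ?thesis
    using bij_betw_trans[of "\<lambda>a. a - 1" "{1..k}" "{..<k}" "nth v" "set v"] by (simp add: comp_def)
qed

text \<open>An injective sequence is the sorted list of its values together with one ordering of
  them. This groups the diagonal sum into \<open>fact k\<close> rearrangements of each increasing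
  list.\<close>

lemma injective_sequences_bij:
  "bij_betw (\<lambda>(v, \<rho>). \<lambda>a\<in>{1..k}. v ! (\<rho> a - 1)) (increasing_lists n k \<times> {\<rho>. \<rho> permutes {1..k}})
     {J \<in> {1..k} \<rightarrow>\<^sub>E {1..n}. inj_on J {1..k}}" (is "bij_betw ?f ?A ?B")
proof (rule bij_betw_imageI)
  have im: "?f (v, \<rho>) ` {1..k} = set v" if "v \<in> increasing_lists n k" "\<rho> permutes {1..k}" for v \<rho>
  proof -
    have "?f (v, \<rho>) ` {1..k} = (\<lambda>a. v ! (a - 1)) ` (\<rho> ` {1..k})" by (auto simp: image_image)
    also have "\<dots> = set v"
      using permutes_image[OF that(2)] bij_betw_imp_surj_on[OF increasing_lists_nth[OF that(1)]] by simp
    finally show ?thesis .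
  qed
  show "inj_on ?f ?A"
  proof (rule inj_onI, clarify)
    fix v \<rho> v' \<rho>'
    assume v: "v \<in> increasing_lists n k" "v' \<in> increasing_lists n k" and \<rho>: "\<rho> permutes {1..k}" "\<rho>' permutes {1..k}"
      and eq: "(\<lambda>a\<in>{1..k}. v ! (\<rho> a - 1)) = (\<lambda>a\<in>{1..k}. v' ! (\<rho>' a - 1))"
    have "set v = set v'" using im[OF v(1) \<rho>(1)] im[OF v(2) \<rho>(2)] eq by simp
    then have vv: "v = v'" using v by (auto simp: increasing_lists_def intro: strict_sorted_equal)
    have "\<rho> a = \<rho>' a" if a: "a \<in> {1..k}" for a
    proof -
      have "v ! (\<rho> a - 1) = v ! (\<rho>' a - 1)"
        using fun_cong[OF eq, of a] a vv by simp
      then show ?thesis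
        using a permutes_in_image[OF \<rho>(1), of a] permutes_in_image[OF \<rho>(2), of a]
          inj_on_eq_iff[OF bij_betw_imp_inj_on[OF increasing_lists_nth[OF v(1)]], of "\<rho> a" "\<rho>' a"] by simp
    qed
    moreover have "\<rho> a = \<rho>' a" if "a \<notin> {1..k}" for a
      using permutes_not_in[OF \<rho>(1) that] permutes_not_in[OF \<rho>(2) that] by simp
    ultimately show "v = v' \<and> \<rho> = \<rho>'" using vv by blast
  qed
  show "?f ` ?A = ?B"
  proof (intro equalityI subsetI)
    fix J assume "J \<in> ?f ` ?A"
    then obtain v \<rho> where v: "v \<in> increasing_lists n k" and \<rho>: "\<rho> permutes {1..k}" and J: "J = ?f (v, \<rho>)"
      by auto
    have "inj_on J {1..k}"
    proof (rule eq_card_imp_inj_on)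
      have "card (set v) = k"
        using v by (simp add: increasing_lists_def strict_sorted_iff distinct_card)
      then show "card (J ` {1..k}) = card {1..k}"
        using im[OF v \<rho>] unfolding J by simp
    qed simp
    moreover have "J ` {1..k} \<subseteq> {1..n}"
      using im[OF v \<rho>] v unfolding J by (simp add: increasing_lists_def)
    moreover have "J \<in> extensional {1..k}" unfolding J by simp
    ultimately show "J \<in> ?B" by (auto simp: PiE_def image_subset_iff)
  next
    fix J assume "J \<in> ?B"
    then have J: "J \<in> {1..k} \<rightarrow>\<^sub>E {1..n}" "inj_on J {1..k}" by auto
    define v where "v = sorted_list_of_set (J ` {1..k})"
    have "card (J ` {1..k}) = k" using card_image[OF J(2)] by simp
    then have v: "v \<in> increasing_lists n k" "set v = J ` {1..k}"
      using J(1) by (auto simp: increasing_lists_def v_def)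
    let ?w = "\<lambda>a. v ! (a - 1)"
    define \<rho> where "\<rho> a = (if a \<in> {1..k} then inv_into {1..k} ?w (J a) else a)" for a
    have w: "bij_betw ?w {1..k} (J ` {1..k})" using increasing_lists_nth[OF v(1)] v(2) by simp
    have "bij_betw (inv_into {1..k} ?w \<circ> J) {1..k} {1..k}"
      by (rule bij_betw_trans[OF _ bij_betw_inv_into[OF w]]) (simp add: bij_betw_def J(2))
    then have "bij_betw \<rho> {1..k} {1..k}"
      by (rule iffD1[OF bij_betw_cong, rotated]) (simp add: \<rho>_def)
    then have \<rho>: "\<rho> permutes {1..k}"
      by (rule bij_imp_permutes) (auto simp: \<rho>_def)
    have "J = ?f (v, \<rho>)"
    proof
      fix a show "J a = ?f (v, \<rho>) a"
      proof (cases "a \<in> {1..k}")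
        case True
        have "?w (inv_into {1..k} ?w (J a)) = J a"
          using True w by (intro bij_betw_inv_into_right) auto
        with True show ?thesis by (simp add: \<rho>_def)
      next
        case False
        then show ?thesis using J(1) by (auto simp: PiE_def extensional_def)
      qed
    qed
    then show "J \<in> ?f ` ?A" using v(1) \<rho> by blast
  qed
qed

lemma Capelli_tensor_tensor_filt: "Capelli_tensor n k \<in> tensor_filt n k"
  unfolding Capelli_tensor_def
proof (intro tensor_filt_sum Capelli_minor_tensor_filt)
  fix v assume v: "v \<in> increasing_lists n k"
  then show "(\<lambda>a. v ! (a - 1)) ` {1..k} \<subseteq> {1..n}"
    using bij_betw_imp_surj_on[OF increasing_lists_nth[OF v]] by (simp add: increasing_lists_def)
  then show "(\<lambda>a. v ! (a - 1)) ` {1..k} \<subseteq> {1..n}" .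
qed

text \<open>Sequences with a repetition contribute elements of the ideal, and the
  \<open>fact k\<close> orderings of an increasing list have congruent minors.\<close>

lemma Capelli_total_Capelli_tensor: "Capelli_total n k - of_nat (fact k) * Capelli_tensor n k \<in> gl_ideal n"
proof -
  let ?A = "{1..k} \<rightarrow>\<^sub>E {1..n}"
  let ?w = "\<lambda>v a. v ! (a - 1) :: nat"
  let ?Inj = "{J \<in> ?A. inj_on J {1..k}}"
  have fin: "finite ?A" by (simp add: finite_PiE)
  have "Capelli_total n k = (\<Sum>J\<in>?Inj. Capelli_minor k J J) + (\<Sum>J\<in>?A - ?Inj. Capelli_minor k J J)"
    unfolding Capelli_total_def using fin by (subst sum.subset_diff[of ?Inj]) (auto simp: add.commute)
  moreover have "(\<Sum>J\<in>?A - ?Inj. Capelli_minor k J J) \<in> gl_ideal n"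
    by (intro gl_ideal_sum Capelli_minor_repeated) auto
  moreover have "(\<Sum>J\<in>?Inj. Capelli_minor k J J) - of_nat (fact k) * Capelli_tensor n k \<in> gl_ideal n"
  proof -
    have "(\<Sum>J\<in>?Inj. Capelli_minor k J J) = (\<Sum>(v, \<rho>)\<in>increasing_lists n k \<times> {\<rho>. \<rho> permutes {1..k}}. Capelli_minor k (?w v \<circ> \<rho>) (?w v \<circ> \<rho>))"
      unfolding sum.reindex_bij_betw[OF injective_sequences_bij, symmetric]
      by (intro sum.cong) (auto intro!: Capelli_minor_cong)
    also have "\<dots> = (\<Sum>v\<in>increasing_lists n k. \<Sum>\<rho> | \<rho> permutes {1..k}. Capelli_minor k (?w v \<circ> \<rho>) (?w v \<circ> \<rho>))"
      by (simp add: sum.cartesian_product)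
    finally have 1: "(\<Sum>J\<in>?Inj. Capelli_minor k J J) = \<dots>" .
    have "card {\<rho>. \<rho> permutes {1..k}} = fact k"
      by (rule card_permutations) auto
    then have "of_nat (fact k) * Capelli_tensor n k = (\<Sum>v\<in>increasing_lists n k. \<Sum>\<rho> | \<rho> permutes {1..k}. Capelli_minor k (?w v) (?w v))"
      by (simp add: Capelli_tensor_def sum_distrib_left)
    then have "(\<Sum>J\<in>?Inj. Capelli_minor k J J) - of_nat (fact k) * Capelli_tensor n k
       = (\<Sum>v\<in>increasing_lists n k. \<Sum>\<rho> | \<rho> permutes {1..k}. Capelli_minor k (?w v \<circ> \<rho>) (?w v \<circ> \<rho>) - Capelli_minor k (?w v) (?w v))"
      by (simp add: 1 sum_subtractf)
    also have "\<dots> \<in> gl_ideal n"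
    proof (intro gl_ideal_sum Capelli_minor_permute)
      fix v assume v: "v \<in> increasing_lists n k"
      then show "?w v ` {1..k} \<subseteq> {1..n}"
        using bij_betw_imp_surj_on[OF increasing_lists_nth[OF v]] by (simp add: increasing_lists_def)
    qed auto
    finally show ?thesis .
  qed
  moreover have "a - d \<in> gl_ideal n" if "a = b + c" "c \<in> gl_ideal n" "b - d \<in> gl_ideal n" for a b c d
    using gl_ideal_add[OF that(2,3)] that(1) by (simp add: algebra_simps)
  ultimately show ?thesis by blast
qed

text \<open>Invariance is visible for \<open>Capelli_total\<close> only. It passes to
  \<open>fact k\<close> times the Capelli tensor, and then \<open>fact k\<close> is
  cancelled.\<close>

lemma Capelli_tensor_central: "U_class n (Capelli_tensor n k) \<in> carrier (zeta n)"
  unfolding center_iff_commutator[OF tensor_filt_carrier[OF Capelli_tensor_tensor_filt]]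
proof (intro allI impI)
  fix p q assume pq: "(p, q) \<in> index_pairs n"
  have g: "gen p q \<in> carrier (tensor_alg n)" using tensor_filt_carrier[OF tensor_filt_gen[OF pq]] .
  let ?d = "Capelli_total n k - of_nat (fact k) * Capelli_tensor n k"
  have "of_nat (fact k) * (gen p q * Capelli_tensor n k - Capelli_tensor n k * gen p q)
      = (gen p q * Capelli_total n k - Capelli_total n k * gen p q) - (gen p q * ?d - ?d * gen p q)"
    using mult_of_nat_commute[of "fact k" "gen p q"]
    by (simp add: right_diff_distrib left_diff_distrib mult.assoc[symmetric])
  also have "\<dots> \<in> gl_ideal n"
    by (intro gl_ideal_diff Capelli_total_commutator gl_ideal_lmult gl_ideal_rmult Capelli_total_Capelli_tensor pq g)
  finally show "gen p q * Capelli_tensor n k - Capelli_tensor n k * gen p q \<in> gl_ideal n"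
    by (rule gl_ideal_cancel_nat) simp
qed

section \<open>Polynomial functions\<close>

text \<open>The number is an upper bound for the degree, which is why constants occur with every
  \<open>d\<close>. Working with functions allows differentiation along curves and substitution of
  matrices.\<close>

inductive poly_fun :: "'v set \<Rightarrow> nat \<Rightarrow> (('v \<Rightarrow> complex) \<Rightarrow> complex) \<Rightarrow> bool" for V where
  poly_fun_const: "poly_fun V d (\<lambda>_. c)"
| poly_fun_var: "v \<in> V \<Longrightarrow> poly_fun V (Suc d) (\<lambda>Y. Y v)"
| poly_fun_add: "poly_fun V d f \<Longrightarrow> poly_fun V d g \<Longrightarrow> poly_fun V d (\<lambda>Y. f Y + g Y)"
| poly_fun_mult: "poly_fun V d f \<Longrightarrow> poly_fun V e g \<Longrightarrow> poly_fun V (d + e) (\<lambda>Y. f Y * g Y)"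

lemma poly_fun_mono: "poly_fun V d f \<Longrightarrow> d \<le> e \<Longrightarrow> poly_fun V e f"
  using poly_fun_mult[of V d f "e - d" "\<lambda>_. 1"] poly_fun_const[of V "e - d" 1] by simp

lemma poly_fun_cmult: "poly_fun V d f \<Longrightarrow> poly_fun V d (\<lambda>Y. c * f Y)"
  using poly_fun_mult[OF poly_fun_const[of V 0 c], of d f] by simp

lemma poly_fun_diff: "poly_fun V d f \<Longrightarrow> poly_fun V d g \<Longrightarrow> poly_fun V d (\<lambda>Y. f Y - g Y)"
  using poly_fun_add[OF _ poly_fun_cmult[of V d g "-1"], of f] by simp

lemma poly_fun_sum: "(\<And>i. i \<in> A \<Longrightarrow> poly_fun V d (f i)) \<Longrightarrow> poly_fun V d (\<lambda>Y. \<Sum>i\<in>A. f i Y)"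
  by (induction A rule: infinite_finite_induct) (auto intro: poly_fun_add poly_fun_const)

lemma poly_fun_cong: "poly_fun V d f \<Longrightarrow> (\<And>v. v \<in> V \<Longrightarrow> Y v = Z v) \<Longrightarrow> f Y = f Z"
  by (induction rule: poly_fun.induct) auto

lemma poly_fun_line_poly:
  assumes "poly_fun V d f"
  shows "\<exists>q :: complex poly. degree q \<le> d \<and> (\<forall>t. f (\<lambda>v. Y v + t * X v) = poly q t)"
  using assms
proof (induction rule: poly_fun.induct)
  case (poly_fun_const d c)
  show ?case by (rule exI[of _ "[:c:]"]) simp
next
  case (poly_fun_var v d)
  show ?case by (rule exI[of _ "[:Y v, X v:]"]) (simp add: degree_pCons_le order.trans)
next
  case (poly_fun_add d f g)
  then obtain p q where "degree p \<le> d" "degree q \<le> d" "\<And>t. f (\<lambda>v. Y v + t * X v) = poly p t"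
    "\<And>t. g (\<lambda>v. Y v + t * X v) = poly q t" by blast
  then show ?case by (intro exI[of _ "p + q"]) (simp add: degree_add_le)
next
  case (poly_fun_mult d f e g)
  then obtain p q where "degree p \<le> d" "degree q \<le> e" "\<And>t. f (\<lambda>v. Y v + t * X v) = poly p t"
    "\<And>t. g (\<lambda>v. Y v + t * X v) = poly q t" by blast
  then show ?case
    by (intro exI[of _ "p * q"]) (use degree_mult_le[of p q] in \<open>auto intro: order.trans add_mono\<close>)
qed

text \<open>On the line from \<open>Y0\<close> to \<open>Y\<close> both functions become polynomials
  in one variable. Their product vanishes identically and the one from \<open>h\<close> is nonzero
  at \<open>Y0\<close>, so the one from \<open>f\<close> is zero.\<close>

lemma poly_fun_density:
  assumes f: "poly_fun V d f" and h: "poly_fun V e h" and Y0: "h Y0 \<noteq> 0"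
    and vanish: "\<And>Y. h Y \<noteq> 0 \<Longrightarrow> f Y = 0"
  shows "f Y = 0"
proof -
  obtain p where p: "f (\<lambda>v. Y0 v + t * (Y v - Y0 v)) = poly p t" for t
    using poly_fun_line_poly[OF f, of Y0 "\<lambda>v. Y v - Y0 v"] by blast
  obtain q where q: "h (\<lambda>v. Y0 v + t * (Y v - Y0 v)) = poly q t" for t
    using poly_fun_line_poly[OF h, of Y0 "\<lambda>v. Y v - Y0 v"] by blast
  have "poly (p * q) t = 0" for t
    using vanish[of "\<lambda>v. Y0 v + t * (Y v - Y0 v)"] by (auto simp: p q)
  then have "p * q = 0" using poly_all_0_iff_0 by blast
  moreover have "q \<noteq> 0" using Y0 q[of 0] by auto
  ultimately have "p = 0" by simp
  then show ?thesis using p[of 1] by simp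
qed

section \<open>Directional derivatives of polynomial functions\<close>

definition dir_deriv :: "(('v \<Rightarrow> complex) \<Rightarrow> complex) \<Rightarrow> ('v \<Rightarrow> complex) \<Rightarrow> ('v \<Rightarrow> complex) \<Rightarrow> complex" where
  "dir_deriv f Y X = deriv (\<lambda>t. f (\<lambda>v. Y v + t * X v)) 0"

lemma poly_fun_line_deriv:
  assumes "poly_fun V d f"
  shows "((\<lambda>t. f (\<lambda>v. Y v + t * X v)) has_field_derivative dir_deriv f Y X) (at 0)"
proof -
  obtain q where "f (\<lambda>v. Y v + t * X v) = poly q t" for t
    using poly_fun_line_poly[OF assms, of Y X] by blast
  then have eq: "(\<lambda>t. f (\<lambda>v. Y v + t * X v)) = poly q" by auto
  show ?thesis
    unfolding dir_deriv_def eq using poly_DERIV[of q 0] DERIV_imp_deriv[OF poly_DERIV[of q 0]] by simp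
qed

lemma dir_deriv_const [simp]: "dir_deriv (\<lambda>_. c) Y X = 0"
  by (simp add: dir_deriv_def)

lemma dir_deriv_var [simp]: "dir_deriv (\<lambda>Y. Y v) Y X = X v"
proof -
  have "((\<lambda>t. Y v + t * X v) has_field_derivative X v) (at 0)"
    by (auto intro!: derivative_eq_intros)
  then show ?thesis by (simp add: dir_deriv_def DERIV_imp_deriv)
qed

lemma dir_deriv_add:
  assumes "poly_fun V d f" "poly_fun V e g"
  shows "dir_deriv (\<lambda>Y. f Y + g Y) Y X = dir_deriv f Y X + dir_deriv g Y X"
  using DERIV_add[OF poly_fun_line_deriv[OF assms(1)] poly_fun_line_deriv[OF assms(2)], of Y X Y X]
  unfolding dir_deriv_def[of "\<lambda>Y. f Y + g Y"] by (rule DERIV_imp_deriv)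

lemma dir_deriv_mult:
  assumes "poly_fun V d f" "poly_fun V e g"
  shows "dir_deriv (\<lambda>Y. f Y * g Y) Y X = f Y * dir_deriv g Y X + dir_deriv f Y X * g Y"
  using DERIV_mult'[OF poly_fun_line_deriv[OF assms(1)] poly_fun_line_deriv[OF assms(2)], of Y X Y X]
  unfolding dir_deriv_def[of "\<lambda>Y. f Y * g Y"] by (simp add: DERIV_imp_deriv)

lemma dir_deriv_cmult:
  assumes "poly_fun V d f"
  shows "dir_deriv (\<lambda>Y. c * f Y) Y X = c * dir_deriv f Y X"
  using dir_deriv_mult[OF poly_fun_const[of V 0 c] assms, of Y X] by simp

lemma dir_deriv_chain:
  assumes "poly_fun V d f" and "\<And>v. v \<in> V \<Longrightarrow> ((\<lambda>t. M t v) has_field_derivative M' v) (at s)"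
  shows "((\<lambda>t. f (M t)) has_field_derivative dir_deriv f (M s) M') (at s)"
  using assms(1)
proof (induction rule: poly_fun.induct)
  case (poly_fun_add d f g)
  show ?case
    using DERIV_add[OF poly_fun_add.IH] by (simp add: dir_deriv_add[OF poly_fun_add.hyps])
next
  case (poly_fun_mult d f e g)
  show ?case
    using DERIV_mult'[OF poly_fun_mult.IH] by (simp add: dir_deriv_mult[OF poly_fun_mult.hyps])
qed (use assms(2) in auto)

lemma dir_deriv_cong: "poly_fun V d f \<Longrightarrow> (\<And>v. v \<in> V \<Longrightarrow> X v = X' v) \<Longrightarrow> dir_deriv f Y X = dir_deriv f Y X'"
  by (induction rule: poly_fun.induct) (auto simp: dir_deriv_add dir_deriv_mult)

lemma dir_deriv_linear:
  assumes "poly_fun V d f"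
  shows "dir_deriv f Y (\<lambda>v. \<Sum>i\<in>A. c i * X i v) = (\<Sum>i\<in>A. c i * dir_deriv f Y (X i))"
  using assms
  by (induction rule: poly_fun.induct)
     (auto simp: dir_deriv_add dir_deriv_mult sum.distrib sum_distrib_left sum_distrib_right algebra_simps)

lemma poly_fun_dir_deriv:
  assumes "poly_fun V d f" and "\<And>v. v \<in> V \<Longrightarrow> poly_fun V 1 (\<lambda>Y. \<xi> Y v)"
  shows "poly_fun V d (\<lambda>Y. dir_deriv f Y (\<xi> Y))"
  using assms(1)
proof (induction rule: poly_fun.induct)
  case (poly_fun_var v d)
  then show ?case using poly_fun_mono[OF assms(2)[of v], of "Suc d"] by (simp add: One_nat_def)
next
  case (poly_fun_add d f g)
  then show ?case by (simp add: dir_deriv_add[OF poly_fun_add.hyps] poly_fun.poly_fun_add)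
next
  case (poly_fun_mult d f e g)
  then show ?case
    unfolding dir_deriv_mult[OF poly_fun_mult.hyps] by (intro poly_fun.poly_fun_add poly_fun.poly_fun_mult) auto
qed (auto intro: poly_fun.intros)

section \<open>A faithful filtered representation\<close>

text \<open>The vector field of a polarization operator: \<open>shear (i, j) Y\<close> has row
  \<open>i\<close> of \<open>Y\<close> in row \<open>j\<close> and zeros elsewhere, so
  differentiating along it is the sum over \<open>l\<close> of \<open>Y (i, l)\<close> times the
  partial derivative by \<open>Y (j, l)\<close>.\<close>

definition shear :: "nat \<times> nat \<Rightarrow> (nat \<times> nat \<Rightarrow> complex) \<Rightarrow> nat \<times> nat \<Rightarrow> complex" where
  "shear x Y v = (if fst v = snd x then Y (fst x, snd v) else 0)"

text \<open>In a commutator of two such operators the multiplications commute, the derivations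
  reproduce the bracket of gl(n), and the mixed terms differentiate the coordinates, which yields
  the coordinates belonging to the same bracket. Hence the sum is again a representation.\<close>

definition act :: "nat \<times> nat \<Rightarrow> ((nat \<times> nat \<Rightarrow> complex) \<Rightarrow> complex) \<Rightarrow> (nat \<times> nat \<Rightarrow> complex) \<Rightarrow> complex" where
  "act x f Y = Y x * f Y + dir_deriv f Y (shear x Y)"

definition act_word :: "(nat \<times> nat) list \<Rightarrow> ((nat \<times> nat \<Rightarrow> complex) \<Rightarrow> complex) \<Rightarrow> (nat \<times> nat \<Rightarrow> complex) \<Rightarrow> complex" where
  "act_word w f = foldr act w f"

lemma act_word_simps [simp]: "act_word [] f = f" "act_word (x # w) f = act x (act_word w f)"
  by (simp_all add: act_word_def)

lemma act_word_append: "act_word (v @ w) f = act_word v (act_word w f)"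
  by (simp add: act_word_def)

lemma poly_fun_shear: "x \<in> index_pairs n \<Longrightarrow> v \<in> index_pairs n \<Longrightarrow> poly_fun (index_pairs n) 1 (\<lambda>Y. shear x Y v)"
  by (cases x; cases v; cases "fst v = snd x") (auto simp: shear_def One_nat_def intro!: poly_fun_const poly_fun_var)

lemma poly_fun_dir_deriv_shear: "x \<in> index_pairs n \<Longrightarrow> poly_fun (index_pairs n) d f \<Longrightarrow> poly_fun (index_pairs n) d (\<lambda>Y. dir_deriv f Y (shear x Y))"
  by (rule poly_fun_dir_deriv) (auto intro: poly_fun_shear)

lemma poly_fun_act: "x \<in> index_pairs n \<Longrightarrow> poly_fun (index_pairs n) d f \<Longrightarrow> poly_fun (index_pairs n) (Suc d) (act x f)"
  unfolding act_def[abs_def]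
  using poly_fun_mult[OF poly_fun_var[of x "index_pairs n" 0]]
  by (intro poly_fun_add) (auto intro: poly_fun_mono[OF poly_fun_dir_deriv_shear])

lemma poly_fun_act_word: "set w \<subseteq> index_pairs n \<Longrightarrow> poly_fun (index_pairs n) d f \<Longrightarrow> poly_fun (index_pairs n) (length w + d) (act_word w f)"
  by (induction w) (auto intro: poly_fun_act)

text \<open>A commutator of derivations is a derivation: on a product the mixed first derivatives
  are symmetric in the two fields and cancel. The identity is therefore decided on
  coordinates.\<close>

lemma dir_deriv_shear_commutator:
  assumes ij: "(i, j) \<in> index_pairs n" and kl: "(k, l) \<in> index_pairs n" and "poly_fun (index_pairs n) d f"
  shows "dir_deriv (\<lambda>Y. dir_deriv f Y (shear (k, l) Y)) Y (shear (i, j) Y)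
       - dir_deriv (\<lambda>Y. dir_deriv f Y (shear (i, j) Y)) Y (shear (k, l) Y)
       = (if j = k then dir_deriv f Y (shear (i, l) Y) else 0) - (if l = i then dir_deriv f Y (shear (k, j) Y) else 0)"
  using assms(3)
proof (induction rule: poly_fun.induct)
  case (poly_fun_var v d)
  have "dir_deriv (\<lambda>Y. shear x Y v) Y X = (if fst v = snd x then X (fst x, snd v) else 0)" for x X
    by (simp add: shear_def)
  then show ?case by (simp add: shear_def)
next
  case (poly_fun_add d f g)
  have D: "poly_fun (index_pairs n) d (\<lambda>Y. dir_deriv h Y (shear x Y))" if "h = f \<or> h = g" "x = (i, j) \<or> x = (k, l)" for h x
    using that poly_fun_add.hyps ij kl by (auto intro!: poly_fun_dir_deriv_shear)
  have "dir_deriv (\<lambda>Y. dir_deriv (\<lambda>Y. f Y + g Y) Y (shear (k, l) Y)) Y (shear (i, j) Y)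
       - dir_deriv (\<lambda>Y. dir_deriv (\<lambda>Y. f Y + g Y) Y (shear (i, j) Y)) Y (shear (k, l) Y)
     = (dir_deriv (\<lambda>Y. dir_deriv f Y (shear (k, l) Y)) Y (shear (i, j) Y)
       - dir_deriv (\<lambda>Y. dir_deriv f Y (shear (i, j) Y)) Y (shear (k, l) Y))
     + (dir_deriv (\<lambda>Y. dir_deriv g Y (shear (k, l) Y)) Y (shear (i, j) Y)
       - dir_deriv (\<lambda>Y. dir_deriv g Y (shear (i, j) Y)) Y (shear (k, l) Y))"
    by (simp add: dir_deriv_add[OF poly_fun_add.hyps] dir_deriv_add[OF D D])
  then show ?case
    unfolding poly_fun_add.IH dir_deriv_add[OF poly_fun_add.hyps] by simp
next
  case (poly_fun_mult d f e g)
  note hyps = poly_fun_mult.hyps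
  have D: "poly_fun (index_pairs n) d (\<lambda>Y. dir_deriv f Y (shear x Y))" "poly_fun (index_pairs n) e (\<lambda>Y. dir_deriv g Y (shear x Y))"
    if "x = (i, j) \<or> x = (k, l)" for x
    using that hyps ij kl by (auto intro!: poly_fun_dir_deriv_shear)
  have E: "dir_deriv (\<lambda>Y. dir_deriv (\<lambda>Y. f Y * g Y) Y (shear x Y)) Y X =
      f Y * dir_deriv (\<lambda>Y. dir_deriv g Y (shear x Y)) Y X + dir_deriv f Y X * dir_deriv g Y (shear x Y)
      + (dir_deriv f Y (shear x Y) * dir_deriv g Y X + dir_deriv (\<lambda>Y. dir_deriv f Y (shear x Y)) Y X * g Y)"
    if "x = (i, j) \<or> x = (k, l)" for x X
    unfolding dir_deriv_mult[OF hyps]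
    by (subst dir_deriv_add[OF poly_fun.poly_fun_mult[OF hyps(1) D(2)[OF that]] poly_fun.poly_fun_mult[OF D(1)[OF that] hyps(2)]])
       (simp add: dir_deriv_mult[OF hyps(1) D(2)[OF that]] dir_deriv_mult[OF D(1)[OF that] hyps(2)])
  have "dir_deriv (\<lambda>Y. dir_deriv (\<lambda>Y. f Y * g Y) Y (shear (k, l) Y)) Y (shear (i, j) Y)
       - dir_deriv (\<lambda>Y. dir_deriv (\<lambda>Y. f Y * g Y) Y (shear (i, j) Y)) Y (shear (k, l) Y)
     = f Y * (dir_deriv (\<lambda>Y. dir_deriv g Y (shear (k, l) Y)) Y (shear (i, j) Y)
       - dir_deriv (\<lambda>Y. dir_deriv g Y (shear (i, j) Y)) Y (shear (k, l) Y))
     + (dir_deriv (\<lambda>Y. dir_deriv f Y (shear (k, l) Y)) Y (shear (i, j) Y)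
       - dir_deriv (\<lambda>Y. dir_deriv f Y (shear (i, j) Y)) Y (shear (k, l) Y)) * g Y"
    by (simp add: E algebra_simps)
  also have "\<dots> = (if j = k then dir_deriv (\<lambda>Y. f Y * g Y) Y (shear (i, l) Y) else 0)
      - (if l = i then dir_deriv (\<lambda>Y. f Y * g Y) Y (shear (k, j) Y) else 0)"
    unfolding poly_fun_mult.IH by (simp add: dir_deriv_mult[OF hyps] algebra_simps)
  finally show ?case .
qed simp

lemma act_commutator:
  assumes ij: "(i, j) \<in> index_pairs n" and kl: "(k, l) \<in> index_pairs n" and f: "poly_fun (index_pairs n) d f"
  shows "act (i, j) (act (k, l) f) Y - act (k, l) (act (i, j) f) Y
       = (if j = k then act (i, l) f Y else 0) - (if l = i then act (k, j) f Y else 0)"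
proof -
  have E: "act x (act y f) Y = Y x * (Y y * f Y + dir_deriv f Y (shear y Y)) +
      (Y y * dir_deriv f Y (shear x Y) + shear x Y y * f Y + dir_deriv (\<lambda>Y. dir_deriv f Y (shear y Y)) Y (shear x Y))"
    if "y \<in> index_pairs n" for x y
  proof -
    have "dir_deriv (act y f) Y X = Y y * dir_deriv f Y X + X y * f Y + dir_deriv (\<lambda>Y. dir_deriv f Y (shear y Y)) Y X" for X
      unfolding act_def[abs_def]
      by (simp add: dir_deriv_add[OF poly_fun_mult[OF poly_fun_var[OF that, of 0] f] poly_fun_dir_deriv_shear[OF that f]]
          dir_deriv_mult[OF poly_fun_var[OF that, of 0] f])
    then show ?thesis unfolding act_def[of x "act y f"] by (simp add: act_def[of y])
  qed
  show ?thesis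
    using dir_deriv_shear_commutator[OF assms, of Y]
    unfolding E[OF ij] E[OF kl] by (auto simp: act_def shear_def algebra_simps)
qed

section \<open>The action and the top symbol of a tensor\<close>

definition lin_ext :: "('a list \<Rightarrow> complex) \<Rightarrow> ('a word \<Rightarrow>\<^sub>0 complex) \<Rightarrow> complex" where
  "lin_ext g p = (\<Sum>w\<in>Poly_Mapping.keys p. poly_mapping.lookup p w * g (letters w))"

lemma lin_ext_superset:
  assumes "finite A" "Poly_Mapping.keys p \<subseteq> A"
  shows "lin_ext g p = (\<Sum>w\<in>A. poly_mapping.lookup p w * g (letters w))"
  unfolding lin_ext_def by (rule sum.mono_neutral_left) (use assms in \<open>auto simp: in_keys_iff\<close>)

lemma lin_ext_0 [simp]: "lin_ext g 0 = 0"
  by (simp add: lin_ext_def)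

lemma lin_ext_single [simp]: "lin_ext g (Poly_Mapping.single (Word w) c) = c * g w"
  by (simp add: lin_ext_def)

lemma lin_ext_add: "lin_ext g (p + q) = lin_ext g p + lin_ext g q"
proof -
  let ?A = "Poly_Mapping.keys p \<union> Poly_Mapping.keys q"
  have "lin_ext g (p + q) = (\<Sum>w\<in>?A. poly_mapping.lookup (p + q) w * g (letters w))"
    by (rule lin_ext_superset) (auto simp: keys_add)
  also have "\<dots> = lin_ext g p + lin_ext g q"
    by (simp add: lin_ext_superset[of ?A p] lin_ext_superset[of ?A q] lookup_add algebra_simps sum.distrib)
  finally show ?thesis .
qed

lemma lin_ext_uminus: "lin_ext g (- p) = - lin_ext g p"
  using lin_ext_add[of g p "- p"] by (simp add: eq_neg_iff_add_eq_0 add.commute)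

lemma lin_ext_diff: "lin_ext g (p - q) = lin_ext g p - lin_ext g q"
  using lin_ext_add[of g p "- q"] by (simp add: lin_ext_uminus)

definition act_tensor :: "gl_tensor \<Rightarrow> ((nat \<times> nat \<Rightarrow> complex) \<Rightarrow> complex) \<Rightarrow> (nat \<times> nat \<Rightarrow> complex) \<Rightarrow> complex" where
  "act_tensor p f Y = lin_ext (\<lambda>w. act_word w f Y) p"

definition word_eval :: "('v \<Rightarrow> complex) \<Rightarrow> 'v list \<Rightarrow> complex" where
  "word_eval Y w = prod_list (map Y w)"

definition top_symbol :: "nat \<Rightarrow> gl_tensor \<Rightarrow> (nat \<times> nat \<Rightarrow> complex) \<Rightarrow> complex" where
  "top_symbol m p Y = lin_ext (\<lambda>w. if length w = m then word_eval Y w else 0) p"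

lemma act_tensor_add: "act_tensor (p + q) f Y = act_tensor p f Y + act_tensor q f Y"
  by (simp add: act_tensor_def lin_ext_add)

lemma act_tensor_diff: "act_tensor (p - q) f Y = act_tensor p f Y - act_tensor q f Y"
  by (simp add: act_tensor_def lin_ext_diff)

lemma act_tensor_word_mon: "act_tensor (word_mon w) f = act_word w f"
  by (simp add: fun_eq_iff act_tensor_def word_mon_def)

lemma act_word_add:
  assumes "set w \<subseteq> index_pairs n" "poly_fun (index_pairs n) d f" "poly_fun (index_pairs n) d g"
  shows "act_word w (\<lambda>Y. f Y + g Y) Y = act_word w f Y + act_word w g Y"
  using assms(1)
proof (induction w arbitrary: Y)
  case (Cons x w)
  then have "act_word w (\<lambda>Y. f Y + g Y) = (\<lambda>Y. act_word w f Y + act_word w g Y)" by auto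
  then show ?case
    using Cons.prems by (simp add: act_def dir_deriv_add[OF poly_fun_act_word[OF _ assms(2)] poly_fun_act_word[OF _ assms(3)]] algebra_simps)
qed simp

lemma act_word_cmult:
  assumes "set w \<subseteq> index_pairs n" "poly_fun (index_pairs n) d f"
  shows "act_word w (\<lambda>Y. c * f Y) Y = c * act_word w f Y"
  using assms(1)
proof (induction w arbitrary: Y)
  case (Cons x w)
  then have "act_word w (\<lambda>Y. c * f Y) = (\<lambda>Y. c * act_word w f Y)" by auto
  then show ?case
    using Cons.prems by (simp add: act_def dir_deriv_cmult[OF poly_fun_act_word[OF _ assms(2)]] algebra_simps)
qed simp

lemma poly_fun_act_tensor:
  assumes "p \<in> tensor_filt n m" "poly_fun (index_pairs n) d f"
  shows "poly_fun (index_pairs n) (m + d) (act_tensor p f)"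
  using assms(1)
proof (induction rule: tensor_filt_induct)
  case (single w c)
  have "act_tensor (Poly_Mapping.single (Word w) c) f = (\<lambda>Y. c * act_word w f Y)"
    by (simp add: fun_eq_iff act_tensor_def)
  then show ?case
    using poly_fun_mono[OF poly_fun_cmult[OF poly_fun_act_word[OF single(1) assms(2)]]] single(2) by simp
next
  case (add p q)
  have "act_tensor (p + q) f = (\<lambda>Y. act_tensor p f Y + act_tensor q f Y)" by (simp add: fun_eq_iff act_tensor_add)
  with add show ?case by (simp add: poly_fun_add)
qed (simp add: act_tensor_def[abs_def] poly_fun_const)

lemma act_tensor_mult:
  assumes p: "p \<in> tensor_filt n a" and q: "q \<in> tensor_filt n b" and f: "poly_fun (index_pairs n) d f"
  shows "act_tensor (p * q) f Y = act_tensor p (act_tensor q f) Y"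
  using p
proof (induction rule: tensor_filt_induct)
  case (single u c)
  show ?case using q
  proof (induction arbitrary: Y rule: tensor_filt_induct_mem)
    case zero
    \<comment> \<open>The zero function is written as \<open>0 * 0\<close> so that
      \<open>act_word_cmult\<close> applies with scalar 0.\<close>
    have "act_word u (\<lambda>Y. 0 * 0) Y = 0 * act_word u (\<lambda>Y. 0) Y"
      by (rule act_word_cmult[OF single(1) poly_fun_const])
    then show ?case by (simp add: act_tensor_def[abs_def])
  next
    case (single v e)
    have "act_tensor (Poly_Mapping.single (Word v) e) f = (\<lambda>Y. e * act_word v f Y)"
      by (simp add: fun_eq_iff act_tensor_def)
    then show ?case
      using act_word_cmult[OF \<open>set u \<subseteq> index_pairs n\<close> poly_fun_act_word[OF single(1) f], of e Y]
      by (simp add: mult_single plus_word_def act_tensor_def act_word_append)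
  next
    case (add q r)
    note b = add.hyps
    have "act_tensor (q + r) f = (\<lambda>Y. act_tensor q f Y + act_tensor r f Y)" by (simp add: fun_eq_iff act_tensor_add)
    moreover have S: "act_tensor (Poly_Mapping.single (Word u) c) g Y = c * act_word u g Y" for g
      by (simp add: act_tensor_def)
    ultimately show ?case
      using act_word_add[OF single(1) poly_fun_act_tensor[OF b(1) f] poly_fun_act_tensor[OF b(2) f], of Y]
      by (simp add: distrib_left act_tensor_add add.IH)
  qed
next
  case (add p p')
  then show ?case by (simp add: distrib_right act_tensor_add)
qed (simp add: act_tensor_def)

text \<open>The tensors annihilating all polynomial functions form a two-sided ideal
  \<open>J\<close> that contains the relations. So the action descends to the enveloping
  algebra.\<close>

lemma gl_ideal_act_tensor:
  assumes "p \<in> gl_ideal n" "poly_fun (index_pairs n) d f"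
  shows "act_tensor p f Y = 0"
proof -
  define J where "J = {p \<in> carrier (tensor_alg n). \<forall>d f Y. poly_fun (index_pairs n) d f \<longrightarrow> act_tensor p f Y = 0}"
  have zero: "act_tensor q (\<lambda>_. 0) Y = 0" if "q \<in> tensor_filt n m" for q m Y
    using that
  proof (induction rule: tensor_filt_induct)
    case (single w c)
    have "act_word w (\<lambda>Y. 0 * 0) Y = 0 * act_word w (\<lambda>Y. 0) Y"
      by (rule act_word_cmult[OF single(1) poly_fun_const])
    then show ?case by (simp add: act_tensor_def)
  qed (simp_all add: act_tensor_def lin_ext_add)
  have "ideal J (tensor_alg n)"
  proof (rule idealI[OF tensor_alg_ring])
    show "subgroup J (add_monoid (tensor_alg n))"
    proof (rule group.subgroupI[OF abelian_group.a_group])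
      show "abelian_group (tensor_alg n)"
        using tensor_alg_ring ring_def by blast
      show "J \<noteq> {}" by (auto simp: J_def act_tensor_def carrier_tensor_alg intro!: exI[of _ 0])
      fix p assume p: "p \<in> J"
      interpret ring "tensor_alg n" by (rule tensor_alg_ring)
      have "\<ominus>\<^bsub>tensor_alg n\<^esub> p = - p"
        by (rule minus_equality) (use p carrier_closed in \<open>auto simp: J_def\<close>)
      then have "inv\<^bsub>add_monoid (tensor_alg n)\<^esub> p = - p" by (simp add: a_inv_def)
      then show "inv\<^bsub>add_monoid (tensor_alg n)\<^esub> p \<in> J"
        using p carrier_closed(4) by (auto simp: J_def act_tensor_def lin_ext_uminus)
    qed (auto simp: J_def carrier_closed act_tensor_add)
  next
    fix p x assume p: "p \<in> J" and x: "x \<in> carrier (tensor_alg n)"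
    obtain a b where ab: "p \<in> tensor_filt n a" "x \<in> tensor_filt n b"
      using p x by (auto simp: J_def carrier_tensor_alg_UN)
    have "act_tensor (x * p) f Y = 0" "act_tensor (p * x) f Y = 0" if f: "poly_fun (index_pairs n) d f" for d f Y
    proof -
      have "act_tensor p f = (\<lambda>_. 0)" using p f by (auto simp: J_def)
      then show "act_tensor (x * p) f Y = 0"
        using act_tensor_mult[OF ab(2,1) f] zero[OF ab(2)] by simp
      show "act_tensor (p * x) f Y = 0"
        using act_tensor_mult[OF ab f] p poly_fun_act_tensor[OF ab(2) f] by (auto simp: J_def)
    qed
    then show "x \<otimes>\<^bsub>tensor_alg n\<^esub> p \<in> J" "p \<otimes>\<^bsub>tensor_alg n\<^esub> x \<in> J"
      using p x by (auto simp: J_def carrier_closed)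
  qed
  moreover have "gl_relations n \<subseteq> J"
  proof
    fix r assume r: "r \<in> gl_relations n"
    then obtain i j k l where ij: "(i, j) \<in> index_pairs n" and kl: "(k, l) \<in> index_pairs n"
      and r_def: "r = word_mon [(i, j), (k, l)] - word_mon [(k, l), (i, j)]
         - ((if j = k then word_mon [(i, l)] else 0) - (if l = i then word_mon [(k, j)] else 0))"
      unfolding gl_relations_def by (auto simp: word_mon_Cons gl_bracket_def)
    have "act_tensor r f Y = 0" if f: "poly_fun (index_pairs n) d f" for d f Y
      using act_commutator[OF ij kl f, of Y] by (simp add: r_def act_tensor_diff act_tensor_word_mon)(auto simp: act_tensor_word_mon act_tensor_def)
    then show "r \<in> J" using subsetD[OF gl_relations_carrier r] by (simp add: J_def)
  qed
  ultimately have "gl_ideal n \<subseteq> J"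
    unfolding gl_ideal_def by (rule ring.genideal_minimal[OF tensor_alg_ring])
  then show ?thesis using assms by (auto simp: J_def)
qed

lemma word_eval_simps [simp]: "word_eval Y [] = 1" "word_eval Y (x # w) = Y x * word_eval Y w"
  by (simp_all add: word_eval_def)

lemma word_eval_append: "word_eval Y (v @ w) = word_eval Y v * word_eval Y w"
  by (simp add: word_eval_def)

lemma poly_fun_word_eval: "set w \<subseteq> V \<Longrightarrow> poly_fun V (length w) (\<lambda>Y. word_eval Y w)"
proof (induction w)
  case (Cons x w)
  then show ?case using poly_fun_mult[OF poly_fun_var[of x V 0], of "length w" "\<lambda>Y. word_eval Y w"] by simp
qed (simp add: poly_fun_const)

lemma poly_fun_top_symbol: "p \<in> tensor_filt n a \<Longrightarrow> poly_fun (index_pairs n) m (top_symbol m p)"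
proof (induction rule: tensor_filt_induct)
  case (single w c)
  show ?case
    using poly_fun_cmult[OF poly_fun_word_eval[OF single(1)], of c]
    by (cases "length w = m") (auto simp: top_symbol_def[abs_def] intro: poly_fun_const)
next
  case (add p q)
  then show ?case by (simp add: top_symbol_def[abs_def] lin_ext_add poly_fun_add)
qed (simp add: top_symbol_def[abs_def] poly_fun_const)

lemma top_symbol_add: "top_symbol m (p + q) Y = top_symbol m p Y + top_symbol m q Y"
  by (simp add: top_symbol_def lin_ext_add)

lemma top_symbol_diff: "top_symbol m (p - q) Y = top_symbol m p Y - top_symbol m q Y"
  by (simp add: top_symbol_def lin_ext_diff)

lemma top_symbol_lower: "p \<in> tensor_filt n a \<Longrightarrow> a < m \<Longrightarrow> top_symbol m p Y = 0"
  by (induction rule: tensor_filt_induct) (auto simp: top_symbol_def lin_ext_add)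

lemma top_symbol_mult:
  assumes "p \<in> tensor_filt n a" "q \<in> tensor_filt n b"
  shows "top_symbol (a + b) (p * q) Y = top_symbol a p Y * top_symbol b q Y"
  using assms(1)
proof (induction rule: tensor_filt_induct)
  case (single u c)
  show ?case using assms(2)
  proof (induction rule: tensor_filt_induct)
    case (single v e)
    with \<open>length u \<le> a\<close> show ?case
      by (auto simp: top_symbol_def mult_single plus_word_def word_eval_append)
  next
    case (add q r)
    then show ?case by (simp add: distrib_left top_symbol_add)
  qed (simp add: top_symbol_def)
next
  case (add p p')
  then show ?case by (simp add: distrib_right top_symbol_add)
qed (simp add: top_symbol_def)

lemma word_eval_scale: "word_eval (\<lambda>v. t * Y v) w = t ^ length w * word_eval Y w"
  by (induction w) (auto simp: algebra_simps)

lemma top_symbol_scale: "top_symbol m p (\<lambda>v. t * Y v) = t ^ m * top_symbol m p Y"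
  by (auto simp: top_symbol_def lin_ext_def word_eval_scale sum_distrib_left intro!: sum.cong)

text \<open>Applied to the constant 1, each letter raises the degree once, by its multiplication;
  derivations keep the degree and only feed the remainder \<open>g\<close>. For the empty word the
  truncated bound \<open>length w - 1\<close> is 0 and would still admit a constant remainder, so
  its vanishing is carried along separately.\<close>

lemma act_word_top:
  assumes "set w \<subseteq> index_pairs n"
  shows "\<exists>g. poly_fun (index_pairs n) (length w - 1) g \<and> (w = [] \<longrightarrow> g = (\<lambda>_. 0)) \<and>
     (\<forall>Y. act_word w (\<lambda>_. 1) Y = word_eval Y w + g Y)"
  using assms
proof (induction w)
  case Nil
  show ?case by (rule exI[of _ "\<lambda>_. 0"]) (simp add: poly_fun_const)
next
  case (Cons x w)
  then obtain g where g: "poly_fun (index_pairs n) (length w - 1) g" "w = [] \<longrightarrow> g = (\<lambda>_. 0)"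
    and eq: "act_word w (\<lambda>_. 1) = (\<lambda>Y. word_eval Y w + g Y)" by auto
  have x: "x \<in> index_pairs n" and w: "set w \<subseteq> index_pairs n" using Cons.prems by auto
  note m = poly_fun_word_eval[OF w]
  have g': "poly_fun (index_pairs n) (length w) g" using g(1) by (rule poly_fun_mono) simp
  let ?g = "\<lambda>Y. Y x * g Y + dir_deriv (\<lambda>Y. word_eval Y w + g Y) Y (shear x Y)"
  have "poly_fun (index_pairs n) (length w) (\<lambda>Y. Y x * g Y)"
  proof (cases "w = []")
    case True
    then show ?thesis using g(2) by (simp add: poly_fun_const)
  next
    case False
    then show ?thesis using poly_fun_mult[OF poly_fun_var[OF x, of 0] g(1)] by simp
  qed
  then have "poly_fun (index_pairs n) (length w) ?g"
    by (intro poly_fun_add poly_fun_dir_deriv_shear[OF x] m g')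
  then show ?case
    by (intro exI[of _ ?g]) (simp add: eq act_def distrib_left)
qed

lemma act_tensor_top:
  assumes "p \<in> tensor_filt n m"
  shows "\<exists>g. poly_fun (index_pairs n) (m - 1) g \<and> (m = 0 \<longrightarrow> g = (\<lambda>_. 0)) \<and>
     (\<forall>Y. act_tensor p (\<lambda>_. 1) Y = top_symbol m p Y + g Y)"
  using assms
proof (induction rule: tensor_filt_induct)
  case zero
  show ?case by (rule exI[of _ "\<lambda>_. 0"]) (simp add: poly_fun_const act_tensor_def top_symbol_def)
next
  case (single w c)
  obtain g where g: "poly_fun (index_pairs n) (length w - 1) g" "w = [] \<longrightarrow> g = (\<lambda>_. 0)"
    and eq: "\<And>Y. act_word w (\<lambda>_. 1) Y = word_eval Y w + g Y"
    using act_word_top[OF single(1)] by blast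
  show ?case
  proof (cases "length w = m")
    case True
    then show ?thesis
      using poly_fun_cmult[OF g(1), of c] g(2)
      by (intro exI[of _ "\<lambda>Y. c * g Y"]) (auto simp: act_tensor_def top_symbol_def eq algebra_simps)
  next
    case False
    then have less: "length w \<le> m - 1" "m \<noteq> 0" using single(2) by auto
    have "poly_fun (index_pairs n) (m - 1) (\<lambda>Y. c * (word_eval Y w + g Y))"
      using less by (intro poly_fun_cmult poly_fun_add poly_fun_mono[OF poly_fun_word_eval[OF single(1)]] poly_fun_mono[OF g(1)]) auto
    then show ?thesis
      using False less by (intro exI[of _ "\<lambda>Y. c * (word_eval Y w + g Y)"]) (simp add: act_tensor_def top_symbol_def eq)
  qed
next
  case (add p q)
  then obtain g h where "poly_fun (index_pairs n) (m - 1) g" "poly_fun (index_pairs n) (m - 1) h" "m = 0 \<longrightarrow> g = (\<lambda>_. 0)"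
    "m = 0 \<longrightarrow> h = (\<lambda>_. 0)" "\<And>Y. act_tensor p (\<lambda>_. 1) Y = top_symbol m p Y + g Y" "\<And>Y. act_tensor q (\<lambda>_. 1) Y = top_symbol m q Y + h Y"
    by blast
  then show ?case
    by (intro exI[of _ "\<lambda>Y. g Y + h Y"]) (auto simp: act_tensor_add top_symbol_add poly_fun_add)
qed

text \<open>The part of the Poincare-Birkhoff-Witt theorem on which symbols rest. An element of the
  ideal kills the constant 1, so its symbol is minus a polynomial of smaller degree. On the ray
  through \<open>Y\<close> the symbol is \<open>t ^ m\<close> times a constant, and comparing
  coefficients at \<open>m\<close> makes this constant zero.\<close>

lemma gl_ideal_top_symbol:
  assumes I: "p \<in> gl_ideal n" and p: "p \<in> tensor_filt n m"
  shows "top_symbol m p Y = 0"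
proof -
  obtain g where g: "poly_fun (index_pairs n) (m - 1) g" "m = 0 \<longrightarrow> g = (\<lambda>_. 0)"
    and "\<And>Y. act_tensor p (\<lambda>_. 1) Y = top_symbol m p Y + g Y"
    using act_tensor_top[OF p] by blast
  then have eq: "top_symbol m p Y = - g Y" for Y
    using gl_ideal_act_tensor[OF I poly_fun_const[of _ 0 1], of Y] by (simp add: eq_neg_iff_add_eq_0)
  show ?thesis
  proof (cases "m = 0")
    case True
    then show ?thesis using eq g(2) by simp
  next
    case False
    obtain q where q: "degree q \<le> m - 1" "\<And>t. g (\<lambda>v. 0 + t * Y v) = poly q t"
      using poly_fun_line_poly[OF g(1), of "\<lambda>_. 0" Y] by blast
    have "poly (monom (top_symbol m p Y) m + q) t = 0" for t
      using eq[of "\<lambda>v. t * Y v"] q(2)[of t] by (simp add: top_symbol_scale poly_monom mult.commute)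
    then have "monom (top_symbol m p Y) m + q = 0" using poly_all_0_iff_0 by blast
    then have "coeff (monom (top_symbol m p Y) m + q) m = 0" by simp
    moreover have "coeff q m = 0" using q(1) False by (intro coeff_eq_0) auto
    ultimately show ?thesis by simp
  qed
qed

section \<open>Tensors of vanishing symbol\<close>

definition mset_eval :: "('v \<Rightarrow> complex) \<Rightarrow> 'v multiset \<Rightarrow> complex" where
  "mset_eval Y M = prod_mset (image_mset Y M)"

lemma mset_eval_mset: "mset_eval Y (mset w) = word_eval Y w"
  by (simp add: mset_eval_def word_eval_def prod_mset_prod_list flip: mset_map)

lemma mset_eval_mult: "mset_eval (\<lambda>v. Y v * Z v) M = mset_eval Y M * mset_eval Z M"
  by (induction M) (auto simp: mset_eval_def algebra_simps)

lemma mset_eval_separates: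
  assumes "M \<noteq> N"
  shows "\<exists>Z. mset_eval Z M \<noteq> mset_eval Z N"
proof -
  obtain v where v: "count M v \<noteq> count N v"
    using assms by (meson multiset_eqI)
  \<comment> \<open>The value 2 at \<open>v\<close> turns the multiplicity of \<open>v\<close> into
    an exponent, and powers of 2 determine their exponents.\<close>
  have "mset_eval (\<lambda>u. if u = v then 2 else 1) L = of_nat (2 ^ count L v)" for L
    by (induction L) (auto simp: mset_eval_def)
  then show ?thesis
    using v by (intro exI[of _ "\<lambda>u. if u = v then 2 else 1"]) (simp only: of_nat_eq_iff power_inject_exp, simp)
qed

text \<open>Dedekind's independence of characters, for the monoid of functions under pointwise product.\<close>

lemma mset_eval_independent:
  assumes "finite S" "\<And>Y. (\<Sum>M\<in>S. b M * mset_eval Y M) = 0" "M \<in> S"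
  shows "b M = 0"
  using assms
proof (induction S arbitrary: b M rule: finite_induct)
  case (insert N S)
  have S: "b L = 0" if L: "L \<in> S" for L
  proof -
    obtain Z where Z: "mset_eval Z L \<noteq> mset_eval Z N"
      using mset_eval_separates[of L N] insert.hyps(2) L by blast
    \<comment> \<open>The relation twisted by \<open>Z\<close>, minus \<open>mset_eval Z N\<close>
      times the relation itself: the term of \<open>N\<close> disappears, while the coefficient of
      \<open>L\<close> is multiplied by a nonzero number.\<close>
    have "(\<Sum>K\<in>S. (b K * (mset_eval Z K - mset_eval Z N)) * mset_eval Y K) = 0" for Y
    proof -
      have "(\<Sum>K\<in>insert N S. b K * mset_eval (\<lambda>v. Y v * Z v) K)
          - mset_eval Z N * (\<Sum>K\<in>insert N S. b K * mset_eval Y K) = 0"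
        by (simp only: insert.prems(1) mult_zero_right diff_self)
      moreover have "(\<Sum>K\<in>insert N S. b K * mset_eval (\<lambda>v. Y v * Z v) K)
          - mset_eval Z N * (\<Sum>K\<in>insert N S. b K * mset_eval Y K)
         = (\<Sum>K\<in>insert N S. (b K * (mset_eval Z K - mset_eval Z N)) * mset_eval Y K)"
        by (simp only: sum_distrib_left sum_subtractf[symmetric] mset_eval_mult)
           (auto intro!: sum.cong simp: algebra_simps)
      ultimately show ?thesis using insert.hyps by simp
    qed
    then have "b L * (mset_eval Z L - mset_eval Z N) = 0"
      by (rule insert.IH[OF _ L])
    with Z show ?thesis by simp
  qed
  have "(\<Sum>K\<in>insert N S. b K * mset_eval (\<lambda>_. 1) K) = b N"
    using insert.hyps S by (simp add: mset_eval_def)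
  then have "b N = 0" using insert.prems(1) by simp
  then show ?case using S insert.prems(2) by blast
qed simp

section \<open>Equality in the enveloping algebra up to lower filtration\<close>

definition eqmod :: "nat \<Rightarrow> nat \<Rightarrow> gl_tensor \<Rightarrow> gl_tensor \<Rightarrow> bool" where
  "eqmod n m p q \<longleftrightarrow> (\<exists>r \<in> tensor_filt n m. p - q - r \<in> gl_ideal n)"

lemma eqmod_refl [simp]: "eqmod n m p p"
  unfolding eqmod_def by (rule bexI[of _ 0]) simp_all

lemma eqmod_trans:
  assumes "eqmod n m p q" "eqmod n m q r"
  shows "eqmod n m p r"
proof -
  obtain x y where "x \<in> tensor_filt n m" "y \<in> tensor_filt n m" "p - q - x \<in> gl_ideal n" "q - r - y \<in> gl_ideal n"
    using assms by (auto simp: eqmod_def)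
  moreover have "(p - q - x) + (q - r - y) = p - r - (x + y)" by (simp add: algebra_simps)
  ultimately show ?thesis
    unfolding eqmod_def by (intro bexI[of _ "x + y"] tensor_filt_add) (metis gl_ideal_add)+
qed

lemma eqmod_sym:
  assumes "eqmod n m p q" shows "eqmod n m q p"
proof -
  obtain x where "x \<in> tensor_filt n m" "p - q - x \<in> gl_ideal n"
    using assms by (auto simp: eqmod_def)
  moreover have "- (p - q - x) = q - p - (- x)" by (simp add: algebra_simps)
  ultimately show ?thesis
    unfolding eqmod_def by (intro bexI[of _ "- x"] tensor_filt_uminus) (metis gl_ideal_uminus)+
qed

lemma eqmod_lmult:
  assumes "eqmod n m p q" "x \<in> tensor_filt n a"
  shows "eqmod n (a + m) (x * p) (x * q)"
proof -
  obtain r where "r \<in> tensor_filt n m" "p - q - r \<in> gl_ideal n"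
    using assms(1) by (auto simp: eqmod_def)
  moreover have "x * (p - q - r) = x * p - x * q - x * r" by (simp add: right_diff_distrib)
  ultimately show ?thesis
    unfolding eqmod_def using tensor_filt_carrier[OF assms(2)]
    by (intro bexI[of _ "x * r"] tensor_filt_mult assms(2)) (metis gl_ideal_lmult)+
qed

lemma eqmod_add:
  assumes "eqmod n m p q" "eqmod n m p' q'"
  shows "eqmod n m (p + p') (q + q')"
proof -
  obtain x y where "x \<in> tensor_filt n m" "y \<in> tensor_filt n m" "p - q - x \<in> gl_ideal n" "p' - q' - y \<in> gl_ideal n"
    using assms by (auto simp: eqmod_def)
  moreover have "(p - q - x) + (p' - q' - y) = p + p' - (q + q') - (x + y)" by (simp add: algebra_simps)
  ultimately show ?thesis
    unfolding eqmod_def by (intro bexI[of _ "x + y"] tensor_filt_add) (metis gl_ideal_add)+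
qed

lemma eqmod_sum: "(\<And>i. i \<in> A \<Longrightarrow> eqmod n m (f i) (g i)) \<Longrightarrow> eqmod n m (sum f A) (sum g A)"
  by (induction A rule: infinite_finite_induct) (auto intro: eqmod_add)

text \<open>Passing \<open>x\<close> over one letter costs a bracket, which replaces two letters by
  one. All corrections are therefore shorter than the word by at least one.\<close>

lemma eqmod_move:
  assumes "set (x # ys @ zs) \<subseteq> index_pairs n"
  shows "eqmod n (length (ys @ zs)) (word_mon (ys @ x # zs)) (word_mon (x # ys @ zs))"
  using assms
proof (induction ys)
  case (Cons y ys)
  obtain i j k l where x: "x = (i, j)" and y: "y = (k, l)" by (cases x; cases y)
  have yT: "gen k l \<in> tensor_filt n 1" using Cons.prems y by (intro tensor_filt_gen) auto
  have "eqmod n (1 + length (ys @ zs)) (gen k l * word_mon (ys @ x # zs)) (gen k l * word_mon (x # ys @ zs))"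
    using Cons by (intro eqmod_lmult yT) auto
  moreover have "eqmod n (1 + length (ys @ zs)) (gen k l * word_mon (x # ys @ zs)) (word_mon (x # y # ys @ zs))"
  proof -
    let ?b = "gl_bracket k l i j * word_mon (ys @ zs)"
    have "?b \<in> tensor_filt n (1 + length (ys @ zs))"
      using Cons.prems x y by (intro tensor_filt_mult tensor_filt_bracket tensor_filt_word_mon) auto
    moreover have "gen k l * word_mon (x # ys @ zs) - word_mon (x # y # ys @ zs) - ?b
       = (gen k l * gen i j - gen i j * gen k l - gl_bracket k l i j) * word_mon (ys @ zs)"
      by (simp add: x y word_mon_Cons algebra_simps)
    then have "gen k l * word_mon (x # ys @ zs) - word_mon (x # y # ys @ zs) - ?b \<in> gl_ideal n"
      using Cons.prems x y
      by (simp only:) (rule gl_ideal_rmult[OF gl_ideal_relation tensor_filt_carrier[OF tensor_filt_word_mon]], auto)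
    ultimately show ?thesis unfolding eqmod_def by blast
  qed
  ultimately have "eqmod n (1 + length (ys @ zs)) (gen k l * word_mon (ys @ x # zs)) (word_mon (x # y # ys @ zs))"
    by (rule eqmod_trans)
  then show ?case
    by (simp only: word_mon_Cons[of "(k, l)" "ys @ x # zs"] y fst_conv snd_conv append_Cons length_Cons plus_1_eq_Suc)
qed simp

lemma eqmod_permute:
  assumes "mset v = mset w" "set v \<subseteq> index_pairs n" "length v \<le> Suc m"
  shows "eqmod n m (word_mon v) (word_mon w)"
  using assms
proof (induction v arbitrary: w m)
  case (Cons x v)
  obtain ys zs where w: "w = ys @ x # zs"
    using Cons.prems(1) by (metis list.set_intros(1) set_mset_mset split_list)
  have mset: "mset v = mset (ys @ zs)" using Cons.prems(1) w by simp
  have set: "set (ys @ zs) = set v" using mset by (metis set_mset_mset)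
  have len: "length (ys @ zs) = length v" using mset by (metis size_mset)
  have x: "x \<in> index_pairs n" using Cons.prems by simp
  have 1: "eqmod n m (word_mon (x # v)) (word_mon (x # ys @ zs))"
  proof (cases v)
    case Nil
    then show ?thesis using mset by simp
  next
    case (Cons a v')
    then have "m \<noteq> 0" using Cons.prems(3) \<open>length (x # v) \<le> Suc m\<close> by simp
    then obtain m' where m': "m = Suc m'" by (cases m) auto
    have "eqmod n m' (word_mon v) (word_mon (ys @ zs))"
      using Cons.IH[OF mset] Cons.prems m' by simp
    then have "eqmod n (1 + m') (gen (fst x) (snd x) * word_mon v) (gen (fst x) (snd x) * word_mon (ys @ zs))"
      using x by (intro eqmod_lmult tensor_filt_gen) auto
    then show ?thesis by (simp only: word_mon_Cons m' plus_1_eq_Suc)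
  qed
  have "eqmod n (length (ys @ zs)) (word_mon (ys @ x # zs)) (word_mon (x # ys @ zs))"
    using x set Cons.prems by (intro eqmod_move) auto
  then have 2: "eqmod n m (word_mon (ys @ x # zs)) (word_mon (x # ys @ zs))"
    unfolding eqmod_def using tensor_filt_mono[of _ n "length (ys @ zs)" m] len Cons.prems(3) by auto
  show ?case unfolding w by (rule eqmod_trans[OF 1 eqmod_sym[OF 2]])
qed simp

lemma scal_sum: "scal (sum f A) = (\<Sum>i\<in>A. scal (f i))"
  by (induction A rule: infinite_finite_induct) (simp_all add: single_add)

text \<open>Words with the same multiset of letters are congruent modulo shorter words, so the top
  part collapses to one word per multiset. The collected coefficients are those of the symbol as a
  polynomial, and they vanish because monomials are independent.\<close>

lemma top_symbol_eq_0_lower: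
  assumes p: "p \<in> tensor_filt n (Suc m)" and 0: "\<And>Y. top_symbol (Suc m) p Y = 0"
  shows "eqmod n m p 0"
proof -
  let ?K = "Poly_Mapping.keys p"
  let ?top = "{w \<in> ?K. length (letters w) = Suc m}"
  let ?c = "poly_mapping.lookup p"
  define rep :: "(nat \<times> nat) multiset \<Rightarrow> (nat \<times> nat) list" where "rep M = (SOME w. mset w = M)" for M
  have rep: "mset (rep M) = M" for M
    unfolding rep_def by (rule someI_ex) (rule ex_mset)
  let ?ms = "\<lambda>w. mset (letters w)"
  define b where "b M = (\<Sum>w | w \<in> ?top \<and> ?ms w = M. ?c w)" for M
  have fin: "finite ?top" by simp
  have b0: "b M = 0" if "M \<in> ?ms ` ?top" for M
  proof (rule mset_eval_independent[OF _ _ that])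
    fix Y
    have "(\<Sum>M\<in>?ms ` ?top. b M * mset_eval Y M) = (\<Sum>w\<in>?top. ?c w * mset_eval Y (?ms w))"
      unfolding b_def sum_distrib_right
      by (subst sum.image_gen[OF fin, of "\<lambda>w. ?c w * mset_eval Y (?ms w)" ?ms]) (auto intro!: sum.cong)
    also have "\<dots> = top_symbol (Suc m) p Y"
      unfolding top_symbol_def lin_ext_def mset_eval_mset
      by (rule sum.mono_neutral_cong_left) auto
    finally show "(\<Sum>M\<in>?ms ` ?top. b M * mset_eval Y M) = 0" using 0 by simp
  qed simp
  have p_eq: "p = (\<Sum>w\<in>?K. scal (?c w) * word_mon (letters w))"
  proof -
    have "p = (\<Sum>k\<in>?K. Poly_Mapping.single k (?c k))"
      by (rule poly_mapping_eqI)
         (simp add: lookup_sum lookup_single when_def not_in_keys_iff_lookup_eq_zero)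
    also have "\<dots> = (\<Sum>w\<in>?K. scal (?c w) * word_mon (letters w))"
      by (intro sum.cong refl) (simp flip: single_Word)
    finally show ?thesis .
  qed
  have "eqmod n m (scal (?c w) * word_mon (letters w))
     (if w \<in> ?top then scal (?c w) * word_mon (rep (?ms w)) else 0)" if w: "w \<in> ?K" for w
  proof (cases "w \<in> ?top")
    case True
    have "eqmod n m (word_mon (letters w)) (word_mon (rep (?ms w)))"
      using p w by (intro eqmod_permute) (auto simp: rep tensor_filt_def)
    from eqmod_lmult[OF this tensor_filt_scal[of _ n 0]] True show ?thesis by simp
  next
    case False
    have "scal (?c w) * word_mon (letters w) \<in> tensor_filt n (0 + length (letters w))"
      using p w by (intro tensor_filt_mult tensor_filt_scal tensor_filt_word_mon) (auto simp: tensor_filt_def)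
    then have "scal (?c w) * word_mon (letters w) \<in> tensor_filt n m"
    proof (rule tensor_filt_mono)
      show "0 + length (letters w) \<le> m"
        using False p w by (auto simp: tensor_filt_def le_Suc_eq)
    qed
    then show ?thesis using False unfolding eqmod_def by (intro bexI) auto
  qed
  then have "eqmod n m (\<Sum>w\<in>?K. scal (?c w) * word_mon (letters w))
     (\<Sum>w\<in>?K. if w \<in> ?top then scal (?c w) * word_mon (rep (?ms w)) else 0)"
    by (rule eqmod_sum)
  moreover have "(\<Sum>w\<in>?K. if w \<in> ?top then scal (?c w) * word_mon (rep (?ms w)) else 0) = 0"
  proof -
    have "(\<Sum>w\<in>?K. if w \<in> ?top then scal (?c w) * word_mon (rep (?ms w)) else 0)
       = (\<Sum>w\<in>?top. scal (?c w) * word_mon (rep (?ms w)))"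
      by (rule sum.mono_neutral_cong_right) auto
    also have "\<dots> = (\<Sum>M\<in>?ms ` ?top. \<Sum>w | w \<in> ?top \<and> ?ms w = M. scal (?c w) * word_mon (rep (?ms w)))"
      by (rule sum.image_gen[OF fin])
    also have "\<dots> = (\<Sum>M\<in>?ms ` ?top. scal (b M) * word_mon (rep M))"
    proof (rule sum.cong[OF refl])
      fix M
      have "scal (b M) = (\<Sum>w | w \<in> ?top \<and> ?ms w = M. scal (?c w))"
        unfolding b_def by (rule scal_sum)
      then show "(\<Sum>w | w \<in> ?top \<and> ?ms w = M. scal (?c w) * word_mon (rep (?ms w))) = scal (b M) * word_mon (rep M)"
        by (simp add: sum_distrib_right)
    qed
    also have "\<dots> = 0" using b0 by simp
    finally show ?thesis .
  qed
  ultimately have "eqmod n m (\<Sum>w\<in>?K. scal (?c w) * word_mon (letters w)) 0"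
    by (simp only:)
  then show ?thesis by (subst p_eq)
qed

section \<open>Symbols of central elements\<close>

text \<open>The Poisson bracket of the coordinate at \<open>(a, b)\<close> with all coordinates.
  Read as a matrix, \<open>ad_field (a, b) Y\<close> is the commutator of the elementary matrix at
  \<open>(b, a)\<close> with \<open>Y\<close>; note the reversed pair.\<close>

definition ad_field :: "nat \<times> nat \<Rightarrow> (nat \<times> nat \<Rightarrow> complex) \<Rightarrow> nat \<times> nat \<Rightarrow> complex" where
  "ad_field x Y v = (if snd x = fst v then Y (fst x, snd v) else 0) - (if snd v = fst x then Y (fst v, snd x) else 0)"

lemma top_symbol_0: "top_symbol m 0 Y = 0"
  by (simp add: top_symbol_def)

lemma top_symbol_gen: "top_symbol 1 (gen i j) Y = Y (i, j)"
  by (simp add: top_symbol_def gen_def)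

text \<open>A commutator lies one degree below the product, hence has a representative
  \<open>q\<close> no longer than \<open>w\<close>. Its symbol follows from the Leibniz rule: the
  bracket with the first letter gives \<open>ad_field\<close> at that coordinate, the rest comes by
  induction.\<close>

lemma commutator_word:
  assumes x: "(a, b) \<in> index_pairs n" and "set w \<subseteq> index_pairs n"
  shows "\<exists>q \<in> tensor_filt n (length w). gen a b * word_mon w - word_mon w * gen a b - q \<in> gl_ideal n \<and>
     (\<forall>Y. top_symbol (length w) q Y = dir_deriv (\<lambda>Y. word_eval Y w) Y (ad_field (a, b) Y))"
  using assms(2)
proof (induction w)
  case Nil
  show ?case by (rule bexI[of _ 0]) (simp_all add: top_symbol_0)
next
  case (Cons y w)
  obtain i j where y: "y = (i, j)" by (cases y)
  have ij: "(i, j) \<in> index_pairs n" and w: "set w \<subseteq> index_pairs n" using Cons.prems y by auto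
  obtain q where q: "q \<in> tensor_filt n (length w)" "gen a b * word_mon w - word_mon w * gen a b - q \<in> gl_ideal n"
    and symq: "\<And>Y. top_symbol (length w) q Y = dir_deriv (\<lambda>Y. word_eval Y w) Y (ad_field (a, b) Y)"
    using Cons.IH[OF w] by blast
  let ?B = "gl_bracket a b i j"
  let ?q = "?B * word_mon w + gen i j * q"
  have word_mon: "word_mon w \<in> tensor_filt n (length w)" and B: "?B \<in> tensor_filt n 1" and g: "gen i j \<in> tensor_filt n 1"
    using w x ij by (auto intro: tensor_filt_word_mon tensor_filt_bracket tensor_filt_gen)
  have qT: "?q \<in> tensor_filt n (1 + length w)"
    by (intro tensor_filt_add tensor_filt_mult word_mon B g q)
  have "gen a b * word_mon (y # w) - word_mon (y # w) * gen a b - ?q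
     = (gen a b * gen i j - gen i j * gen a b - ?B) * word_mon w + gen i j * (gen a b * word_mon w - word_mon w * gen a b - q)"
    by (simp add: y word_mon_Cons algebra_simps)
  also have "\<dots> \<in> gl_ideal n"
    by (intro gl_ideal_add gl_ideal_rmult[OF gl_ideal_relation[OF x ij]] gl_ideal_lmult[OF q(2)]
        tensor_filt_carrier[OF word_mon] tensor_filt_carrier[OF g])
  finally have I: "gen a b * word_mon (y # w) - word_mon (y # w) * gen a b - ?q \<in> gl_ideal n" .
  have "top_symbol (1 + length w) ?q Y = dir_deriv (\<lambda>Y. word_eval Y (y # w)) Y (ad_field (a, b) Y)" for Y
  proof -
    have "top_symbol 1 ?B Y = ad_field (a, b) Y (i, j)"
      by (auto simp: gl_bracket_def ad_field_def top_symbol_diff top_symbol_gen top_symbol_0)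
    moreover have "top_symbol (length w) (word_mon w) Y = word_eval Y w"
      by (simp add: word_mon_def top_symbol_def)
    moreover have "dir_deriv (\<lambda>Y. Y y * word_eval Y w) Y (ad_field (a, b) Y)
       = Y y * dir_deriv (\<lambda>Y. word_eval Y w) Y (ad_field (a, b) Y) + ad_field (a, b) Y y * word_eval Y w"
      using dir_deriv_mult[OF poly_fun_var[of y "index_pairs n" 0] poly_fun_word_eval[OF w]] ij y by simp
    ultimately show ?thesis
      by (simp only: top_symbol_add top_symbol_mult[OF B word_mon] top_symbol_mult[OF g q(1)] symq top_symbol_gen word_eval_simps y) simp
  qed
  then show ?case using qT I by (intro bexI[of _ ?q]) (simp_all add: One_nat_def)
qed

lemma commutator_symbol:
  assumes x: "(a, b) \<in> index_pairs n" and p: "p \<in> tensor_filt n m"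
  shows "\<exists>q \<in> tensor_filt n m. gen a b * p - p * gen a b - q \<in> gl_ideal n \<and>
     (\<forall>Y. top_symbol m q Y = dir_deriv (top_symbol m p) Y (ad_field (a, b) Y))"
  using p
proof (induction rule: tensor_filt_induct_mem)
  case zero
  have "top_symbol m 0 = (\<lambda>_. 0)" by (simp add: fun_eq_iff top_symbol_0)
  then show ?case by (intro bexI[of _ 0]) simp_all
next
  case (single w c)
  obtain q where q: "q \<in> tensor_filt n (length w)" "gen a b * word_mon w - word_mon w * gen a b - q \<in> gl_ideal n"
    and symq: "\<And>Y. top_symbol (length w) q Y = dir_deriv (\<lambda>Y. word_eval Y w) Y (ad_field (a, b) Y)"
    using commutator_word[OF x single(1)] by blast
  let ?q = "scal c * q"
  have cq: "?q \<in> tensor_filt n (0 + length w)" by (intro tensor_filt_mult tensor_filt_scal q)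
  then have "?q \<in> tensor_filt n m" using single(2) tensor_filt_mono by simp
  moreover have "gen a b * Poly_Mapping.single (Word w) c - Poly_Mapping.single (Word w) c * gen a b - ?q
     = scal c * (gen a b * word_mon w - word_mon w * gen a b - q)"
  proof -
    have "gen a b * (scal c * word_mon w) = scal c * (gen a b * word_mon w)"
      by (simp only: mult.assoc[symmetric] scal_commute[of c "gen a b"])
    then show ?thesis by (simp add: single_Word right_diff_distrib mult.assoc)
  qed
  then have "gen a b * Poly_Mapping.single (Word w) c - Poly_Mapping.single (Word w) c * gen a b - ?q \<in> gl_ideal n"
    using gl_ideal_scal[OF q(2)] by simp
  moreover have "top_symbol m ?q Y = dir_deriv (top_symbol m (Poly_Mapping.single (Word w) c)) Y (ad_field (a, b) Y)" for Y
  proof (cases "length w = m")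
    case True
    then have "top_symbol m (Poly_Mapping.single (Word w) c) = (\<lambda>Y. c * word_eval Y w)"
      by (simp add: fun_eq_iff top_symbol_def)
    moreover have "top_symbol (0 + length w) ?q Y = c * top_symbol (length w) q Y"
    proof -
      have "top_symbol 0 (scal c) Y = c" by (simp add: top_symbol_def zero_word_def)
      then show ?thesis using top_symbol_mult[OF tensor_filt_scal[of c n 0] q(1), of Y] by simp
    qed
    ultimately show ?thesis
      using True symq dir_deriv_cmult[OF poly_fun_word_eval[OF single(1)]] by simp
  next
    case False
    then have "top_symbol m ?q Y = 0" using cq single(2) by (intro top_symbol_lower[of _ n "length w"]) auto
    moreover have "top_symbol m (Poly_Mapping.single (Word w) c) = (\<lambda>_. 0)"
      using False by (simp add: fun_eq_iff top_symbol_def)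
    ultimately show ?thesis by simp
  qed
  ultimately show ?case by blast
next
  case (add p p')
  then obtain q q' where q: "q \<in> tensor_filt n m" "gen a b * p - p * gen a b - q \<in> gl_ideal n"
     "\<And>Y. top_symbol m q Y = dir_deriv (top_symbol m p) Y (ad_field (a, b) Y)"
    and q': "q' \<in> tensor_filt n m" "gen a b * p' - p' * gen a b - q' \<in> gl_ideal n"
     "\<And>Y. top_symbol m q' Y = dir_deriv (top_symbol m p') Y (ad_field (a, b) Y)"
    by blast
  have "gen a b * (p + p') - (p + p') * gen a b - (q + q') \<in> gl_ideal n"
    using gl_ideal_add[OF q(2) q'(2)] by (simp add: algebra_simps)
  moreover have "top_symbol m (p + p') = (\<lambda>Y. top_symbol m p Y + top_symbol m p' Y)"
    by (simp add: fun_eq_iff top_symbol_add)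
  then have "top_symbol m (q + q') Y = dir_deriv (top_symbol m (p + p')) Y (ad_field (a, b) Y)" for Y
    using dir_deriv_add[OF poly_fun_top_symbol[OF add.hyps(1)] poly_fun_top_symbol[OF add.hyps(2)]] q q' by (simp add: top_symbol_add)
  ultimately show ?case using tensor_filt_add[OF q(1) q'(1)] by blast
qed

definition ad_invariant :: "nat \<Rightarrow> ((nat \<times> nat \<Rightarrow> complex) \<Rightarrow> complex) \<Rightarrow> bool" where
  "ad_invariant n f \<longleftrightarrow> (\<forall>x \<in> index_pairs n. \<forall>Y. dir_deriv f Y (ad_field x Y) = 0)"

text \<open>For central \<open>p\<close> the representative \<open>q\<close> of the commutator lies
  in the ideal, so its symbol is zero. Centrality thus becomes a first-order differential equation
  for the symbol.\<close>

lemma central_ad_invariant: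
  assumes p: "p \<in> tensor_filt n m" and z: "U_class n p \<in> carrier (zeta n)"
  shows "ad_invariant n (top_symbol m p)"
  unfolding ad_invariant_def
proof (intro ballI allI)
  fix x Y assume "x \<in> index_pairs n"
  then obtain a b where x: "x = (a, b)" "(a, b) \<in> index_pairs n" by (cases x) auto
  obtain q where q: "q \<in> tensor_filt n m" "gen a b * p - p * gen a b - q \<in> gl_ideal n"
    "\<And>Y. top_symbol m q Y = dir_deriv (top_symbol m p) Y (ad_field (a, b) Y)"
    using commutator_symbol[OF x(2) p] by blast
  have "gen a b * p - p * gen a b \<in> gl_ideal n"
    using z x center_iff_commutator[OF tensor_filt_carrier[OF p]] by blast
  then have "q \<in> gl_ideal n"
    using gl_ideal_diff[OF _ q(2)] by fastforce
  then show "dir_deriv (top_symbol m p) Y (ad_field x Y) = 0"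
    using gl_ideal_top_symbol[OF _ q(1)] q(3) x by simp
qed

section \<open>Invariance under conjugation\<close>

text \<open>Coordinates are counted from 1, matrix entries from 0.\<close>

definition vec_of :: "complex mat \<Rightarrow> nat \<times> nat \<Rightarrow> complex" where
  "vec_of M v = M $$ (fst v - 1, snd v - 1)"

definition has_mat_deriv :: "nat \<Rightarrow> (complex \<Rightarrow> complex mat) \<Rightarrow> complex mat \<Rightarrow> complex \<Rightarrow> bool" where
  "has_mat_deriv n M M' s \<longleftrightarrow>
     (\<forall>i<n. \<forall>j<n. ((\<lambda>s. M s $$ (i, j)) has_field_derivative M' $$ (i, j)) (at s))"

lemma has_mat_deriv_mult:
  assumes M: "\<And>s. M s \<in> carrier_mat n n" "M' \<in> carrier_mat n n"
    and N: "\<And>s. N s \<in> carrier_mat n n" "N' \<in> carrier_mat n n"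
    and "has_mat_deriv n M M' s" "has_mat_deriv n N N' s"
  shows "has_mat_deriv n (\<lambda>s. M s * N s) (M' * N s + M s * N') s"
  unfolding has_mat_deriv_def
proof (intro allI impI)
  fix i j assume ij: "i < n" "j < n"
  have entry: "(A * B) $$ (i, j) = (\<Sum>c<n. A $$ (i, c) * B $$ (c, j))"
    if "A \<in> carrier_mat n n" "B \<in> carrier_mat n n" for A B :: "complex mat"
    using that ij by (auto simp: scalar_prod_def atLeast0LessThan)
  have "((\<lambda>s. \<Sum>c<n. M s $$ (i, c) * N s $$ (c, j)) has_field_derivative
     (\<Sum>c<n. M s $$ (i, c) * N' $$ (c, j) + M' $$ (i, c) * N s $$ (c, j))) (at s)"
    using assms(5,6) ij unfolding has_mat_deriv_def
    by (intro DERIV_sum DERIV_mult') auto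
  moreover have "(M' * N s + M s * N') $$ (i, j)
     = (\<Sum>c<n. M s $$ (i, c) * N' $$ (c, j) + M' $$ (i, c) * N s $$ (c, j))"
  proof -
    have "(M' * N s + M s * N') $$ (i, j) = (M' * N s) $$ (i, j) + (M s * N') $$ (i, j)"
      using carrier_matD[OF mult_carrier_mat[OF M(1)[of s] N(2)]] ij
      by (intro index_add_mat(1)) (simp_all only:)
    then show ?thesis
      by (simp only: entry[OF M(2) N(1)] entry[OF M(1) N(2)] sum.distrib add.commute)
  qed
  ultimately show "((\<lambda>s. (M s * N s) $$ (i, j)) has_field_derivative (M' * N s + M s * N') $$ (i, j)) (at s)"
    by (simp only: entry[OF M(1) N(1)])
qed

lemma has_mat_deriv_unique:
  assumes "has_mat_deriv n M A s" "has_mat_deriv n N B s" "A \<in> carrier_mat n n" "B \<in> carrier_mat n n"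
    and "open S" "s \<in> S" "\<And>t. t \<in> S \<Longrightarrow> M t = N t"
  shows "A = B"
proof (rule eq_matI)
  fix i j assume "i < dim_row B" "j < dim_col B"
  then have ij: "i < n" "j < n" using assms(4) by auto
  have "((\<lambda>s. M s $$ (i, j)) has_field_derivative B $$ (i, j)) (at s)"
    by (rule has_field_derivative_transform_within_open[OF _ assms(5,6)])
       (use assms(2,7) ij in \<open>auto simp: has_mat_deriv_def\<close>)
  moreover have "((\<lambda>s. M s $$ (i, j)) has_field_derivative A $$ (i, j)) (at s)"
    using assms(1) ij by (auto simp: has_mat_deriv_def)
  ultimately show "A $$ (i, j) = B $$ (i, j)" by (rule DERIV_unique[rotated])
qed (use assms in auto)

text \<open>The direction is a linear combination of the fields \<open>ad_field (a, b)\<close>, with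
  the entry of \<open>Z\<close> at \<open>(b, a)\<close> as coefficient, and
  \<open>dir_deriv\<close> is linear in the direction.\<close>

lemma ad_invariant_commutator:
  assumes f: "poly_fun (index_pairs n) d f" and inv: "ad_invariant n f"
    and Z: "Z \<in> carrier_mat n n" and M: "M \<in> carrier_mat n n"
  shows "dir_deriv f (vec_of M) (vec_of (Z * M - M * Z)) = 0"
proof -
  let ?c = "\<lambda>x. Z $$ (snd x - 1, fst x - 1)"
  have "vec_of (Z * M - M * Z) v = (\<Sum>x\<in>index_pairs n. ?c x * ad_field x (vec_of M) v)" if v: "v \<in> index_pairs n" for v
  proof -
    obtain k l where kl: "v = (k, l)" "k \<in> {1..n}" "l \<in> {1..n}" using v by (cases v) auto
    have shift: "(\<Sum>c<n. h c) = (\<Sum>a\<in>{1..n}. h (a - 1))" for h :: "nat \<Rightarrow> complex"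
      by (rule sum.reindex_bij_witness[of _ "\<lambda>a. a - 1" Suc]) (auto simp: One_nat_def)
    have entry: "(A * B) $$ (k - 1, l - 1) = (\<Sum>a\<in>{1..n}. A $$ (k - 1, a - 1) * B $$ (a - 1, l - 1))"
      if "A \<in> carrier_mat n n" "B \<in> carrier_mat n n" for A B :: "complex mat"
      unfolding shift[symmetric, of "\<lambda>c. A $$ (k - 1, c) * B $$ (c, l - 1)"]
      using that kl by (auto simp: scalar_prod_def atLeast0LessThan)
    have "(\<Sum>x\<in>index_pairs n. ?c x * ad_field x (vec_of M) v)
       = (\<Sum>a\<in>{1..n}. \<Sum>b\<in>{1..n}. Z $$ (b - 1, a - 1) * ad_field (a, b) (vec_of M) (k, l))"
      by (simp add: index_pairs_def sum.cartesian_product split_beta kl)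
    also have "\<dots> = (\<Sum>a\<in>{1..n}. \<Sum>b\<in>{1..n}. if b = k then Z $$ (b - 1, a - 1) * M $$ (a - 1, l - 1) else 0)
        - (\<Sum>a\<in>{1..n}. \<Sum>b\<in>{1..n}. if l = a then Z $$ (b - 1, a - 1) * M $$ (k - 1, b - 1) else 0)"
      unfolding sum_subtractf[symmetric]
      by (intro sum.cong) (auto simp: ad_field_def vec_of_def right_diff_distrib)
    also have "(\<Sum>a\<in>{1..n}. \<Sum>b\<in>{1..n}. if l = a then Z $$ (b - 1, a - 1) * M $$ (k - 1, b - 1) else 0)
       = (\<Sum>b\<in>{1..n}. \<Sum>a\<in>{1..n}. if l = a then Z $$ (b - 1, a - 1) * M $$ (k - 1, b - 1) else 0)"
      by (rule sum.swap)
    finally have "(\<Sum>x\<in>index_pairs n. ?c x * ad_field x (vec_of M) v) = (Z * M) $$ (k - 1, l - 1) - (M * Z) $$ (k - 1, l - 1)"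
      unfolding entry[OF Z M] entry[OF M Z] using kl by (simp add: mult.commute)
    moreover have "(Z * M - M * Z) $$ (k - 1, l - 1) = (Z * M) $$ (k - 1, l - 1) - (M * Z) $$ (k - 1, l - 1)"
      using M Z kl by (intro index_minus_mat(1)) auto
    ultimately show ?thesis using kl by (simp add: vec_of_def)
  qed
  then have "dir_deriv f (vec_of M) (vec_of (Z * M - M * Z))
     = dir_deriv f (vec_of M) (\<lambda>v. \<Sum>x\<in>index_pairs n. ?c x * ad_field x (vec_of M) v)"
    by (rule dir_deriv_cong[OF f])
  also have "\<dots> = (\<Sum>x\<in>index_pairs n. ?c x * dir_deriv f (vec_of M) (ad_field x (vec_of M)))"
    by (rule dir_deriv_linear[OF f])
  also have "\<dots> = 0" using inv by (simp add: ad_invariant_def)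
  finally show ?thesis .
qed

text \<open>
  Along \<open>G s = 1 + s (K - 1)\<close> the conjugate \<open>G s * B * inverse (G s)\<close> moves in the direction
  \<open>[G' * inverse (G s), _]\<close>, so \<open>f\<close> is constant on the connected set of all \<open>s\<close> with \<open>G s\<close> invertible.
\<close>

lemma ad_invariant_conjugate:
  assumes f: "poly_fun (index_pairs n) d f" and inv: "ad_invariant n f"
    and K: "K \<in> carrier_mat n n" and L: "L \<in> carrier_mat n n" and B: "B \<in> carrier_mat n n"
    and KL: "K * L = 1\<^sub>m n" and LK: "L * K = 1\<^sub>m n"
  shows "f (vec_of (K * B * L)) = f (vec_of B)"
proof -
  define PG :: "complex poly mat" where
    "PG = mat n n (\<lambda>(i, j). [: 1\<^sub>m n $$ (i, j), K $$ (i, j) - 1\<^sub>m n $$ (i, j) :])"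
  define D where "D = det PG"
  define G where "G s = map_mat (\<lambda>p. poly p s) PG" for s
  \<comment> \<open>The inverse of \<open>G s\<close> as adjugate over determinant. Its entries are
    rational in \<open>s\<close>, hence differentiable on \<open>S\<close>.\<close>
  define R where "R s = inverse (poly D s) \<cdot>\<^sub>m map_mat (\<lambda>p. poly p s) (adj_mat PG)" for s
  define S where "S = {s. poly D s \<noteq> 0}"
  have ev: "comm_ring_hom (\<lambda>p. poly p s)" for s :: complex
    by unfold_locales auto
  have PG: "PG \<in> carrier_mat n n" by (simp add: PG_def)
  note adj = adj_mat[OF PG]
  have G: "G s \<in> carrier_mat n n" for s using PG by (simp add: G_def)
  have R: "R s \<in> carrier_mat n n" for s using adj(1) by (simp add: R_def)
  have detG: "det (G s) = poly D s" for s
    unfolding G_def D_def by (rule comm_ring_hom.hom_det[OF ev])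
  have scal: "map_mat (\<lambda>p. poly p s) (D \<cdot>\<^sub>m 1\<^sub>m n) = poly D s \<cdot>\<^sub>m 1\<^sub>m n" for s
    by (rule eq_matI) auto
  have hom_mult: "map_mat (\<lambda>p. poly p s) (A * A') = map_mat (\<lambda>p. poly p s) A * map_mat (\<lambda>p. poly p s) A'"
    if "A \<in> carrier_mat n n" "A' \<in> carrier_mat n n" for A A' :: "complex poly mat" and s
  proof -
    interpret comm_ring_hom "\<lambda>p :: complex poly. poly p s" by (rule ev)
    show ?thesis by (rule mat_hom_mult[OF that])
  qed
  have GR: "G s * R s = 1\<^sub>m n" "R s * G s = 1\<^sub>m n" if "s \<in> S" for s
  proof -
    have 1: "G s * map_mat (\<lambda>p. poly p s) (adj_mat PG) = poly D s \<cdot>\<^sub>m 1\<^sub>m n"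
      unfolding G_def hom_mult[OF PG adj(1), symmetric] adj(2) D_def[symmetric] by (rule scal)
    have 2: "map_mat (\<lambda>p. poly p s) (adj_mat PG) * G s = poly D s \<cdot>\<^sub>m 1\<^sub>m n"
      unfolding G_def hom_mult[OF adj(1) PG, symmetric] adj(3) D_def[symmetric] by (rule scal)
    have A: "map_mat (\<lambda>p. poly p s) (adj_mat PG) \<in> carrier_mat n n" using adj(1) by simp
    have s: "poly D s \<noteq> 0" using that by (simp add: S_def)
    show "G s * R s = 1\<^sub>m n"
      unfolding R_def mult_smult_distrib[OF G A] 1 using s by (auto intro!: eq_matI)
    show "R s * G s = 1\<^sub>m n"
      unfolding R_def mult_smult_assoc_mat[OF A G] 2 using s by (auto intro!: eq_matI)
  qed
  have G0: "G 0 = 1\<^sub>m n" and G1: "G 1 = K"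
    using K by (auto simp: G_def PG_def intro!: eq_matI)
  have D0: "poly D 0 \<noteq> 0" using detG[of 0] by (simp add: G0)
  have D1: "poly D 1 \<noteq> 0"
  proof
    assume "poly D 1 = 0"
    then have "det K = 0" using detG[of 1] by (simp add: G1)
    then show False using det_mult[OF K L] KL by simp
  qed
  have S01: "0 \<in> S" "1 \<in> S" using D0 D1 by (auto simp: S_def)
  have R0: "R 0 = 1\<^sub>m n"
    using GR(1)[OF S01(1)] R[of 0] by (simp add: G0)
  have R1: "R 1 = L"
  proof -
    have "R 1 = R 1 * (K * L)" using R[of 1] by (simp add: KL)
    also have "\<dots> = (R 1 * K) * L" by (rule assoc_mult_mat[symmetric, OF R K L])
    also have "\<dots> = L" using GR(2)[OF S01(2)] L by (simp add: G1)
    finally show ?thesis .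
  qed
  have "D \<noteq> 0" using D0 by auto
  then have fin: "finite {s. poly D s = 0}" by (rule poly_roots_finite)
  have S_eq: "S = - {s. poly D s = 0}" by (auto simp: S_def)
  have "open S" unfolding S_eq using fin by (intro open_Compl finite_imp_closed)
  \<comment> \<open>It matters that \<open>s\<close> is complex: finitely many roots do not
    disconnect the plane, though they would disconnect the real line.\<close>
  have "connected S"
    unfolding S_eq by (intro path_connected_imp_connected path_connected_complement_countable)
      (use fin countable_finite in auto)
  define M where "M s = G s * B * R s" for s
  have M: "M s \<in> carrier_mat n n" for s unfolding M_def using G B R by (meson mult_carrier_mat)
  define G' where "G' = K - 1\<^sub>m n"
  have G': "G' \<in> carrier_mat n n" unfolding G'_def by (rule minus_carrier_mat) simp
  have dG: "has_mat_deriv n G G' s" for s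
    unfolding has_mat_deriv_def
  proof (intro allI impI)
    fix i j assume "i < n" "j < n"
    then show "((\<lambda>s. G s $$ (i, j)) has_field_derivative G' $$ (i, j)) (at s)"
      using K by (auto simp: G_def PG_def G'_def intro!: derivative_eq_intros)
  qed
  have deriv: "((\<lambda>s. f (vec_of (M s))) has_field_derivative 0) (at s)" if s: "s \<in> S" for s
  proof -
    define R' where "R' = mat n n (\<lambda>(i, j). deriv (\<lambda>s. R s $$ (i, j)) s)"
    have R': "R' \<in> carrier_mat n n" by (simp add: R'_def)
    have dR: "has_mat_deriv n R R' s"
      unfolding has_mat_deriv_def
    proof (intro allI impI)
      fix i j assume ij: "i < n" "j < n"
      have eq: "(\<lambda>s. R s $$ (i, j)) = (\<lambda>s. inverse (poly D s) * poly (adj_mat PG $$ (i, j)) s)"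
        using ij adj(1) by (auto simp: R_def fun_eq_iff)
      have poly_differentiable: "poly q field_differentiable at s" for q
        using poly_DERIV[of q s] unfolding field_differentiable_def by blast
      have "(\<lambda>s. R s $$ (i, j)) field_differentiable (at s)"
        unfolding eq using s
        by (intro field_differentiable_mult field_differentiable_inverse poly_differentiable) (simp add: S_def)
      then show "((\<lambda>s. R s $$ (i, j)) has_field_derivative R' $$ (i, j)) (at s)"
        using ij by (simp add: R'_def DERIV_deriv_iff_field_differentiable)
    qed
    have dB: "has_mat_deriv n (\<lambda>_. B) (0\<^sub>m n n) s"
      by (simp add: has_mat_deriv_def)
    define GB' where "GB' = G' * B + G s * 0\<^sub>m n n"
    have GB': "GB' = G' * B"
      unfolding GB'_def right_mult_zero_mat[OF G] by (rule right_add_zero_mat[OF mult_carrier_mat[OF G' B]])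
    have dGB: "has_mat_deriv n (\<lambda>s. G s * B) (G' * B) s"
      using has_mat_deriv_mult[OF G G' B _ dG dB] by (simp add: GB'_def[symmetric] GB')
    define M' where "M' = G' * B * R s + G s * B * R'"
    have M': "M' \<in> carrier_mat n n"
      unfolding M'_def using G B R R' G' by (intro add_carrier_mat mult_carrier_mat)
    have GBc: "G s * B \<in> carrier_mat n n" for s using G B by (rule mult_carrier_mat)
    have G'Bc: "G' * B \<in> carrier_mat n n" using G' B by (rule mult_carrier_mat)
    have dM: "has_mat_deriv n M M' s"
      unfolding M_def[abs_def] M'_def by (rule has_mat_deriv_mult[OF GBc G'Bc R R' dGB dR])
    have MG: "M t * G t = G t * B" if "t \<in> S" for t
    proof -
      have "M t * G t = G t * B * (R t * G t)" unfolding M_def by (rule assoc_mult_mat[OF GBc R G])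
      then show ?thesis unfolding GR(2)[OF that] right_mult_one_mat[OF GBc] .
    qed
    \<comment> \<open>Differentiating \<open>M t * G t = G t * B\<close> on \<open>S\<close>
      determines \<open>M'\<close> without a formula for the derivative of the inverse.
      Multiplication by \<open>R s\<close> from the right then exhibits \<open>M'\<close> as a
      commutator with \<open>M s\<close>.\<close>
    have "M' * G s + M s * G' = G' * B"
    proof (rule has_mat_deriv_unique[OF _ dGB _ G'Bc \<open>open S\<close> s])
      show "has_mat_deriv n (\<lambda>s. M s * G s) (M' * G s + M s * G') s"
        by (rule has_mat_deriv_mult[OF M M' G G' dM dG])
      show "M' * G s + M s * G' \<in> carrier_mat n n"
        using M[of s] M' G[of s] G' by (intro add_carrier_mat mult_carrier_mat)
    qed (rule MG)
    then have eq: "M' * G s = G' * B - M s * G'"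
    proof -
      assume a: "M' * G s + M s * G' = G' * B"
      show ?thesis unfolding a[symmetric]
        using M[of s] M' G[of s] G' by (auto intro!: eq_matI)
    qed
    let ?Z = "G' * R s"
    have Z: "?Z \<in> carrier_mat n n" using G' R by (rule mult_carrier_mat)
    have RM: "B * R s = R s * M s"
    proof -
      have "R s * M s = R s * (G s * (B * R s))"
        unfolding M_def using assoc_mult_mat[OF G B R] by simp
      also have "\<dots> = (R s * G s) * (B * R s)"
        by (rule assoc_mult_mat[symmetric, OF R G]) (rule mult_carrier_mat[OF B R])
      also have "\<dots> = B * R s" using GR(2)[OF s] B R[of s] by simp
      finally show ?thesis ..
    qed
    have "M' = M' * (G s * R s)" using GR(1)[OF s] M' by simp
    also have "\<dots> = (M' * G s) * R s" by (rule assoc_mult_mat[symmetric, OF M' G R])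
    also have "\<dots> = (G' * B) * R s - (M s * G') * R s"
      unfolding eq by (rule minus_mult_distrib_mat[OF G'Bc _ R]) (rule mult_carrier_mat[OF M G'])
    also have "(G' * B) * R s = ?Z * M s"
      unfolding assoc_mult_mat[OF G' B R] RM by (rule assoc_mult_mat[symmetric, OF G' R M])
    also have "(M s * G') * R s = M s * ?Z" by (rule assoc_mult_mat[OF M G' R])
    finally have M'_eq: "M' = ?Z * M s - M s * ?Z" .
    have "((\<lambda>s. f (vec_of (M s))) has_field_derivative dir_deriv f (vec_of (M s)) (vec_of M')) (at s)"
    proof (rule dir_deriv_chain[OF f])
      fix v assume "v \<in> index_pairs n"
      then have "fst v - 1 < n" "snd v - 1 < n" by (auto simp: index_pairs_def)
      then show "((\<lambda>t. vec_of (M t) v) has_field_derivative vec_of M' v) (at s)"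
        using dM by (simp add: vec_of_def has_mat_deriv_def)
    qed
    then show ?thesis
      unfolding M'_eq ad_invariant_commutator[OF f inv Z M] .
  qed
  have "(\<lambda>s. f (vec_of (M s))) constant_on S"
    using deriv \<open>connected S\<close> \<open>open S\<close> by (rule has_field_derivative_0_imp_constant_on)
  then have "f (vec_of (M 1)) = f (vec_of (M 0))"
    using S01 unfolding constant_on_def by metis
  moreover have "M 0 = B" using B by (simp add: M_def G0 R0)
  moreover have "M 1 = K * B * L" by (simp add: M_def G1 R1)
  ultimately show ?thesis by simp
qed

section \<open>Reduction to companion matrices\<close>

definition Capelli_symbol :: "nat \<Rightarrow> nat \<Rightarrow> (nat \<times> nat \<Rightarrow> complex) \<Rightarrow> complex" where
  "Capelli_symbol n k = top_symbol k (Capelli_tensor n k)"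

definition companion :: "nat \<Rightarrow> (nat \<Rightarrow> complex) \<Rightarrow> nat \<times> nat \<Rightarrow> complex" where
  "companion n a v = (if snd v = n then a (fst v) else if fst v = Suc (snd v) then 1 else 0)"

lemma top_symbol_sum: "top_symbol m (sum f A) Y = (\<Sum>i\<in>A. top_symbol m (f i) Y)"
  by (induction A rule: infinite_finite_induct) (simp_all add: top_symbol_add top_symbol_0)

lemma top_symbol_of_int: "top_symbol m (of_int c * p) Y = of_int c * top_symbol m p Y"
proof -
  have nat: "top_symbol m (of_nat k * p) Y = of_nat k * top_symbol m p Y" for k
    by (induction k) (simp_all add: top_symbol_0 top_symbol_add distrib_right)
  have neg: "top_symbol m (- p) Y = - top_symbol m p Y" for p
    by (simp add: top_symbol_def lin_ext_uminus)
  show ?thesis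
    by (cases c rule: int_cases2) (simp_all add: nat neg)
qed

lemma top_symbol_Capelli_entry: "top_symbol 1 (Capelli_entry u i j) Y = Y (i, j)"
proof -
  have "top_symbol 1 (scal (of_nat u)) Y = 0"
    by (simp add: top_symbol_def zero_word_def)
  then show ?thesis by (simp add: Capelli_entry_def top_symbol_add top_symbol_gen scal_of_nat top_symbol_0)
qed

lemma top_symbol_Capelli_prod:
  assumes "I ` set l \<subseteq> {1..n}" "J ` set l \<subseteq> {1..n}"
  shows "top_symbol (length l) (Capelli_prod sh I J l) Y = (\<Prod>s\<leftarrow>l. Y (I s, J s))"
  using assms
proof (induction l)
  case Nil
  have "top_symbol 0 (scal 1) Y = 1" by (simp add: top_symbol_def zero_word_def)
  then show ?case by (simp add: Capelli_prod_def)
next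
  case (Cons a l)
  have "top_symbol (1 + length l) (Capelli_entry (sh a) (I a) (J a) * Capelli_prod sh I J l) Y
      = top_symbol 1 (Capelli_entry (sh a) (I a) (J a)) Y * top_symbol (length l) (Capelli_prod sh I J l) Y"
    using Cons.prems by (intro top_symbol_mult[of _ n] Capelli_entry_tensor_filt Capelli_prod_tensor_filt) auto
  then show ?case
    using Cons unfolding plus_1_eq_Suc top_symbol_Capelli_entry by (simp add: Capelli_prod_def)
qed

text \<open>The shifts have lower degree and leave no trace in the symbol. What remains is the sum
  of the principal minors of size \<open>k\<close>, up to sign a coefficient of the characteristic
  polynomial.\<close>

lemma Capelli_symbol_eq:
  "Capelli_symbol n k Y = (\<Sum>v\<in>increasing_lists n k. \<Sum>\<sigma> | \<sigma> permutes {1..k}.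
      of_int (sign \<sigma>) * (\<Prod>j\<in>{1..k}. Y (v ! (\<sigma> j - 1), v ! (j - 1))))"
  unfolding Capelli_symbol_def Capelli_tensor_def Capelli_minor_def top_symbol_sum top_symbol_of_int
proof (intro sum.cong refl)
  fix v \<sigma> assume v: "v \<in> increasing_lists n k" and "\<sigma> \<in> {\<sigma>. \<sigma> permutes {1..k}}"
  then have \<sigma>: "\<sigma> permutes {1..k}" by simp
  let ?w = "\<lambda>a. v ! (a - 1)"
  have w: "?w ` {1..k} \<subseteq> {1..n}"
    using bij_betw_imp_surj_on[OF increasing_lists_nth[OF v]] v by (simp add: increasing_lists_def)
  have set: "set [1..<Suc k] = {1..k}" by auto
  have "top_symbol (length [1..<Suc k]) (Capelli_prod ((-) k) (?w \<circ> \<sigma>) ?w [1..<Suc k]) Y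
      = (\<Prod>s\<leftarrow>[1..<Suc k]. Y ((?w \<circ> \<sigma>) s, ?w s))"
    unfolding set by (rule top_symbol_Capelli_prod[where n = n]) (simp_all only: set w image_comp_permutes[OF w \<sigma>])
  also have "\<dots> = (\<Prod>j\<in>{1..k}. Y (v ! (\<sigma> j - 1), v ! (j - 1)))"
    by (subst prod.distinct_set_conv_list[symmetric]) (simp_all only: set distinct_upt o_apply)
  finally show "of_int (sign \<sigma>) * top_symbol k (Capelli_prod ((-) k) (?w \<circ> \<sigma>) ?w [1..<Suc k]) Y
     = of_int (sign \<sigma>) * (\<Prod>j\<in>{1..k}. Y (v ! (\<sigma> j - 1), v ! (j - 1)))"
    by simp
qed

section \<open>Capelli symbols of companion matrices\<close>

definition last_cycle :: "nat \<Rightarrow> nat \<Rightarrow> nat" where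
  "last_cycle k j = (if j \<in> {1..<k} then Suc j else if j = k then 1 else j)"

text \<open>For positive \<open>k\<close> this is \<open>(- 1) ^ (k - 1)\<close>. Being its own
  inverse, it can be moved across equations.\<close>

definition cycle_sign :: "nat \<Rightarrow> complex" where
  "cycle_sign k = of_int (sign (last_cycle k))"

lemma cycle_sign_square [simp]: "cycle_sign k * cycle_sign k = 1"
  by (simp add: cycle_sign_def sign_def)

lemma cycle_sign_square_left [simp]: "cycle_sign k * (cycle_sign k * c) = c"
  by (simp add: mult.assoc[symmetric])

lemma last_cycle_permutes: "1 \<le> k \<Longrightarrow> last_cycle k permutes {1..k}"
proof (rule bij_imp_permutes)
  assume k: "1 \<le> k"
  show "bij_betw (last_cycle k) {1..k} {1..k}"
    by (rule bij_betw_byWitness[of _ "\<lambda>j. if j = 1 then k else j - 1"])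
       (use k in \<open>auto simp: last_cycle_def\<close>)
qed (auto simp: last_cycle_def)

text \<open>Only one term survives: the principal minor of the last \<open>k\<close> rows, at the \<open>k\<close>-cycle.\<close>

lemma Capelli_symbol_companion:
  assumes k: "1 \<le> k" "k \<le> n"
  shows "Capelli_symbol n k (companion n a) = cycle_sign k * a (Suc n - k)"
proof -
  define v0 where "v0 = [Suc n - k..<Suc n]"
  let ?Y = "companion n a"
  let ?g = "\<lambda>v \<sigma>. of_int (sign \<sigma>) * (\<Prod>j\<in>{1..k}. ?Y (v ! (\<sigma> j - 1), v ! (j - 1)))"
  have v0: "v0 \<in> increasing_lists n k"
    using k by (auto simp: v0_def increasing_lists_def sorted_wrt_upt)
  have v0_nth: "v0 ! (j - 1) = n - k + j" if "j \<in> {1..k}" for j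
    using that k by (auto simp: v0_def)
  have val: "?g v0 (last_cycle k) = cycle_sign k * a (Suc n - k)"
  proof -
    have "(\<Prod>j\<in>{1..k}. ?Y (v0 ! (last_cycle k j - 1), v0 ! (j - 1))) = (\<Prod>j\<in>{1..k}. if j = k then a (Suc n - k) else 1)"
    proof (rule prod.cong[OF refl])
      fix j assume j: "j \<in> {1..k}"
      then have "last_cycle k j \<in> {1..k}" using permutes_in_image[OF last_cycle_permutes[OF k(1)]] by simp
      then show "?Y (v0 ! (last_cycle k j - 1), v0 ! (j - 1)) = (if j = k then a (Suc n - k) else 1)"
        unfolding v0_nth[OF j] v0_nth[of "last_cycle k j", OF \<open>last_cycle k j \<in> _\<close>]
        using j k by (auto simp: companion_def last_cycle_def Suc_diff_le One_nat_def)
    qed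
    then show ?thesis using k by (simp add: cycle_sign_def)
  qed
  have zero: "?g v \<sigma> = 0" if v: "v \<in> increasing_lists n k" and \<sigma>: "\<sigma> permutes {1..k}" and ne: "(v, \<sigma>) \<noteq> (v0, last_cycle k)" for v \<sigma>
  proof (rule ccontr)
    assume "?g v \<sigma> \<noteq> 0"
    then have nz: "?Y (v ! (\<sigma> j - 1), v ! (j - 1)) \<noteq> 0" if "j \<in> {1..k}" for j
      using that by auto
    define w where "w j = v ! (j - 1)" for j
    have mono: "w i < w j" if "1 \<le> i" "i < j" "j \<le> k" for i j
      using v that by (auto simp: w_def increasing_lists_def sorted_wrt_iff_nth_less)
    have \<sigma>_in: "1 \<le> \<sigma> j" "\<sigma> j \<le> k" if "1 \<le> j" "j \<le> k" for j
      using permutes_in_image[OF \<sigma>, of j] that by auto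
    \<comment> \<open>Outside the last column the nonzero entries lie just below the diagonal. So
      the largest index must be \<open>n\<close>, or it would have a successor among the indices.
      Every other index has its successor among them, necessarily at the next position since
      \<open>w\<close> increases. This forces both the cycle and the list of the last
      \<open>k\<close> indices.\<close>
    have step: "w (\<sigma> j) = Suc (w j)" if "1 \<le> j" "j \<le> k" "w j \<noteq> n" for j
      using nz[of j] that by (auto simp: companion_def w_def split: if_splits)
    have mono': "w i \<le> w j" if "1 \<le> i" "i \<le> j" "j \<le> k" for i j
      using mono[of i j] that by (cases "i = j") auto
    have wk: "w k = n"
    proof (rule ccontr)
      assume "w k \<noteq> n"
      then have "w (\<sigma> k) = Suc (w k)" using k by (intro step) auto
      then show False using mono'[of "\<sigma> k" k] \<sigma>_in[of k] k by auto
    qed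
    have succ: "\<sigma> j = Suc j \<and> w (Suc j) = Suc (w j)" if j: "1 \<le> j" "j < k" for j
    proof -
      have 1: "w (\<sigma> j) = Suc (w j)" using mono[of j k] j wk by (intro step) auto
      have "j < \<sigma> j" using mono'[of "\<sigma> j" j] \<sigma>_in[of j] j 1 by (cases "j < \<sigma> j") auto
      moreover have "\<not> Suc j < \<sigma> j"
        using mono[of "Suc j" "\<sigma> j"] mono[of j "Suc j"] \<sigma>_in[of j] j 1 by auto
      ultimately have "\<sigma> j = Suc j" by simp
      then show ?thesis using 1 by simp
    qed
    obtain j where j: "j \<in> {1..k}" "\<sigma> j = 1"
      using permutes_image[OF \<sigma>] k by (metis atLeastAtMost_iff imageE le_refl)
    then have "j = k" using succ[of j] by (cases "j < k") auto
    then have "\<sigma> i = last_cycle k i" for i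
      using succ[of i] j permutes_not_in[OF \<sigma>, of i] by (cases "1 \<le> i \<and> i < k") (auto simp: last_cycle_def)
    then have "\<sigma> = last_cycle k" by auto
    moreover have "v = v0"
    proof (rule nth_equalityI)
      show len: "length v = length v0" using v v0 by (simp add: increasing_lists_def)
      have w_eq: "w (k - i) = n - i" if "i < k" for i
        using that
      proof (induction i)
        case (Suc i)
        have "w (Suc (k - Suc i)) = Suc (w (k - Suc i))" using succ[of "k - Suc i"] Suc.prems by auto
        then show ?case using Suc by (simp add: Suc_diff_Suc)
      qed (simp add: wk)
      fix i assume "i < length v"
      then have i: "i < k" using v by (simp add: increasing_lists_def)
      have "v ! i = w (k - (k - Suc i))" using i by (simp add: w_def One_nat_def)
      also have "\<dots> = n - (k - Suc i)" using i by (intro w_eq) auto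
      also have "\<dots> = v0 ! i" using v0_nth[of "Suc i"] i k by (simp add: One_nat_def)
      finally show "v ! i = v0 ! i" .
    qed
    ultimately show False using ne by simp
  qed
  let ?P = "increasing_lists n k \<times> {\<sigma>. \<sigma> permutes {1..k}}"
  have "Capelli_symbol n k ?Y = (\<Sum>(v, \<sigma>)\<in>?P. ?g v \<sigma>)"
    unfolding Capelli_symbol_eq by (rule sum.cartesian_product)
  also have "\<dots> = (\<Sum>(v, \<sigma>)\<in>{(v0, last_cycle k)}. ?g v \<sigma>)"
  proof (rule sum.mono_neutral_right)
    show "finite ?P" using finite_increasing_lists finite_permutations[of "{1..k}"] by simp
    show "{(v0, last_cycle k)} \<subseteq> ?P" using v0 last_cycle_permutes[OF k(1)] by simp
    show "\<forall>x\<in>?P - {(v0, last_cycle k)}. (case x of (v, \<sigma>) \<Rightarrow> ?g v \<sigma>) = 0"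
    proof (rule ballI)
      fix x assume "x \<in> ?P - {(v0, last_cycle k)}"
      then show "(case x of (v, \<sigma>) \<Rightarrow> ?g v \<sigma>) = 0"
        using zero[of "fst x" "snd x"] by (cases x) auto
    qed
  qed
  finally show ?thesis using val by simp
qed

text \<open>The coordinates of \<open>Y ^ j e_1\<close>, where \<open>e_1\<close> is the first
  standard basis vector.\<close>

primrec Krylov_vec :: "nat \<Rightarrow> (nat \<times> nat \<Rightarrow> complex) \<Rightarrow> nat \<Rightarrow> nat \<Rightarrow> complex" where
  "Krylov_vec n Y 0 i = (if i = 1 then 1 else 0)"
| "Krylov_vec n Y (Suc j) i = (\<Sum>c\<in>{1..n}. Y (i, c) * Krylov_vec n Y j c)"

definition Krylov_mat :: "nat \<Rightarrow> (nat \<times> nat \<Rightarrow> complex) \<Rightarrow> complex mat" where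
  "Krylov_mat n Y = mat n n (\<lambda>(i, j). Krylov_vec n Y j (Suc i))"

lemma Krylov_mat_carrier [simp]: "Krylov_mat n Y \<in> carrier_mat n n"
  by (simp add: Krylov_mat_def)

lemma poly_fun_Krylov_vec: "i \<in> {1..n} \<Longrightarrow> poly_fun (index_pairs n) j (\<lambda>Y. Krylov_vec n Y j i)"
proof (induction j arbitrary: i)
  case (Suc j)
  have "poly_fun (index_pairs n) (Suc 0 + j) (\<lambda>Y. Y (i, c) * Krylov_vec n Y j c)" if "c \<in> {1..n}" for c
    using Suc that by (intro poly_fun_mult poly_fun_var) auto
  then show ?case by (auto intro: poly_fun_sum)
qed (simp add: poly_fun_const)

lemma poly_fun_prod:
  "finite A \<Longrightarrow> (\<And>i. i \<in> A \<Longrightarrow> poly_fun V d (f i)) \<Longrightarrow> poly_fun V (card A * d) (\<lambda>Y. \<Prod>i\<in>A. f i Y)"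
  by (induction A rule: finite_induct) (auto intro: poly_fun_const poly_fun_mult)

lemma poly_fun_det_Krylov_mat: "poly_fun (index_pairs n) (n * n) (\<lambda>Y. det (Krylov_mat n Y))"
proof -
  have "poly_fun (index_pairs n) (card {0..<n} * n) (\<lambda>Y. \<Prod>i = 0..<n. Krylov_mat n Y $$ (i, p i))"
    if p: "p permutes {0..<n}" for p
  proof (rule poly_fun_prod)
    fix i assume "i \<in> {0..<n}"
    then have i: "i < n" "p i < n" using permutes_in_image[OF p, of i] by auto
    have "poly_fun (index_pairs n) n (\<lambda>Y. Krylov_vec n Y (p i) (Suc i))"
      by (rule poly_fun_mono[OF poly_fun_Krylov_vec]) (use i in \<open>auto simp: One_nat_def\<close>)
    then show "poly_fun (index_pairs n) n (\<lambda>Y. Krylov_mat n Y $$ (i, p i))" using i by (simp add: Krylov_mat_def)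
  qed simp
  then have "poly_fun (index_pairs n) (n * n) (\<lambda>Y. \<Sum>p | p permutes {0..<n}. signof p * (\<Prod>i = 0..<n. Krylov_mat n Y $$ (i, p i)))"
    by (intro poly_fun_sum poly_fun_cmult) auto
  then show ?thesis using det_def'[OF Krylov_mat_carrier[of n]] by simp
qed

lemma Krylov_vec_companion_0: "j < n \<Longrightarrow> i \<in> {1..n} \<Longrightarrow> Krylov_vec n (companion n (\<lambda>_. 0)) j i = (if i = Suc j then 1 else 0)"
proof (induction j arbitrary: i)
  case (Suc j)
  have "Krylov_vec n (companion n (\<lambda>_. 0)) (Suc j) i = (\<Sum>c\<in>{1..n}. if c = Suc j then companion n (\<lambda>_. 0) (i, c) else 0)"
    unfolding Krylov_vec.simps by (intro sum.cong refl) (use Suc in auto)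
  also have "\<dots> = companion n (\<lambda>_. 0) (i, Suc j)" using Suc.prems by (simp add: One_nat_def)
  also have "\<dots> = (if i = Suc (Suc j) then 1 else 0)" using Suc.prems by (simp add: companion_def)
  finally show ?case .
qed (simp add: One_nat_def)

text \<open>With last column zero, the companion matrix moves each basis vector to the next, so its
  Krylov matrix is the identity. It supplies the point where the determinant does not vanish in the
  density argument.\<close>

lemma det_Krylov_mat_companion_0: "det (Krylov_mat n (companion n (\<lambda>_. 0))) = 1"
proof -
  have "Krylov_mat n (companion n (\<lambda>_. 0)) = 1\<^sub>m n"
    by (rule eq_matI) (auto simp: Krylov_mat_def Krylov_vec_companion_0 One_nat_def)
  then show ?thesis by simp
qed

text \<open>Let \<open>K\<close> have the columns \<open>e_1\<close>, \<open>Y e_1\<close>, and so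
  on up to \<open>Y ^ (n - 1) e_1\<close>. Then \<open>Y K = K C\<close>, where \<open>C\<close> is
  the companion matrix whose last column lists the coordinates of \<open>Y ^ n e_1\<close> in this
  basis. The same \<open>a\<close> serves all invariant functions, so it can be used for
  \<open>f\<close> and the Capelli symbols at once.\<close>

lemma ad_invariant_Krylov:
  assumes det: "det (Krylov_mat n Y) \<noteq> 0"
  shows "\<exists>a. \<forall>d f. poly_fun (index_pairs n) d f \<longrightarrow> ad_invariant n f \<longrightarrow> f Y = f (companion n a)"
proof -
  let ?K = "Krylov_mat n Y"
  define toM :: "(nat \<times> nat \<Rightarrow> complex) \<Rightarrow> complex mat" where "toM Z = mat n n (\<lambda>(i, j). Z (Suc i, Suc j))" for Z
  have toM: "toM Z \<in> carrier_mat n n" for Z by (simp add: toM_def)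
  define L where "L = inverse (det ?K) \<cdot>\<^sub>m adj_mat ?K"
  note adj = adj_mat[OF Krylov_mat_carrier[of n Y]]
  have K: "?K \<in> carrier_mat n n" by simp
  have L: "L \<in> carrier_mat n n" using adj(1) by (simp add: L_def)
  have KL: "?K * L = 1\<^sub>m n"
    unfolding L_def mult_smult_distrib[OF K adj(1)] adj(2) using det by (auto intro!: eq_matI)
  have LK: "L * ?K = 1\<^sub>m n"
    unfolding L_def mult_smult_assoc_mat[OF adj(1) K] adj(3) using det by (auto intro!: eq_matI)
  define a where "a i = (\<Sum>c<n. L $$ (i - 1, c) * Krylov_vec n Y n (Suc c))" for i
  have entry: "(A * B) $$ (i, j) = (\<Sum>c<n. A $$ (i, c) * B $$ (c, j))"
    if "A \<in> carrier_mat n n" "B \<in> carrier_mat n n" "i < n" "j < n" for A B :: "complex mat" and i j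
    using that by (auto simp: scalar_prod_def atLeast0LessThan)
  have shift: "(\<Sum>c\<in>{1..n}. h c) = (\<Sum>c<n. h (Suc c))" for h :: "nat \<Rightarrow> complex"
    by (rule sum.reindex_bij_witness[of _ Suc "\<lambda>a. a - 1"]) (auto simp: One_nat_def)
  have intertwine: "toM Y * ?K = ?K * toM (companion n a)"
  proof (rule eq_matI)
    fix i j assume "i < dim_row (?K * toM (companion n a))" "j < dim_col (?K * toM (companion n a))"
    then have ij: "i < n" "j < n" using K toM[of "companion n a"] by auto
    have lhs: "(toM Y * ?K) $$ (i, j) = Krylov_vec n Y (Suc j) (Suc i)"
      unfolding entry[OF toM K ij] Krylov_vec.simps(2) shift using ij
      by (intro sum.cong) (auto simp: toM_def Krylov_mat_def)
    have "(?K * toM (companion n a)) $$ (i, j) = (\<Sum>c<n. Krylov_vec n Y c (Suc i) * companion n a (Suc c, Suc j))"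
      unfolding entry[OF K toM ij] using ij by (intro sum.cong) (auto simp: toM_def Krylov_mat_def)
    also have "\<dots> = Krylov_vec n Y (Suc j) (Suc i)"
    proof (cases "Suc j = n")
      case False
      then have "(\<Sum>c<n. Krylov_vec n Y c (Suc i) * companion n a (Suc c, Suc j))
         = (\<Sum>c<n. if c = Suc j then Krylov_vec n Y c (Suc i) else 0)"
        by (intro sum.cong) (auto simp: companion_def)
      then show ?thesis using False ij by simp
    next
      case True
      have "(\<Sum>c<n. Krylov_vec n Y c (Suc i) * companion n a (Suc c, Suc j))
          = (\<Sum>c<n. ?K $$ (i, c) * (\<Sum>e<n. L $$ (c, e) * Krylov_vec n Y n (Suc e)))"
        using True ij by (intro sum.cong) (auto simp: companion_def a_def Krylov_mat_def One_nat_def)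
      also have "\<dots> = (\<Sum>c<n. \<Sum>e<n. ?K $$ (i, c) * L $$ (c, e) * Krylov_vec n Y n (Suc e))"
        by (simp add: sum_distrib_left mult.assoc)
      also have "\<dots> = (\<Sum>e<n. (\<Sum>c<n. ?K $$ (i, c) * L $$ (c, e)) * Krylov_vec n Y n (Suc e))"
        unfolding sum_distrib_right by (rule sum.swap)
      also have "\<dots> = (\<Sum>e<n. (?K * L) $$ (i, e) * Krylov_vec n Y n (Suc e))"
        using ij by (intro sum.cong) (auto simp: entry[OF K L] simp del: index_mult_mat)
      also have "\<dots> = (\<Sum>e<n. if e = i then Krylov_vec n Y n (Suc e) else 0)"
        unfolding KL using ij by (intro sum.cong) auto
      also have "\<dots> = Krylov_vec n Y n (Suc i)" using ij by simp
      finally show ?thesis using True by simp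
    qed
    finally show "(toM Y * ?K) $$ (i, j) = (?K * toM (companion n a)) $$ (i, j)"
      using lhs by simp
  qed (use carrier_matD[OF K] carrier_matD[OF toM] in simp_all)
  have Y_eq: "toM Y = ?K * toM (companion n a) * L"
    unfolding intertwine[symmetric] assoc_mult_mat[OF toM K L] KL using toM[of Y] by simp
  have vec: "vec_of (toM Z) v = Z v" if "v \<in> index_pairs n" for Z v
    using that by (cases v) (auto simp: vec_of_def toM_def One_nat_def)
  have "f Y = f (companion n a)" if f: "poly_fun (index_pairs n) d f" and inv: "ad_invariant n f" for d f
  proof -
    have "f Y = f (vec_of (toM Y))" by (rule poly_fun_cong[OF f]) (simp add: vec)
    also have "\<dots> = f (vec_of (toM (companion n a)))"
      unfolding Y_eq by (rule ad_invariant_conjugate[OF f inv K L toM KL LK])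
    also have "\<dots> = f (companion n a)" by (rule poly_fun_cong[OF f]) (simp add: vec)
    finally show ?thesis .
  qed
  then show ?thesis by blast
qed

section \<open>Weighted homogeneous functions\<close>

lemma poly_fun_compose:
  assumes "poly_fun V d f" "\<And>v. v \<in> V \<Longrightarrow> poly_fun W c (\<lambda>b. \<phi> b v)"
  shows "poly_fun W (d * c) (\<lambda>b. f (\<phi> b))"
  using assms(1)
proof (induction rule: poly_fun.induct)
  case (poly_fun_var v d)
  then show ?case using poly_fun_mono[OF assms(2)] by simp
next
  case (poly_fun_mult d f e g)
  then show ?case by (simp add: distrib_right poly_fun.poly_fun_mult)
qed (auto intro: poly_fun.intros)

text \<open>The variable \<open>b k\<close> stands for \<open>H_k\<close>, whence its weight
  \<open>k\<close>. Zero belongs to every weight because components may vanish.\<close>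

inductive weighted_hom :: "nat \<Rightarrow> nat \<Rightarrow> ((nat \<Rightarrow> complex) \<Rightarrow> complex) \<Rightarrow> bool" for n where
  weighted_hom_zero: "weighted_hom n d (\<lambda>_. 0)"
| weighted_hom_const: "weighted_hom n 0 (\<lambda>_. c)"
| weighted_hom_var: "k \<in> {1..n} \<Longrightarrow> weighted_hom n k (\<lambda>b. b k)"
| weighted_hom_add: "weighted_hom n d f \<Longrightarrow> weighted_hom n d g \<Longrightarrow> weighted_hom n d (\<lambda>b. f b + g b)"
| weighted_hom_mult: "weighted_hom n d f \<Longrightarrow> weighted_hom n e g \<Longrightarrow> weighted_hom n (d + e) (\<lambda>b. f b * g b)"

lemma weighted_hom_sum: "(\<And>i. i \<in> A \<Longrightarrow> weighted_hom n d (f i)) \<Longrightarrow> weighted_hom n d (\<lambda>b. \<Sum>i\<in>A. f i b)"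
  by (induction A rule: infinite_finite_induct) (auto intro: weighted_hom_add weighted_hom_zero)

text \<open>Scaling the variable of index \<open>k\<close> by \<open>t ^ k\<close> turns weight into
  a power of \<open>t\<close>, so the coefficients of \<open>P b\<close> are the weighted components
  of \<open>Q\<close>.\<close>

lemma poly_fun_weight_components:
  assumes "poly_fun {1..n} e Q"
  shows "\<exists>P :: (nat \<Rightarrow> complex) \<Rightarrow> complex poly.
     (\<forall>b t. Q (\<lambda>k. t ^ k * b k) = poly (P b) t) \<and> (\<forall>d. weighted_hom n d (\<lambda>b. coeff (P b) d))"
  using assms
proof (induction rule: poly_fun.induct)
  case (poly_fun_const d c)
  have "weighted_hom n e (\<lambda>_. coeff [:c:] e)" for e
    by (cases e) (auto intro: weighted_hom_const weighted_hom_zero)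
  then show ?case by (intro exI[of _ "\<lambda>_. [:c:]"]) simp
next
  case (poly_fun_var k d)
  have "weighted_hom n e (\<lambda>b. if k = e then b k else 0)" for e
    using poly_fun_var by (cases "k = e") (auto intro: weighted_hom_var weighted_hom_zero)
  then show ?case
    by (intro exI[of _ "\<lambda>b. monom (b k) k"]) (simp add: poly_monom mult.commute)
next
  case (poly_fun_add d f g)
  then obtain P R where "\<forall>b t. f (\<lambda>k. t ^ k * b k) = poly (P b) t" "\<forall>d. weighted_hom n d (\<lambda>b. coeff (P b) d)"
     "\<forall>b t. g (\<lambda>k. t ^ k * b k) = poly (R b) t" "\<forall>d. weighted_hom n d (\<lambda>b. coeff (R b) d)"
    by blast
  then show ?case by (intro exI[of _ "\<lambda>b. P b + R b"]) (simp add: weighted_hom_add)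
next
  case (poly_fun_mult d f e g)
  then obtain P R where *: "\<forall>b t. f (\<lambda>k. t ^ k * b k) = poly (P b) t" "\<forall>d. weighted_hom n d (\<lambda>b. coeff (P b) d)"
     "\<forall>b t. g (\<lambda>k. t ^ k * b k) = poly (R b) t" "\<forall>d. weighted_hom n d (\<lambda>b. coeff (R b) d)"
    by blast
  have "weighted_hom n d (\<lambda>b. \<Sum>i\<le>d. coeff (P b) i * coeff (R b) (d - i))" for d
  proof (rule weighted_hom_sum)
    fix i assume "i \<in> {..d}"
    then show "weighted_hom n d (\<lambda>b. coeff (P b) i * coeff (R b) (d - i))"
      using weighted_hom_mult[of n i "\<lambda>b. coeff (P b) i" "d - i" "\<lambda>b. coeff (R b) (d - i)"] * by simp
  qed
  with * show ?case by (intro exI[of _ "\<lambda>b. P b * R b"]) (simp add: coeff_mult)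
qed

text \<open>\<open>Q\<close> is read off from \<open>f\<close> on companion matrices. The equation
  with \<open>f\<close> holds wherever the Krylov matrix is invertible and spreads by density.
  Homogeneity of \<open>f\<close> and of the symbols then identifies \<open>Q\<close> with its
  component of weight \<open>m\<close>.\<close>

lemma ad_invariant_homogeneous:
  assumes f: "poly_fun (index_pairs n) d f" and inv: "ad_invariant n f"
    and hom: "\<And>t Y. f (\<lambda>v. t * Y v) = t ^ m * f Y"
    and Capelli_symbol: "\<And>k. k \<in> {1..n} \<Longrightarrow> ad_invariant n (Capelli_symbol n k)"
  shows "\<exists>Q. weighted_hom n m Q \<and> (\<forall>Y. f Y = Q (\<lambda>k. Capelli_symbol n k Y))"
proof -
  \<comment> \<open>Sign and index reversal undo \<open>Capelli_symbol_companion\<close>: the symbol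
    of index \<open>k\<close> takes the value \<open>b k\<close> at
    \<open>companion n (A b)\<close>.\<close>
  define A where "A b i = cycle_sign (Suc n - i) * b (Suc n - i)" for b i
  define Q where "Q b = f (companion n (A b))" for b
  have flip: "Suc n - i \<in> {1..n}" if "i \<in> {1..n}" for i using that by auto
  have pQ: "poly_fun {1..n} (d * 1) Q"
    unfolding Q_def
  proof (rule poly_fun_compose[OF f])
    fix v assume v: "v \<in> index_pairs n"
    obtain i j where ij: "v = (i, j)" "i \<in> {1..n}" using v by (cases v) auto
    have "poly_fun {1..n} 1 (\<lambda>b. cycle_sign (Suc n - i) * b (Suc n - i))"
      using flip[OF ij(2)] by (intro poly_fun_cmult) (simp add: One_nat_def poly_fun_var)
    then show "poly_fun {1..n} 1 (\<lambda>b. companion n (A b) v)"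
      by (cases "j = n") (simp_all add: companion_def A_def ij poly_fun_const)
  qed
  have pck: "poly_fun (index_pairs n) n (Capelli_symbol n k)" if "k \<in> {1..n}" for k
    unfolding Capelli_symbol_def by (rule poly_fun_mono[OF poly_fun_top_symbol[OF Capelli_tensor_tensor_filt]]) (use that in auto)
  have ckA: "Capelli_symbol n k (companion n (A b)) = b k" if k: "k \<in> {1..n}" for k b
    using Capelli_symbol_companion[of k n "A b"] k by (simp add: A_def Suc_diff_Suc)
  have Q_cong: "Q b = Q b'" if "\<And>k. k \<in> {1..n} \<Longrightarrow> b k = b' k" for b b'
    by (rule poly_fun_cong[OF pQ]) (use that in auto)
  have eq: "f Y = Q (\<lambda>k. Capelli_symbol n k Y)" for Y
  proof -
    have 0: "poly_fun (index_pairs n) (d * 1 * n) (\<lambda>Y. Q (\<lambda>k. Capelli_symbol n k Y))"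
      by (rule poly_fun_compose[OF pQ]) (use pck in auto)
    have 1: "poly_fun (index_pairs n) (d + d * 1 * n) (\<lambda>Y. f Y - Q (\<lambda>k. Capelli_symbol n k Y))"
      by (rule poly_fun_diff[OF poly_fun_mono[OF f] poly_fun_mono[OF 0]]) auto
    have 2: "det (Krylov_mat n (companion n (\<lambda>_. 0))) \<noteq> 0" by (simp add: det_Krylov_mat_companion_0)
    have 3: "f Y - Q (\<lambda>k. Capelli_symbol n k Y) = 0" if det: "det (Krylov_mat n Y) \<noteq> 0" for Y
    proof -
      obtain a where a: "\<And>d f. poly_fun (index_pairs n) d f \<Longrightarrow> ad_invariant n f \<Longrightarrow> f Y = f (companion n a)"
        using ad_invariant_Krylov[OF det] by blast
      have "Q (\<lambda>k. Capelli_symbol n k Y) = Q (\<lambda>k. cycle_sign k * a (Suc n - k))"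
        using a[OF pck Capelli_symbol] Capelli_symbol_companion by (intro Q_cong) auto
      also have "\<dots> = f (companion n a)"
        unfolding Q_def by (rule poly_fun_cong[OF f]) (auto simp: companion_def A_def index_pairs_def)
      finally show ?thesis using a[OF f inv] by simp
    qed
    have "f Y - Q (\<lambda>k. Capelli_symbol n k Y) = 0"
      by (rule poly_fun_density[OF 1 poly_fun_det_Krylov_mat 2 3])
    then show ?thesis by simp
  qed
  have scale: "Q (\<lambda>k. t ^ k * b k) = t ^ m * Q b" for t b
  proof -
    let ?Y = "companion n (A b)"
    have "t ^ m * Q b = f (\<lambda>v. t * ?Y v)" unfolding Q_def hom ..
    also have "\<dots> = Q (\<lambda>k. Capelli_symbol n k (\<lambda>v. t * ?Y v))" by (rule eq)
    also have "\<dots> = Q (\<lambda>k. t ^ k * b k)"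
      by (rule Q_cong) (simp add: Capelli_symbol_def top_symbol_scale, simp add: ckA flip: Capelli_symbol_def)
    finally show ?thesis ..
  qed
  obtain P where P: "\<And>b t. Q (\<lambda>k. t ^ k * b k) = poly (P b) t" "\<And>d. weighted_hom n d (\<lambda>b. coeff (P b) d)"
    using poly_fun_weight_components[OF pQ] by blast
  have "coeff (P b) m = Q b" for b
  proof -
    have "poly (P b - monom (Q b) m) t = 0" for t
      using P(1)[of t b] scale[of t b] by (simp add: poly_monom mult.commute)
    then have "P b - monom (Q b) m = 0" using poly_all_0_iff_0 by blast
    then have "P b = monom (Q b) m" by simp
    then show ?thesis by simp
  qed
  then have "weighted_hom n m Q" using P(2)[of m] by simp
  then show ?thesis using eq by blast
qed

section \<open>The filtered center\<close>

lemma U_class_closed: "p \<in> carrier (tensor_alg n) \<Longrightarrow> U_class n p \<in> carrier (U n)"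
  by (simp add: carrier_U)

lemma carrier_sum:
  "(\<And>i. i \<in> A \<Longrightarrow> f i \<in> carrier (tensor_alg n)) \<Longrightarrow> sum f A \<in> carrier (tensor_alg n)"
  by (induction A rule: infinite_finite_induct) (auto intro: carrier_closed tensor_filt_carrier[OF tensor_filt_0[of n 0]])

lemma U_class_sum:
  assumes "finite A" "\<And>i. i \<in> A \<Longrightarrow> f i \<in> carrier (tensor_alg n)"
  shows "U_class n (sum f A) = (\<Oplus>\<^bsub>U n\<^esub>i\<in>A. U_class n (f i))"
  using assms
proof (induction A rule: finite_induct)
  case empty
  interpret U: ring "U n" by (rule ring_U)
  show ?case by (simp add: U_class_0)
next
  case (insert a A)
  interpret U: ring "U n" by (rule ring_U)
  have "sum f A \<in> carrier (tensor_alg n)"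
    using insert by (intro carrier_sum) auto
  then show ?case
    using insert by (subst U.finsum_insert) (auto simp: U_class_simps U_class_closed)
qed

lemma U_class_uminus:
  assumes p: "p \<in> carrier (tensor_alg n)"
  shows "U_class n (- p) = \<ominus>\<^bsub>U n\<^esub> U_class n p"
proof -
  interpret U: ring "U n" by (rule ring_U)
  have "U_class n (- p) \<oplus>\<^bsub>U n\<^esub> U_class n p = \<zero>\<^bsub>U n\<^esub>"
    using U_class_simps(1)[OF carrier_closed(4)[OF p] p] by (simp add: U_class_0)
  then show ?thesis
    using p carrier_closed(4)[OF p] U_class_closed by (intro U.minus_equality[symmetric]) auto
qed

lemma U_class_sign:
  assumes p: "p \<in> carrier (tensor_alg n)"
  shows "U_class n (of_int (sign \<sigma>) * p) = [(sign \<sigma> :: int)] \<cdot>\<^bsub>U n\<^esub> U_class n p"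
proof -
  interpret U: ring "U n" by (rule ring_U)
  have x: "U_class n p \<in> carrier (U n)" by (rule U_class_closed[OF p])
  have 1: "[(1 :: int)] \<cdot>\<^bsub>U n\<^esub> U_class n p = U_class n p"
    using U.add.int_pow_1[of "U_class n p"] x by simp
  have "[(- 1 :: int)] \<cdot>\<^bsub>U n\<^esub> U_class n p = \<ominus>\<^bsub>U n\<^esub> U_class n p"
    using U.add.int_pow_neg[of "U_class n p" 1] x 1 by simp
  with 1 show ?thesis
    using p by (cases "evenperm \<sigma>") (simp_all add: sign_def U_class_uminus)
qed

lemma U_class_of_nat: "U_class n (of_nat u) = [u] \<cdot>\<^bsub>U n\<^esub> \<one>\<^bsub>U n\<^esub>"
proof (induction u)
  case (Suc u)
  interpret U: ring "U n" by (rule ring_U)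
  have c: "of_nat u \<in> carrier (tensor_alg n)" "1 \<in> carrier (tensor_alg n)"
    using tensor_filt_scal[of "of_nat u" n 0] tensor_filt_scal[of 1 n 0] by (auto simp: scal_of_nat dest: tensor_filt_carrier)
  have "U_class n (of_nat u + 1) = U_class n (of_nat u) \<oplus>\<^bsub>U n\<^esub> \<one>\<^bsub>U n\<^esub>"
    using U_class_simps(1)[OF c] by (simp add: U_class_1)
  then show ?case using Suc U.add.nat_pow_Suc by (simp add: add.commute)
qed (use U_class_0 in \<open>simp add: add_pow_def\<close>)

lemma U_class_prod_list:
  assumes "\<And>s. s \<in> set l \<Longrightarrow> g s \<in> carrier (tensor_alg n)"
  shows "prod_list (map g l) \<in> carrier (tensor_alg n) \<and>
     U_class n (prod_list (map g l)) = foldr (\<otimes>\<^bsub>U n\<^esub>) (map (\<lambda>s. U_class n (g s)) l) \<one>\<^bsub>U n\<^esub>"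
  using assms
proof (induction l)
  case Nil
  then show ?case using tensor_filt_carrier[OF tensor_filt_scal[of 1 n 0]] by (simp add: U_class_1)
next
  case (Cons a l)
  then show ?case by (simp add: U_class_simps carrier_closed)
qed

text \<open>\<open>Capelli_H\<close> adds the shift of row \<open>a\<close> where positions agree,
  \<open>Capelli_entry\<close> the shift of column \<open>b\<close> where index values agree. Along
  an increasing list the values are distinct, so both mean \<open>a = b\<close> and the same
  shift.\<close>

lemma Capelli_H_eq: "Capelli_H n k = U_class n (Capelli_tensor n k)"
proof -
  interpret U: ring "U n" by (rule ring_U)
  let ?w = "\<lambda>v a. v ! (a - 1) :: nat"
  let ?A = "\<lambda>v a b. E n (?w v a) (?w v b)
          \<oplus>\<^bsub>U n\<^esub> (if a = b then [(k - a)] \<cdot>\<^bsub>U n\<^esub> \<one>\<^bsub>U n\<^esub> else \<zero>\<^bsub>U n\<^esub>)"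
  have w: "?w v a \<in> {1..n}" if "v \<in> increasing_lists n k" "a \<in> {1..k}" for v a
  proof -
    have "?w v a \<in> set v" using bij_betwE[OF increasing_lists_nth[OF that(1)]] that(2) by blast
    then show ?thesis using that(1) unfolding increasing_lists_def by blast
  qed
  have "cdet (U n) k (?A v) = U_class n (Capelli_minor k (?w v) (?w v))" if v: "v \<in> increasing_lists n k" for v
  proof -
    have entry: "?A v a b = U_class n (Capelli_entry (k - b) (?w v a) (?w v b))"
      if ab: "a \<in> {1..k}" "b \<in> {1..k}" for a b
    proof -
      have "?w v a = ?w v b \<longleftrightarrow> a = b"
        using inj_on_eq_iff[OF bij_betw_imp_inj_on[OF increasing_lists_nth[OF v]] ab] .
      moreover have "gen (?w v a) (?w v b) \<in> carrier (tensor_alg n)"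
        using w[OF v ab(1)] w[OF v ab(2)] by (intro tensor_filt_carrier[OF tensor_filt_gen]) auto
      moreover have "of_nat (k - b) \<in> carrier (tensor_alg n)" "0 \<in> carrier (tensor_alg n)"
        using tensor_filt_carrier[OF tensor_filt_scal[of "of_nat (k - b)" n 0]] tensor_filt_carrier[OF tensor_filt_0[of n 0]]
        by (simp_all add: scal_of_nat)
      ultimately show ?thesis
        unfolding Capelli_entry_def by (simp add: E_def U_class_simps U_class_of_nat U_class_0)
    qed
    have set: "set [1..<Suc k] = {1..k}" by auto
    have summand: "Capelli_prod ((-) k) (?w v \<circ> \<sigma>) (?w v) [1..<Suc k] \<in> carrier (tensor_alg n) \<and>
        U_class n (of_int (sign \<sigma>) * Capelli_prod ((-) k) (?w v \<circ> \<sigma>) (?w v) [1..<Suc k])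
        = [(sign \<sigma> :: int)] \<cdot>\<^bsub>U n\<^esub> foldr (\<otimes>\<^bsub>U n\<^esub>) (map (\<lambda>j. ?A v (\<sigma> j) j) [1..<Suc k]) \<one>\<^bsub>U n\<^esub>"
      if \<sigma>: "\<sigma> permutes {1..k}" for \<sigma>
    proof -
      have in_k: "\<sigma> s \<in> {1..k}" "s \<in> {1..k}" if "s \<in> set [1..<Suc k]" for s
        using that permutes_in_image[OF \<sigma>, of s] unfolding set by auto
      have X: "Capelli_entry (k - s) ((?w v \<circ> \<sigma>) s) (?w v s) \<in> carrier (tensor_alg n)"
        if "s \<in> set [1..<Suc k]" for s
        using w[OF v in_k(1)[OF that]] w[OF v in_k(2)[OF that]]
        by (intro tensor_filt_carrier[OF Capelli_entry_tensor_filt]) auto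
      let ?P = "Capelli_prod ((-) k) (?w v \<circ> \<sigma>) (?w v) [1..<Suc k]"
      have P: "?P \<in> carrier (tensor_alg n) \<and> U_class n ?P
          = foldr (\<otimes>\<^bsub>U n\<^esub>) (map (\<lambda>s. U_class n (Capelli_entry (k - s) ((?w v \<circ> \<sigma>) s) (?w v s))) [1..<Suc k]) \<one>\<^bsub>U n\<^esub>"
        unfolding Capelli_prod_def by (rule U_class_prod_list) (rule X)
      have map: "map (\<lambda>s. U_class n (Capelli_entry (k - s) ((?w v \<circ> \<sigma>) s) (?w v s))) [1..<Suc k]
          = map (\<lambda>j. ?A v (\<sigma> j) j) [1..<Suc k]"
        using entry[OF in_k] by (intro map_cong refl) (simp only: o_apply)
      show ?thesis
        using P U_class_sign[OF conjunct1[OF P], of \<sigma>] unfolding map by (simp only:)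
    qed
    have "U_class n (Capelli_minor k (?w v) (?w v)) = (\<Oplus>\<^bsub>U n\<^esub>\<sigma> \<in> {\<sigma>. \<sigma> permutes {1..k}}.
        U_class n (of_int (sign \<sigma>) * Capelli_prod ((-) k) (?w v \<circ> \<sigma>) (?w v) [1..<Suc k]))"
      unfolding Capelli_minor_def
    proof (rule U_class_sum)
      show "finite {\<sigma>. \<sigma> permutes {1..k}}" by (rule finite_permutations) simp
      fix \<sigma> assume "\<sigma> \<in> {\<sigma>. \<sigma> permutes {1..k}}"
      then obtain m where "Capelli_prod ((-) k) (?w v \<circ> \<sigma>) (?w v) [1..<Suc k] \<in> tensor_filt n m"
        using summand[of \<sigma>] by (auto simp: carrier_tensor_alg_UN)
      then show "of_int (sign \<sigma>) * Capelli_prod ((-) k) (?w v \<circ> \<sigma>) (?w v) [1..<Suc k] \<in> carrier (tensor_alg n)"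
        by (intro tensor_filt_carrier[OF tensor_filt_of_int])
    qed
    also have "\<dots> = cdet (U n) k (?A v)"
      unfolding cdet_def
    proof (rule U.finsum_cong')
      show "(\<lambda>\<sigma>. [(sign \<sigma> :: int)] \<cdot>\<^bsub>U n\<^esub> foldr (\<otimes>\<^bsub>U n\<^esub>) (map (\<lambda>j. ?A v (\<sigma> j) j) [1..<Suc k]) \<one>\<^bsub>U n\<^esub>)
         \<in> {\<sigma>. \<sigma> permutes {1..k}} \<rightarrow> carrier (U n)"
      proof
        fix \<sigma> assume "\<sigma> \<in> {\<sigma>. \<sigma> permutes {1..k}}"
        then have t: "Capelli_prod ((-) k) (?w v \<circ> \<sigma>) (?w v) [1..<Suc k] \<in> carrier (tensor_alg n)"
          "U_class n (of_int (sign \<sigma>) * Capelli_prod ((-) k) (?w v \<circ> \<sigma>) (?w v) [1..<Suc k])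
           = [(sign \<sigma> :: int)] \<cdot>\<^bsub>U n\<^esub> foldr (\<otimes>\<^bsub>U n\<^esub>) (map (\<lambda>j. ?A v (\<sigma> j) j) [1..<Suc k]) \<one>\<^bsub>U n\<^esub>"
          using summand[of \<sigma>] by simp_all
        obtain m where "Capelli_prod ((-) k) (?w v \<circ> \<sigma>) (?w v) [1..<Suc k] \<in> tensor_filt n m"
          using t(1) by (auto simp: carrier_tensor_alg_UN)
        then show "[(sign \<sigma> :: int)] \<cdot>\<^bsub>U n\<^esub> foldr (\<otimes>\<^bsub>U n\<^esub>) (map (\<lambda>j. ?A v (\<sigma> j) j) [1..<Suc k]) \<one>\<^bsub>U n\<^esub> \<in> carrier (U n)"
          unfolding t(2)[symmetric] by (intro U_class_closed tensor_filt_carrier[OF tensor_filt_of_int])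
      qed
    qed (use summand in auto)
    finally show ?thesis ..
  qed
  note det = this
  have "Capelli_H n k = (\<Oplus>\<^bsub>U n\<^esub>v \<in> increasing_lists n k. cdet (U n) k (?A v))"
    by (simp only: Capelli_H_def increasing_lists_def)
  also have "\<dots> = (\<Oplus>\<^bsub>U n\<^esub>v \<in> increasing_lists n k. U_class n (Capelli_minor k (?w v) (?w v)))"
  proof (rule U.finsum_cong')
    show "(\<lambda>v. U_class n (Capelli_minor k (?w v) (?w v))) \<in> increasing_lists n k \<rightarrow> carrier (U n)"
      using w by (intro Pi_I U_class_closed tensor_filt_carrier[OF Capelli_minor_tensor_filt]) (auto simp only: image_subset_iff)
  qed (simp_all only: det)
  also have "\<dots> = U_class n (Capelli_tensor n k)"
    unfolding Capelli_tensor_def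
    using w by (intro U_class_sum[symmetric] finite_increasing_lists tensor_filt_carrier[OF Capelli_minor_tensor_filt]) (auto simp only: image_subset_iff)
  finally show ?thesis .
qed

text \<open>Polynomials in the Capelli elements of weight at most \<open>m\<close>. Scalar multiples
  arise as products with scalars, which have weight 0.\<close>

inductive Capelli_span :: "nat \<Rightarrow> nat \<Rightarrow> gl_tensor set \<Rightarrow> bool" for n where
  Capelli_span_scal: "Capelli_span n m (U_smult n c \<one>\<^bsub>U n\<^esub>)"
| Capelli_span_H: "k \<in> {1..n} \<Longrightarrow> k \<le> m \<Longrightarrow> Capelli_span n m (Capelli_H n k)"
| Capelli_span_add: "Capelli_span n m x \<Longrightarrow> Capelli_span n m y \<Longrightarrow> Capelli_span n m (x \<oplus>\<^bsub>U n\<^esub> y)"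
| Capelli_span_mult: "Capelli_span n a x \<Longrightarrow> Capelli_span n b y \<Longrightarrow> a + b \<le> m \<Longrightarrow> Capelli_span n m (x \<otimes>\<^bsub>U n\<^esub> y)"

lemma U_smult_1: "U_smult n c \<one>\<^bsub>U n\<^esub> = U_class n (scal c)"
  using U_class_simps(2)[OF tensor_filt_carrier[OF tensor_filt_scal[of c n 0]] tensor_filt_carrier[OF tensor_filt_scal[of 1 n 0]]]
  by (simp add: U_smult_def U_class_1)

lemma center_closed:
  assumes "x \<in> carrier (zeta n)" "y \<in> carrier (zeta n)"
  shows "x \<oplus>\<^bsub>U n\<^esub> y \<in> carrier (zeta n)" "x \<otimes>\<^bsub>U n\<^esub> y \<in> carrier (zeta n)"
proof -
  interpret U: ring "U n" by (rule ring_U)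
  have c: "x \<in> carrier (U n)" "y \<in> carrier (U n)" "\<And>z. z \<in> carrier (U n) \<Longrightarrow> x \<otimes>\<^bsub>U n\<^esub> z = z \<otimes>\<^bsub>U n\<^esub> x"
    "\<And>z. z \<in> carrier (U n) \<Longrightarrow> y \<otimes>\<^bsub>U n\<^esub> z = z \<otimes>\<^bsub>U n\<^esub> y"
    using assms by (auto simp: zeta_def center_def)
  show "x \<oplus>\<^bsub>U n\<^esub> y \<in> carrier (zeta n)"
    using c by (simp add: zeta_def center_def U.l_distr U.r_distr)
  have "x \<otimes>\<^bsub>U n\<^esub> y \<otimes>\<^bsub>U n\<^esub> z = z \<otimes>\<^bsub>U n\<^esub> (x \<otimes>\<^bsub>U n\<^esub> y)" if z: "z \<in> carrier (U n)" for z
  proof -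
    have "x \<otimes>\<^bsub>U n\<^esub> y \<otimes>\<^bsub>U n\<^esub> z = x \<otimes>\<^bsub>U n\<^esub> (z \<otimes>\<^bsub>U n\<^esub> y)"
      using c(1,2,4) z by (simp add: U.m_assoc)
    also have "\<dots> = z \<otimes>\<^bsub>U n\<^esub> x \<otimes>\<^bsub>U n\<^esub> y"
      using c(1,2) c(3)[OF z] z by (simp add: U.m_assoc[symmetric])
    finally show ?thesis using c(1,2) z by (simp add: U.m_assoc)
  qed
  then show "x \<otimes>\<^bsub>U n\<^esub> y \<in> carrier (zeta n)"
    using c(1,2) by (simp add: zeta_def center_def)
qed

lemma scal_central: "U_class n (scal c) \<in> carrier (zeta n)"
  unfolding center_iff_commutator[OF tensor_filt_carrier[OF tensor_filt_scal[of c n 0]]]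
  by (simp add: scal_commute[of c "gen _ _", symmetric])

lemma Capelli_span_zeta_filt: "Capelli_span n m x \<Longrightarrow> x \<in> zeta_filt n m"
proof (induction rule: Capelli_span.induct)
  case (Capelli_span_scal m c)
  show ?case unfolding U_smult_1 zeta_filt_def U_filt_eq using scal_central by simp
next
  case (Capelli_span_H k m)
  then have "Capelli_tensor n k \<in> tensor_filt n m" using tensor_filt_mono[OF Capelli_tensor_tensor_filt] by blast
  then show ?case unfolding Capelli_H_eq zeta_filt_def U_filt_eq using Capelli_tensor_central by blast
next
  case (Capelli_span_add m x y)
  then obtain p q where pq: "p \<in> tensor_filt n m" "q \<in> tensor_filt n m" "x = U_class n p" "y = U_class n q"
    by (auto simp: zeta_filt_def U_filt_eq)
  then have "x \<oplus>\<^bsub>U n\<^esub> y = U_class n (p + q)" using U_class_simps tensor_filt_carrier by metis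
  moreover have "p + q \<in> tensor_filt n m" by (intro tensor_filt_add pq)
  moreover have "x \<oplus>\<^bsub>U n\<^esub> y \<in> carrier (zeta n)"
    using Capelli_span_add.IH by (intro center_closed) (auto simp: zeta_filt_def)
  ultimately show ?case unfolding zeta_filt_def U_filt_eq by blast
next
  case (Capelli_span_mult a x b y m)
  then obtain p q where pq: "p \<in> tensor_filt n a" "q \<in> tensor_filt n b" "x = U_class n p" "y = U_class n q"
    by (auto simp: zeta_filt_def U_filt_eq)
  then have "x \<otimes>\<^bsub>U n\<^esub> y = U_class n (p * q)" using U_class_simps tensor_filt_carrier by metis
  moreover have "p * q \<in> tensor_filt n m" using tensor_filt_mult[OF pq(1,2)] Capelli_span_mult.hyps tensor_filt_mono by blast
  moreover have "x \<otimes>\<^bsub>U n\<^esub> y \<in> carrier (zeta n)"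
    using Capelli_span_mult.IH by (intro center_closed) (auto simp: zeta_filt_def)
  ultimately show ?case unfolding zeta_filt_def U_filt_eq by blast
qed

text \<open>Replaces the variables by the Capelli tensors. Top symbols add in equal degree and
  multiply with degrees adding, which is exactly how weights behave in
  \<open>weighted_hom\<close>.\<close>

lemma weighted_hom_Capelli_span:
  "weighted_hom n d Q \<Longrightarrow> \<exists>h \<in> tensor_filt n d. Capelli_span n d (U_class n h) \<and> (\<forall>Y. top_symbol d h Y = Q (\<lambda>k. Capelli_symbol n k Y))"
proof (induction rule: weighted_hom.induct)
  case (weighted_hom_zero d)
  have "Capelli_span n d (U_class n 0)" using Capelli_span_scal[of n d 0] by (simp add: U_smult_1)
  then show ?case by (intro bexI[of _ 0]) (simp_all add: top_symbol_0)
next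
  case (weighted_hom_const c)
  have "Capelli_span n 0 (U_class n (scal c))" using Capelli_span_scal[of n 0 c] by (simp add: U_smult_1)
  moreover have "top_symbol 0 (scal c) Y = c" for Y by (simp add: top_symbol_def zero_word_def)
  ultimately show ?case by (intro bexI[of _ "scal c"]) simp_all
next
  case (weighted_hom_var k)
  have "Capelli_span n k (U_class n (Capelli_tensor n k))" using Capelli_span_H[OF weighted_hom_var] by (simp add: Capelli_H_eq)
  then show ?case by (intro bexI[of _ "Capelli_tensor n k"]) (simp_all add: Capelli_symbol_def Capelli_tensor_tensor_filt)
next
  case (weighted_hom_add d f g)
  then obtain h h' where h: "h \<in> tensor_filt n d" "Capelli_span n d (U_class n h)" "\<And>Y. top_symbol d h Y = f (\<lambda>k. Capelli_symbol n k Y)"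
    and h': "h' \<in> tensor_filt n d" "Capelli_span n d (U_class n h')" "\<And>Y. top_symbol d h' Y = g (\<lambda>k. Capelli_symbol n k Y)" by blast
  have "Capelli_span n d (U_class n (h + h'))"
    using Capelli_span_add[OF h(2) h'(2)] U_class_simps(1)[OF tensor_filt_carrier[OF h(1)] tensor_filt_carrier[OF h'(1)]] by simp
  then show ?case using h h' by (intro bexI[of _ "h + h'"]) (simp_all add: top_symbol_add tensor_filt_add)
next
  case (weighted_hom_mult d f e g)
  then obtain h h' where h: "h \<in> tensor_filt n d" "Capelli_span n d (U_class n h)" "\<And>Y. top_symbol d h Y = f (\<lambda>k. Capelli_symbol n k Y)"
    and h': "h' \<in> tensor_filt n e" "Capelli_span n e (U_class n h')" "\<And>Y. top_symbol e h' Y = g (\<lambda>k. Capelli_symbol n k Y)" by blast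
  have "Capelli_span n (d + e) (U_class n (h * h'))"
    using Capelli_span_mult[OF h(2) h'(2) order_refl] U_class_simps(2)[OF tensor_filt_carrier[OF h(1)] tensor_filt_carrier[OF h'(1)]] by simp
  then show ?case
    using h h' by (intro bexI[of _ "h * h'"]) (simp_all add: top_symbol_mult[OF h(1) h'(1)] tensor_filt_mult)
qed

lemma Capelli_span_mono: "Capelli_span n a x \<Longrightarrow> a \<le> b \<Longrightarrow> Capelli_span n b x"
proof (induction arbitrary: b rule: Capelli_span.induct)
  case (Capelli_span_mult a x c y m)
  then show ?case by (meson Capelli_span.Capelli_span_mult order.refl order.trans)
qed (auto intro: Capelli_span.intros)

lemma top_symbol_0_eq_0:
  assumes "p \<in> tensor_filt n 0" "top_symbol 0 p Y = 0"
  shows "p = 0"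
proof -
  have "p = scal (top_symbol 0 p Y)"
    using assms(1)
  proof (induction rule: tensor_filt_induct)
    case (add p q)
    then show ?case by (metis top_symbol_add single_add)
  qed (simp_all add: top_symbol_def zero_word_def)
  then show ?thesis using assms(2) by simp
qed

lemma zeta_filt_Capelli_span: "z \<in> zeta_filt n m \<Longrightarrow> Capelli_span n m z"
proof (induction m arbitrary: z rule: less_induct)
  case (less m z)
  then obtain p where p: "p \<in> tensor_filt n m" and z: "z = U_class n p" and central: "U_class n p \<in> carrier (zeta n)"
    by (auto simp: zeta_filt_def U_filt_eq)
  have "ad_invariant n (Capelli_symbol n k)" for k
    unfolding Capelli_symbol_def by (rule central_ad_invariant[OF Capelli_tensor_tensor_filt Capelli_tensor_central])
  then obtain Q where Q: "weighted_hom n m Q" "\<And>Y. top_symbol m p Y = Q (\<lambda>k. Capelli_symbol n k Y)"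
    using ad_invariant_homogeneous[OF poly_fun_top_symbol[OF p] central_ad_invariant[OF p central] top_symbol_scale] by blast
  obtain h where h: "h \<in> tensor_filt n m" "Capelli_span n m (U_class n h)" "\<And>Y. top_symbol m h Y = Q (\<lambda>k. Capelli_symbol n k Y)"
    using weighted_hom_Capelli_span[OF Q(1)] by blast
  have hc: "U_class n h \<in> carrier (zeta n)"
    using Capelli_span_zeta_filt[OF h(2)] by (simp add: zeta_filt_def)
  have r: "p - h \<in> tensor_filt n m" by (rule tensor_filt_diff[OF p h(1)])
  have top_symbol_r: "top_symbol m (p - h) Y = 0" for Y by (simp add: top_symbol_diff Q(2) h(3))
  have rc: "U_class n (p - h) \<in> carrier (zeta n)"
    unfolding center_iff_commutator[OF tensor_filt_carrier[OF r]]
  proof (intro allI impI)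
    fix a b assume "(a, b) \<in> index_pairs n"
    then have "gen a b * p - p * gen a b \<in> gl_ideal n" "gen a b * h - h * gen a b \<in> gl_ideal n"
      using central hc
      unfolding center_iff_commutator[OF tensor_filt_carrier[OF p]] center_iff_commutator[OF tensor_filt_carrier[OF h(1)]]
      by blast+
    from gl_ideal_diff[OF this] show "gen a b * (p - h) - (p - h) * gen a b \<in> gl_ideal n" by (simp add: algebra_simps)
  qed
  have "Capelli_span n m (U_class n (p - h))"
  proof (cases m)
    case 0
    then have "p - h = scal 0" using top_symbol_0_eq_0[of "p - h" n] r top_symbol_r by simp
    then show ?thesis using Capelli_span_scal[of n m 0] by (simp add: U_smult_1)
  next
    case (Suc m')
    \<comment> \<open>The tensor \<open>p - h\<close> itself may still contain words of length
      \<open>m\<close>. Only its class drops in the filtration, so the induction continues with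
      another representative \<open>q\<close>.\<close>
    then obtain q where q: "q \<in> tensor_filt n m'" "p - h - q \<in> gl_ideal n"
      using top_symbol_eq_0_lower[of "p - h" n m'] r top_symbol_r unfolding eqmod_def by auto
    have eq: "U_class n (p - h) = U_class n q"
      using q(2) unfolding U_class_eq_iff[OF tensor_filt_carrier[OF r] tensor_filt_carrier[OF q(1)]] .
    then have "U_class n q \<in> zeta_filt n m'"
      using rc q(1) by (auto simp: zeta_filt_def U_filt_eq)
    then have "Capelli_span n m' (U_class n q)" using Suc by (intro less.IH) auto
    then show ?thesis unfolding eq by (rule Capelli_span_mono) (simp add: Suc)
  qed
  moreover have "U_class n p = U_class n h \<oplus>\<^bsub>U n\<^esub> U_class n (p - h)"
    using U_class_simps(1)[OF tensor_filt_carrier[OF h(1)] tensor_filt_carrier[OF r]] by simp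
  ultimately show ?case unfolding z using Capelli_span_add[OF h(2)] by simp
qed

corollary zeta_filt_eq: "zeta_filt n m = Collect (Capelli_span n m)"
  using zeta_filt_Capelli_span Capelli_span_zeta_filt by blast

section \<open>Homomorphisms between the centers\<close>

lemma Capelli_span_central: "Capelli_span n m x \<Longrightarrow> x \<in> carrier (zeta n)"
  using Capelli_span_zeta_filt by (auto simp: zeta_filt_def)

lemma zeta_alg_hom_simps:
  assumes "zeta_alg_hom n n' f"
  shows "f (U_smult n c \<one>\<^bsub>U n\<^esub>) = U_smult n' c \<one>\<^bsub>U n'\<^esub>"
    and "x \<in> carrier (zeta n) \<Longrightarrow> f x \<in> carrier (zeta n')"
    and "x \<in> carrier (zeta n) \<Longrightarrow> y \<in> carrier (zeta n) \<Longrightarrow> f (x \<oplus>\<^bsub>U n\<^esub> y) = f x \<oplus>\<^bsub>U n'\<^esub> f y"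
    and "x \<in> carrier (zeta n) \<Longrightarrow> y \<in> carrier (zeta n) \<Longrightarrow> f (x \<otimes>\<^bsub>U n\<^esub> y) = f x \<otimes>\<^bsub>U n'\<^esub> f y"
proof -
  have hom: "f \<in> Ring.ring_hom (zeta n) (zeta n')"
    and smult: "\<And>c z. z \<in> carrier (zeta n) \<Longrightarrow> f (U_smult n c z) = U_smult n' c (f z)"
    using assms by (auto simp: zeta_alg_hom_def)
  have ops: "x \<oplus>\<^bsub>zeta n\<^esub> y = x \<oplus>\<^bsub>U n\<^esub> y" "x \<otimes>\<^bsub>zeta n\<^esub> y = x \<otimes>\<^bsub>U n\<^esub> y" "\<one>\<^bsub>zeta n\<^esub> = \<one>\<^bsub>U n\<^esub>" for x y n
    by (simp_all add: zeta_def)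
  have "\<one>\<^bsub>U n\<^esub> \<in> carrier (zeta n)"
    using scal_central[of n 1] by (simp add: U_class_1)
  then show "f (U_smult n c \<one>\<^bsub>U n\<^esub>) = U_smult n' c \<one>\<^bsub>U n'\<^esub>"
    using smult ring_hom_one[OF hom] by (simp add: ops)
  show "x \<in> carrier (zeta n) \<Longrightarrow> f x \<in> carrier (zeta n')"
    by (rule ring_hom_closed[OF hom])
  show "x \<in> carrier (zeta n) \<Longrightarrow> y \<in> carrier (zeta n) \<Longrightarrow> f (x \<oplus>\<^bsub>U n\<^esub> y) = f x \<oplus>\<^bsub>U n'\<^esub> f y"
    using ring_hom_add[OF hom, of x y] by (simp add: ops)
  show "x \<in> carrier (zeta n) \<Longrightarrow> y \<in> carrier (zeta n) \<Longrightarrow> f (x \<otimes>\<^bsub>U n\<^esub> y) = f x \<otimes>\<^bsub>U n'\<^esub> f y"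
    using ring_hom_mult[OF hom, of x y] by (simp add: ops)
qed

text \<open>An expression of weight at most \<open>m\<close> contains no Capelli element of larger
  index, so the values of \<open>f\<close> on those with \<open>k \<le> m\<close> control it.
  Indices are preserved there, and with them the weights.\<close>

lemma zeta_alg_hom_Capelli_span:
  assumes f: "zeta_alg_hom n n' f"
    and H: "\<And>k. k \<in> {1..n} \<Longrightarrow> k \<le> m \<Longrightarrow> k \<le> n' \<and> f (Capelli_H n k) = Capelli_H n' k"
    and "Capelli_span n a x" "a \<le> m"
  shows "Capelli_span n' a (f x)"
  using assms(3,4)
proof (induction rule: Capelli_span.induct)
  case (Capelli_span_scal a c)
  show ?case unfolding zeta_alg_hom_simps(1)[OF f] by (rule Capelli_span.Capelli_span_scal)
next
  case (Capelli_span_H k a)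
  then show ?case using H[of k] by (auto intro: Capelli_span.Capelli_span_H)
next
  case (Capelli_span_add a x y)
  then show ?case by (simp add: zeta_alg_hom_simps(3)[OF f] Capelli_span_central Capelli_span.Capelli_span_add)
next
  case (Capelli_span_mult a x b y c)
  have "f (x \<otimes>\<^bsub>U n\<^esub> y) = f x \<otimes>\<^bsub>U n'\<^esub> f y"
    using Capelli_span_central[OF Capelli_span_mult.hyps(1)] Capelli_span_central[OF Capelli_span_mult.hyps(2)] by (rule zeta_alg_hom_simps(4)[OF f])
  then show ?case using Capelli_span.Capelli_span_mult[of n' a "f x" b "f y" c] Capelli_span_mult by simp
qed

text \<open>The composite fixes the scalars and the Capelli elements of weight at most
  \<open>m\<close>, and it respects sums and products of central elements.\<close>

lemma zeta_alg_hom_inverse: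
  assumes f: "zeta_alg_hom n n' f" and g: "zeta_alg_hom n' n g"
    and H: "\<And>k. k \<in> {1..n} \<Longrightarrow> k \<le> m \<Longrightarrow> g (f (Capelli_H n k)) = Capelli_H n k"
    and "Capelli_span n a x" "a \<le> m"
  shows "g (f x) = x"
  using assms(4,5)
proof (induction rule: Capelli_span.induct)
  case (Capelli_span_scal a c)
  show ?case unfolding zeta_alg_hom_simps(1)[OF f] zeta_alg_hom_simps(1)[OF g] ..
next
  case (Capelli_span_H k a)
  then show ?case using H[of k] by auto
next
  case (Capelli_span_add a x y)
  note c = Capelli_span_central[OF Capelli_span_add.hyps(1)] Capelli_span_central[OF Capelli_span_add.hyps(2)]
  note c' = zeta_alg_hom_simps(2)[OF f c(1)] zeta_alg_hom_simps(2)[OF f c(2)]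
  show ?case
    using Capelli_span_add by (simp add: zeta_alg_hom_simps(3)[OF f c] zeta_alg_hom_simps(3)[OF g c'])
next
  case (Capelli_span_mult a x b y d)
  note c = Capelli_span_central[OF Capelli_span_mult.hyps(1)] Capelli_span_central[OF Capelli_span_mult.hyps(2)]
  note c' = zeta_alg_hom_simps(2)[OF f c(1)] zeta_alg_hom_simps(2)[OF f c(2)]
  show ?case
    using Capelli_span_mult by (simp add: zeta_alg_hom_simps(4)[OF f c] zeta_alg_hom_simps(4)[OF g c'])
qed

theorem proposition5p4:
  fixes n m :: nat and \<iota> \<pi> :: "gl_tensor set \<Rightarrow> gl_tensor set"
  assumes "1 \<le> m" and "m \<le> n"
    and "is_Capelli_mono n \<iota>" and "is_Capelli_proj n \<pi>"
  shows "\<pi> ` zeta_filt (n + 1) m \<subseteq> zeta_filt n m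
       \<and> \<iota> ` zeta_filt n m \<subseteq> zeta_filt (n + 1) m
       \<and> (\<forall>z \<in> zeta_filt (n + 1) m. \<iota> (\<pi> z) = z)
       \<and> (\<forall>z \<in> zeta_filt n m. \<pi> (\<iota> z) = z)"
proof -
  have \<iota>: "zeta_alg_hom n (n + 1) \<iota>" "\<And>k. k \<in> {1..n} \<Longrightarrow> \<iota> (Capelli_H n k) = Capelli_H (n + 1) k"
    using assms(3) by (auto simp: is_Capelli_mono_def)
  have \<pi>: "zeta_alg_hom (n + 1) n \<pi>" "\<And>k. k \<in> {1..n} \<Longrightarrow> \<pi> (Capelli_H (n + 1) k) = Capelli_H n k"
    using assms(4) by (auto simp: is_Capelli_proj_def)
  have "Capelli_span n m (\<pi> z)" if "Capelli_span (n + 1) m z" for z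
    by (rule zeta_alg_hom_Capelli_span[OF \<pi>(1) _ that order_refl]) (use \<pi>(2) assms(2) in auto)
  moreover have "Capelli_span (n + 1) m (\<iota> z)" if "Capelli_span n m z" for z
    by (rule zeta_alg_hom_Capelli_span[OF \<iota>(1) _ that order_refl]) (use \<iota>(2) in auto)
  moreover have "\<iota> (\<pi> z) = z" if "Capelli_span (n + 1) m z" for z
    by (rule zeta_alg_hom_inverse[OF \<pi>(1) \<iota>(1) _ that order_refl]) (use \<pi>(2) \<iota>(2) assms(2) in auto)
  moreover have "\<pi> (\<iota> z) = z" if "Capelli_span n m z" for z
    by (rule zeta_alg_hom_inverse[OF \<iota>(1) \<pi>(1) _ that order_refl]) (use \<pi>(2) \<iota>(2) in auto)
  ultimately show ?thesis
    unfolding zeta_filt_eq by blast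
qed

end
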